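(* Let $\varrho=\varrho(\mathbf r)$ be a critical point of the free energy $\mathcal F$ and let $\mu_{\max}\|\boldsymbol Z_2\|_{L^\infty(\Omega)}<1$. Consider the stationary problem $$\nabla\cdot\mathbf a=0,\qquad\big(\boldsymbol 1+\boldsymbol Z_1\star\varrho\big)\mathbf a+\varrho\,(\boldsymbol Z_2\star\mathbf a)=\nabla\varrho+\varrho\nabla V_1^{eq}+\varrho\,(\nabla V_2^{eq}\star\varrho)\ \text{ in }\Omega,\qquad\mathbf a\cdot\mathbf n=0\ \text{ on }\partial\Omega.\qquad(\mathrm S)$$ Then: (1) $\varrho$ is an equilibrium density of the system $(\mathrm S)$. (2) The equilibrium density $\varrho$ is independent of $\boldsymbol Z_1$, $\boldsymbol Z_2$ and, as a consequence, of $\boldsymbol D$. (3) The equilibrium flux solving $(\mathrm S)$ is uniquely $\mathbf a\equiv\mathbf 0$. In particular, there are no stationary densities which are advected by some nonzero flux, and hence the only stationary states of the dynamics are equilibrium states.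
   Context: $\Omega\subset\mathbb R^d$ is a bounded domain with $C^1$ boundary and outward unit normal $\mathbf n$. $V_1^{eq}:\Omega\to\mathbb R$ and $V_2^{eq}$ are time-independent one- and two-body potentials with $V_1^{eq},V_2^{eq}\in H^1(\Omega)$; $\boldsymbol Z_1,\boldsymbol Z_2$ are bounded, real, symmetric $\mathbb R^{d\times d}$-valued two-body kernels. Two-body kernels $K$ are functions of $\mathbf r-\mathbf r'$, $\mathbf r,\mathbf r'\in\Omega$, and $(K\star g)(\mathbf r)=\int_\Omega K(\mathbf r-\mathbf r')g(\mathbf r')\,d\mathbf r'$; $L^\infty$ norms of kernels are suprema over $\mathbf r,\mathbf r'\in\Omega$; $V_2^{eq}$ is even. $\boldsymbol D=\boldsymbol D_\varrho:=(\boldsymbol 1+\boldsymbol Z_1\star\varrho)^{-1}$ is assumed symmetric positive definite, and $\mu_{\max}$ is its largest eigenvalue (supremum over $\mathbf r\in\Omega$). The free energy is $\mathcal F[\varrho]=\int_\Omega\varrho(\log\varrho-1)\,d\mathbf r+\int_\Omega\varrho V_1^{eq}\,d\mathbf r+\frac12\int_\Omega\varrho\,(V_2^{eq}\star\varrho)\,d\mathbf r$, with functional derivative $\frac{\delta\mathcal F}{\delta\varrho}[\varrho]=\log\varrho+V_1^{eq}+V_2^{eq}\star\varrho$; a critical point is a density $\varrho>0$, $\int_\Omega\varrho=1$, with $\frac{\delta\mathcal F}{\delta\varrho}[\varrho]$ equal to a constant. A stationary density (state) is a density $\varrho>0$ for which $(\mathrm S)$ holds with some flux $\mathbf a$; it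 is an equilibrium density (state) if this flux is $\mathbf 0$. The dynamics is the time-dependent evolution of $(\varrho,\mathbf a)$, governed by a continuity equation in divergence form for $\varrho$ with flux $\mathbf a$ and the second equation of $(\mathrm S)$, whose stationary states are the solutions of $(\mathrm S)$. *)

theory Defs
  imports "HOL-Analysis.Analysis"
begin

section \<open>Domains with C1 boundary\<close>

text \<open>Local defining functions: near a boundary point the domain is a strict sublevel set of a C1
  function with nonvanishing gradient, the boundary being its zero set. The outward unit normal at
  a boundary point \<open>y\<close> is then \<open>\<psi>' y /\<^sub>R norm (\<psi>' y)\<close>.\<close>

definition C1_boundary :: "'a::euclidean_space set \<Rightarrow> bool" where
  "C1_boundary \<Omega> \<longleftrightarrow>
     (\<forall>x\<in>frontier \<Omega>. \<exists>U \<psi> \<psi>'. open U \<and> x \<in> U \<and>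
        (\<forall>y\<in>U. GDERIV \<psi> y :> \<psi>' y) \<and> continuous_on U \<psi>' \<and> (\<forall>y\<in>U. \<psi>' y \<noteq> 0) \<and>
        \<Omega> \<inter> U = {y\<in>U. \<psi> y < 0} \<and> frontier \<Omega> \<inter> U = {y\<in>U. \<psi> y = 0})"

definition bounded_C1_domain :: "'a::euclidean_space set \<Rightarrow> bool" where
  "bounded_C1_domain \<Omega> \<longleftrightarrow> open \<Omega> \<and> connected \<Omega> \<and> \<Omega> \<noteq> {} \<and> bounded \<Omega> \<and> C1_boundary \<Omega>"

text \<open>The set on which a two-body function of \<open>r - r'\<close> has to be defined.\<close>

definition diff_set :: "'a::ab_group_add set \<Rightarrow> 'a set" where
  "diff_set \<Omega> = {r - r' | r r'. r \<in> \<Omega> \<and> r' \<in> \<Omega>}"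


section \<open>Weak derivatives and Sobolev functions\<close>

definition L2_on :: "'a::euclidean_space set \<Rightarrow> ('a \<Rightarrow> 'b::euclidean_space) \<Rightarrow> bool" where
  "L2_on \<Omega> f \<longleftrightarrow> f \<in> borel_measurable (lebesgue_on \<Omega>) \<and>
     integrable (lebesgue_on \<Omega>) (\<lambda>x. (norm (f x))\<^sup>2)"

definition locally_integrable_on ::
    "'a::euclidean_space set \<Rightarrow> ('a \<Rightarrow> 'b::euclidean_space) \<Rightarrow> bool" where
  "locally_integrable_on \<Omega> f \<longleftrightarrow>
     (\<forall>K. compact K \<and> K \<subseteq> \<Omega> \<longrightarrow> integrable (lebesgue_on K) f)"

text \<open>Compactly supported C1 test functions \<open>\<phi>\<close>, together with their gradient \<open>\<phi>'\<close>. For first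
  order weak derivatives they are equivalent to smooth ones.\<close>

definition test_function ::
    "'a::euclidean_space set \<Rightarrow> ('a \<Rightarrow> real) \<Rightarrow> ('a \<Rightarrow> 'a) \<Rightarrow> bool" where
  "test_function \<Omega> \<phi> \<phi>' \<longleftrightarrow> (\<forall>x. GDERIV \<phi> x :> \<phi>' x) \<and> continuous_on UNIV \<phi>' \<and>
     (\<exists>K. compact K \<and> K \<subseteq> \<Omega> \<and> (\<forall>x. x \<notin> K \<longrightarrow> \<phi> x = 0))"

definition has_weak_gradient ::
    "'a::euclidean_space set \<Rightarrow> ('a \<Rightarrow> real) \<Rightarrow> ('a \<Rightarrow> 'a) \<Rightarrow> bool" where
  "has_weak_gradient \<Omega> f g \<longleftrightarrow> locally_integrable_on \<Omega> f \<and> locally_integrable_on \<Omega> g \<and>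
     (\<forall>\<phi> \<phi>'. test_function \<Omega> \<phi> \<phi>' \<longrightarrow>
        (LINT x|lebesgue_on \<Omega>. f x *\<^sub>R \<phi>' x) = - (LINT x|lebesgue_on \<Omega>. \<phi> x *\<^sub>R g x))"

text \<open>A representative of the weak gradient, which is unique up to null sets when it exists.\<close>

definition wgrad :: "'a::euclidean_space set \<Rightarrow> ('a \<Rightarrow> real) \<Rightarrow> 'a \<Rightarrow> 'a" where
  "wgrad \<Omega> f = (SOME g. has_weak_gradient \<Omega> f g)"

definition H1 :: "'a::euclidean_space set \<Rightarrow> ('a \<Rightarrow> real) set" where
  "H1 \<Omega> = {f. L2_on \<Omega> f \<and> (\<exists>g. has_weak_gradient \<Omega> f g \<and> L2_on \<Omega> g)}"

definition has_weak_divergence ::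
    "'a::euclidean_space set \<Rightarrow> ('a \<Rightarrow> 'a) \<Rightarrow> ('a \<Rightarrow> real) \<Rightarrow> bool" where
  "has_weak_divergence \<Omega> a f \<longleftrightarrow> locally_integrable_on \<Omega> a \<and> locally_integrable_on \<Omega> f \<and>
     (\<forall>\<phi> \<phi>'. test_function \<Omega> \<phi> \<phi>' \<longrightarrow>
        (LINT x|lebesgue_on \<Omega>. a x \<bullet> \<phi>' x) = - (LINT x|lebesgue_on \<Omega>. f x * \<phi> x))"

text \<open>The condition \<open>a \<bullet> n = 0\<close> on the boundary, for a field \<open>a\<close> in \<open>H(div)\<close>. Its normal trace is
  the functional on (traces of) \<open>H1\<close> functions that Green's formula assigns to the boundary
  integral of \<open>\<phi> (a \<bullet> n)\<close>, namely the integral of \<open>a \<bullet> \<nabla>\<phi> + (div a) \<phi>\<close> over the domain.\<close>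

definition zero_normal_trace :: "'a::euclidean_space set \<Rightarrow> ('a \<Rightarrow> 'a) \<Rightarrow> bool" where
  "zero_normal_trace \<Omega> a \<longleftrightarrow> L2_on \<Omega> a \<and>
     (\<exists>f. L2_on \<Omega> f \<and> has_weak_divergence \<Omega> a f \<and>
        (\<forall>\<phi>\<in>H1 \<Omega>. (LINT x|lebesgue_on \<Omega>. a x \<bullet> wgrad \<Omega> \<phi> x)
                     + (LINT x|lebesgue_on \<Omega>. f x * \<phi> x) = 0))"


section \<open>Two-body kernels and the tensor \<open>D\<close>\<close>

text \<open>The convolution over the domain: \<open>conv\<close> applies a scalar-, vector- or matrix-valued kernel
  to a scalar function, \<open>conv_vec\<close> a matrix-valued kernel to a vector field.\<close>

definition conv :: "'a::euclidean_space set \<Rightarrow> ('a \<Rightarrow> 'b::euclidean_space) \<Rightarrow> ('a \<Rightarrow> real) \<Rightarrow> 'a \<Rightarrow> 'b"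
  where "conv \<Omega> K g r = (LINT r'|lebesgue_on \<Omega>. g r' *\<^sub>R K (r - r'))"

definition conv_vec ::
    "(real^'n) set \<Rightarrow> (real^'n \<Rightarrow> real^'n^'n) \<Rightarrow> (real^'n \<Rightarrow> real^'n) \<Rightarrow> real^'n \<Rightarrow> real^'n" where
  "conv_vec \<Omega> K a r = (LINT r'|lebesgue_on \<Omega>. K (r - r') *v a r')"

definition admissible_kernel :: "(real^'n) set \<Rightarrow> (real^'n \<Rightarrow> real^'n^'n) \<Rightarrow> bool" where
  "admissible_kernel \<Omega> Z \<longleftrightarrow> Z \<in> borel_measurable (lebesgue_on (diff_set \<Omega>)) \<and>
     bounded (Z ` diff_set \<Omega>) \<and> (\<forall>z\<in>diff_set \<Omega>. transpose (Z z) = Z z)"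

text \<open>The supremum norm of a matrix kernel, with respect to the operator (spectral) norm.\<close>

definition kernel_norm :: "(real^'n) set \<Rightarrow> (real^'n \<Rightarrow> real^'n^'n) \<Rightarrow> real" where
  "kernel_norm \<Omega> Z = (SUP z\<in>diff_set \<Omega>. onorm (\<lambda>v. Z z *v v))"

definition resistance ::
    "(real^'n) set \<Rightarrow> (real^'n \<Rightarrow> real^'n^'n) \<Rightarrow> (real^'n \<Rightarrow> real) \<Rightarrow> real^'n \<Rightarrow> real^'n^'n" where
  "resistance \<Omega> Z1 \<rho> r = mat 1 + conv \<Omega> Z1 \<rho> r"

definition D_tensor ::
    "(real^'n) set \<Rightarrow> (real^'n \<Rightarrow> real^'n^'n) \<Rightarrow> (real^'n \<Rightarrow> real) \<Rightarrow> real^'n \<Rightarrow> real^'n^'n" where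
  "D_tensor \<Omega> Z1 \<rho> r = matrix_inv (resistance \<Omega> Z1 \<rho> r)"

definition sym_pos_def :: "real^'n^'n \<Rightarrow> bool" where
  "sym_pos_def A \<longleftrightarrow> transpose A = A \<and> (\<forall>v. v \<noteq> 0 \<longrightarrow> v \<bullet> (A *v v) > 0)"

text \<open>Invertibility is required explicitly because \<^const>\<open>matrix_inv\<close> is an arbitrary matrix on
  singular arguments.\<close>

definition D_sym_pos_def ::
    "(real^'n) set \<Rightarrow> (real^'n \<Rightarrow> real^'n^'n) \<Rightarrow> (real^'n \<Rightarrow> real) \<Rightarrow> bool" where
  "D_sym_pos_def \<Omega> Z1 \<rho> \<longleftrightarrow>
     (\<forall>r\<in>\<Omega>. invertible (resistance \<Omega> Z1 \<rho> r) \<and> sym_pos_def (D_tensor \<Omega> Z1 \<rho> r))"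

definition is_eigenvalue :: "real^'n^'n \<Rightarrow> real \<Rightarrow> bool" where
  "is_eigenvalue A l \<longleftrightarrow> (\<exists>v. v \<noteq> 0 \<and> A *v v = l *\<^sub>R v)"

text \<open>Extended-real valued, so that the supremum over the domain may be infinite; the library
  convention \<open>\<infinity> * 0 = 0\<close> matters only for \<open>Z2 = 0\<close>.\<close>

definition mu_max ::
    "(real^'n) set \<Rightarrow> (real^'n \<Rightarrow> real^'n^'n) \<Rightarrow> (real^'n \<Rightarrow> real) \<Rightarrow> ereal" where
  "mu_max \<Omega> Z1 \<rho> = (SUP r\<in>\<Omega>. SUP l\<in>{l. is_eigenvalue (D_tensor \<Omega> Z1 \<rho> r) l}. ereal l)"


section \<open>Free energy\<close>

text \<open>Probability densities. Weak differentiability is the minimal regularity for which the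
  gradient of \<open>\<rho>\<close> in the stationary equations is a function.\<close>

definition density_on :: "'a::euclidean_space set \<Rightarrow> ('a \<Rightarrow> real) \<Rightarrow> bool" where
  "density_on \<Omega> \<rho> \<longleftrightarrow> integrable (lebesgue_on \<Omega>) \<rho> \<and> (AE r in lebesgue_on \<Omega>. \<rho> r > 0) \<and>
     (LINT r|lebesgue_on \<Omega>. \<rho> r) = 1 \<and> (\<exists>g. has_weak_gradient \<Omega> \<rho> g)"

definition free_energy ::
    "'a::euclidean_space set \<Rightarrow> ('a \<Rightarrow> real) \<Rightarrow> ('a \<Rightarrow> real) \<Rightarrow> ('a \<Rightarrow> real) \<Rightarrow> real" where
  "free_energy \<Omega> V1 V2 \<rho> =
     (LINT r|lebesgue_on \<Omega>. \<rho> r * (ln (\<rho> r) - 1)) + (LINT r|lebesgue_on \<Omega>. \<rho> r * V1 r)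
     + (LINT r|lebesgue_on \<Omega>. \<rho> r * conv \<Omega> V2 \<rho> r) / 2"

text \<open>The functional derivative of \<^const>\<open>free_energy\<close> (for even \<open>V2\<close>).\<close>

definition free_energy_deriv ::
    "'a::euclidean_space set \<Rightarrow> ('a \<Rightarrow> real) \<Rightarrow> ('a \<Rightarrow> real) \<Rightarrow> ('a \<Rightarrow> real) \<Rightarrow> 'a \<Rightarrow> real" where
  "free_energy_deriv \<Omega> V1 V2 \<rho> r = ln (\<rho> r) + V1 r + conv \<Omega> V2 \<rho> r"

text \<open>Critical points under the constraint of unit mass, the constant being the Lagrange
  multiplier.\<close>

definition critical_point ::
    "'a::euclidean_space set \<Rightarrow> ('a \<Rightarrow> real) \<Rightarrow> ('a \<Rightarrow> real) \<Rightarrow> ('a \<Rightarrow> real) \<Rightarrow> bool" where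
  "critical_point \<Omega> V1 V2 \<rho> \<longleftrightarrow> density_on \<Omega> \<rho> \<and>
     (\<exists>c. AE r in lebesgue_on \<Omega>. free_energy_deriv \<Omega> V1 V2 \<rho> r = c)"


section \<open>The stationary problem\<close>

text \<open>The system with a general tensor field \<open>M\<close> in place of \<open>1 + Z1 \<star> \<rho>\<close>, i.e. of the inverse
  of \<open>D\<close>.\<close>

definition solves_system ::
    "(real^'n) set \<Rightarrow> (real^'n \<Rightarrow> real) \<Rightarrow> (real^'n \<Rightarrow> real) \<Rightarrow> (real^'n \<Rightarrow> real^'n^'n) \<Rightarrow>
     (real^'n \<Rightarrow> real^'n^'n) \<Rightarrow> (real^'n \<Rightarrow> real) \<Rightarrow> (real^'n \<Rightarrow> real^'n) \<Rightarrow> bool" where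
  "solves_system \<Omega> V1 V2 M Z2 \<rho> a \<longleftrightarrow>
     L2_on \<Omega> a \<and>
     has_weak_divergence \<Omega> a (\<lambda>_. 0) \<and>
     (AE r in lebesgue_on \<Omega>.
        M r *v a r + \<rho> r *\<^sub>R conv_vec \<Omega> Z2 a r =
        wgrad \<Omega> \<rho> r + \<rho> r *\<^sub>R wgrad \<Omega> V1 r + \<rho> r *\<^sub>R conv \<Omega> (wgrad (diff_set \<Omega>) V2) \<rho> r) \<and>
     zero_normal_trace \<Omega> a"

definition stationary_state ::
    "(real^'n) set \<Rightarrow> (real^'n \<Rightarrow> real) \<Rightarrow> (real^'n \<Rightarrow> real) \<Rightarrow> (real^'n \<Rightarrow> real^'n^'n) \<Rightarrow>
     (real^'n \<Rightarrow> real^'n^'n) \<Rightarrow> (real^'n \<Rightarrow> real) \<Rightarrow> (real^'n \<Rightarrow> real^'n) \<Rightarrow> bool" where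
  "stationary_state \<Omega> V1 V2 Z1 Z2 \<rho> a \<longleftrightarrow>
     density_on \<Omega> \<rho> \<and> solves_system \<Omega> V1 V2 (resistance \<Omega> Z1 \<rho>) Z2 \<rho> a"

definition equilibrium_density ::
    "(real^'n) set \<Rightarrow> (real^'n \<Rightarrow> real) \<Rightarrow> (real^'n \<Rightarrow> real) \<Rightarrow> (real^'n \<Rightarrow> real^'n^'n) \<Rightarrow>
     (real^'n \<Rightarrow> real^'n^'n) \<Rightarrow> (real^'n \<Rightarrow> real) \<Rightarrow> bool" where
  "equilibrium_density \<Omega> V1 V2 Z1 Z2 \<rho> \<longleftrightarrow> stationary_state \<Omega> V1 V2 Z1 Z2 \<rho> (\<lambda>_. 0)"

end

theory Submission
  imports Defs
begin

text \<open>For a critical point, \<open>ln \<rho> = c - U\<close> with \<open>U = V1 + V2 \<star> \<rho>\<close>, so \<open>\<nabla>\<rho> = - \<rho> \<nabla>U\<close>: the driving force of the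
  stationary equation vanishes, and \<open>a = 0\<close> solves it, whatever the tensors in front of the flux are.

  For the converse, let \<open>(\<rho>, a)\<close> be any stationary state, and write \<open>M\<close> for \<open>1 + Z1 \<star> \<rho>\<close>. The equation
  says \<open>M a / \<rho> + Z2 \<star> a = \<nabla>(ln \<rho> + U)\<close>. The flux is divergence free with no normal component, hence
  orthogonal to gradients, so \<open>\<integral> a \<bullet> M a / \<rho> = - \<integral> a \<bullet> (Z2 \<star> a)\<close>. By Cauchy-Schwarz and
  \<open>\<integral> \<rho> = 1\<close> the right-hand side is at most \<open>\<parallel>Z2\<parallel> (\<integral> |a|)\<^sup>2 \<le> \<parallel>Z2\<parallel> \<integral> |a|\<^sup>2 / \<rho>\<close>, while the left-hand
  side is at least \<open>\<integral> |a|\<^sup>2 / \<rho>\<close> divided by the supremum of the eigenvalues of \<open>D = M\<^sup>-\<^sup>1\<close>. The smallness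
  assumption makes the two compatible only for \<open>a = 0\<close>.

  Both arguments need care because \<open>\<rho>\<close> is only an integrable function with a weak gradient, and may be
  bounded neither above nor away from zero. First, \<open>ln\<close> and \<open>exp\<close> have unbounded derivatives, whereas the
  chain rule is proved, by mollification, for \<open>C1\<close> functions with bounded derivative
  (\<open>weak_chain_rule\<close>). However, \<open>\<nabla>\<rho> = - \<rho> \<nabla>U\<close> follows by computing the gradient of \<open>ln (\<rho>\<^sup>2 + 1) / 2\<close> twice, as
  a function of \<open>\<rho>\<close> and of \<open>ln \<rho>\<close>, and using that weak gradients are unique
  (\<open>critical_gradient\<close>). Second, \<open>ln \<rho> + U\<close> need not be an \<open>H1\<close> function, so it is replaced by
  \<open>ln (\<rho>\<^sup>2 + \<epsilon>) / 2 + U\<close>. The equation itself shows that this function has a square-integrable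
  gradient, and monotone convergence as \<open>\<epsilon> \<longrightarrow> 0\<close> yields both the integrability of
  \<open>a \<bullet> M a / \<rho>\<close> and the energy identity (\<open>stationary_flux_zero\<close>). That \<open>V2 \<star> \<rho>\<close> is in \<open>H1\<close>, with gradient
  \<open>\<nabla>V2 \<star> \<rho>\<close>, is Fubini's theorem (\<open>has_weak_gradient_conv\<close>) and Young's inequality (\<open>L2_on_conv\<close>).\<close>

section \<open>Borel representatives of Lebesgue measurable functions\<close>

text \<open>Fubini's theorem for convolutions concerns Borel functions, whereas the integrals in question are
  over restrictions of the completed measure. Extending by zero and changing the function on a null set
  passes from the second setting to the first.\<close>

lemma borel_representative:
  fixes f :: "'a::euclidean_space \<Rightarrow> 'b::euclidean_space"
  assumes S: "S \<in> sets lebesgue" and f: "f \<in> borel_measurable (lebesgue_on S)"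
  obtains F where "F \<in> borel_measurable borel" "AE x in lborel. F x = indicator S x *\<^sub>R f x"
proof -
  define g where "g = (\<lambda>x. indicator S x *\<^sub>R f x)"
  have g: "g \<in> borel_measurable lebesgue"
    using borel_measurable_if_I[OF f S] by (simp add: g_def indicator_scaleR_eq_if)
  have "\<exists>F\<in>borel_measurable lborel. AE x in lborel. g x \<bullet> b = F x" for b
    by (rule completion_ex_borel_measurable_real) (use g in measurable)
  then obtain F where F: "\<And>b. F b \<in> borel_measurable lborel" "\<And>b. AE x in lborel. g x \<bullet> b = F b x"
    by metis
  show thesis
  proof
    show "(\<lambda>x. \<Sum>b\<in>Basis. F b x *\<^sub>R b) \<in> borel_measurable borel"
      using F(1) by simp
    have "AE x in lborel. \<forall>b\<in>Basis. g x \<bullet> b = F b x"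
      by (rule AE_finite_allI) (use F(2) in auto)
    then show "AE x in lborel. (\<Sum>b\<in>Basis. F b x *\<^sub>R b) = indicator S x *\<^sub>R f x"
    proof eventually_elim
      case (elim x)
      then have "(\<Sum>b\<in>Basis. F b x *\<^sub>R b) = (\<Sum>b\<in>Basis. (g x \<bullet> b) *\<^sub>R b)" by simp
      also have "\<dots> = g x" by (rule euclidean_representation)
      finally show ?case by (simp only: g_def)
    qed
  qed
qed

lemma lebesgue_on_eq_lborel:
  fixes f :: "'a::euclidean_space \<Rightarrow> 'b::euclidean_space"
  assumes S: "S \<in> sets lebesgue" and F: "F \<in> borel_measurable borel"
    and eq: "AE x in lborel. F x = indicator S x *\<^sub>R f x"
  shows "f \<in> borel_measurable (lebesgue_on S)"
    and "(LINT x|lebesgue_on S. f x) = (LINT x|lborel. F x)"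
    and "integrable (lebesgue_on S) f \<longleftrightarrow> integrable lborel F"
proof -
  have F': "F \<in> borel_measurable lborel" "F \<in> borel_measurable lebesgue"
    using F by (auto intro: measurable_completion)
  have eq': "AE x in lebesgue. F x = indicator S x *\<^sub>R f x"
    using eq by (rule AE_completion)
  have m: "(\<lambda>x. indicator S x *\<^sub>R f x) \<in> borel_measurable lebesgue"
    by (rule borel_measurable_AE[OF F'(2) eq'])
  show "f \<in> borel_measurable (lebesgue_on S)"
    using m S by (intro borel_measurable_if_D) (simp add: indicator_scaleR_eq_if)
  show "(LINT x|lebesgue_on S. f x) = (LINT x|lborel. F x)"
    using S integral_cong_AE[OF F'(2) m eq'] integral_completion[OF F'(1)] by (simp add: integral_restrict_space)
  show "integrable (lebesgue_on S) f \<longleftrightarrow> integrable lborel F"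
    using S integrable_cong_AE[OF F'(2) m eq'] integrable_completion[OF F'(1)] by (simp add: integrable_restrict_space)
qed

lemma integrable_representative:
  fixes f :: "'a::euclidean_space \<Rightarrow> 'b::euclidean_space"
  assumes S: "S \<in> sets lebesgue" and f: "integrable (lebesgue_on S) f"
  obtains F where "F \<in> borel_measurable borel" "integrable lborel F" "AE x in lborel. F x = indicator S x *\<^sub>R f x"
proof -
  obtain F where F: "F \<in> borel_measurable borel" "AE x in lborel. F x = indicator S x *\<^sub>R f x"
    by (rule borel_representative[OF S borel_measurable_integrable[OF f]]) (rule that)
  then show thesis using that lebesgue_on_eq_lborel(3)[OF S F] f by blast
qed

section \<open>Continuity of translations and approximate identities\<close>

lemma distr_lborel_diff: "distr lborel borel (\<lambda>y. x - y) = (lborel :: 'a::euclidean_space measure)"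
  using lborel_affine[of "-1" x] by (simp add: density_1)

lemma distr_lborel_plus: "distr lborel borel (\<lambda>y. y + x) = (lborel :: 'a::euclidean_space measure)"
  using lborel_affine[of 1 x] by (simp add: density_1 add.commute)

text \<open>The exceptional set need not be measurable, so the null set covering it is pulled back.\<close>

lemma AE_distr_lborel:
  assumes T: "T \<in> borel_measurable borel" "distr lborel borel T = lborel"
    and P: "AE x in lborel. P x"
  shows "AE y in lborel. P (T y)"
proof -
  from P obtain N where N: "{x\<in>space lborel. \<not> P x} \<subseteq> N" "N \<in> sets lborel" "emeasure lborel N = 0"
    by (rule AE_E)
  then have "AE x in distr lborel borel T. x \<notin> N" unfolding T(2) by (intro AE_not_in) (simp add: null_sets_def)
  then have "AE y in lborel. T y \<notin> N" using T(1) N(2) by (subst (asm) AE_distr_iff) auto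
  then show ?thesis by eventually_elim (use N in auto)
qed

lemma AE_lborel_diff: "AE x in lborel. P x \<Longrightarrow> AE y in lborel. P (x - y)" for x :: "'a::euclidean_space"
  by (rule AE_distr_lborel[OF _ distr_lborel_diff]) auto

lemma lborel_integral_diff:
  fixes f :: "'a::euclidean_space \<Rightarrow> 'b::{banach, second_countable_topology}"
  assumes "f \<in> borel_measurable borel"
  shows "(LINT y|lborel. f (x - y)) = integral\<^sup>L lborel f"
    "integrable lborel (\<lambda>y. f (x - y)) \<longleftrightarrow> integrable lborel f"
  using integral_distr[of "\<lambda>y. x - y" lborel borel f] integrable_distr_eq[of "\<lambda>y. x - y" lborel borel f] assms
  by (simp_all add: distr_lborel_diff)

lemma lborel_integral_plus:
  fixes f :: "'a::euclidean_space \<Rightarrow> 'b::{banach, second_countable_topology}"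
  assumes "f \<in> borel_measurable borel"
  shows "(LINT y|lborel. f (y + x)) = integral\<^sup>L lborel f"
    "integrable lborel (\<lambda>y. f (y + x)) \<longleftrightarrow> integrable lborel f"
  using integral_distr[of "\<lambda>y. y + x" lborel borel f] integrable_distr_eq[of "\<lambda>y. y + x" lborel borel f] assms
  by (simp_all add: distr_lborel_plus)

lemma lborel_nn_integral_plus:
  fixes f :: "'a::euclidean_space \<Rightarrow> ennreal"
  assumes "f \<in> borel_measurable borel"
  shows "(\<integral>\<^sup>+y. f (y + x) \<partial>lborel) = integral\<^sup>N lborel f"
  using nn_integral_distr[of "\<lambda>y. y + x" lborel borel f] assms
  by (simp add: distr_lborel_plus)

text \<open>By regularity, squeeze \<open>A\<close> between a compact \<open>K\<close> and an open \<open>U\<close> that are close to it in measure. A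
  small translation keeps \<open>K\<close> inside \<open>U\<close>, so only points of \<open>U - A\<close> and \<open>A - K\<close> and of their
  translates can change their membership of \<open>A\<close>.\<close>

lemma indicator_translation_continuous:
  fixes A :: "'a::euclidean_space set"
  assumes A: "A \<in> sets lborel" "emeasure lborel A < \<infinity>" and e: "e > 0"
  shows "\<exists>d>0. \<forall>y. norm y < d \<longrightarrow> (\<integral>\<^sup>+x. ennreal (norm (indicator A (x - y) - indicator A x :: real)) \<partial>lborel) \<le> ennreal e"
proof -
  let ?n = "\<lambda>x y. ennreal (norm (indicator A (x - y) - indicator A x :: real))"
  have AL: "A \<in> sets lebesgue" using A by simp
  obtain U where U: "open U" "A \<subseteq> U" "emeasure lebesgue (U - A) < ennreal (e/4)"
    by (rule sets_lebesgue_outer_open[OF AL, of "e/4"]) (use e in simp_all)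
  obtain C where C: "closed C" "C \<subseteq> A" "emeasure lebesgue (A - C) < ennreal (e/4)"
    by (rule sets_lebesgue_inner_closed[OF AL, of "e/4"]) (use e in simp_all)
  have [measurable]: "A \<in> sets borel" "U \<in> sets borel" "C \<in> sets borel" using A U C by auto
  have U3: "emeasure lborel (U - A) < ennreal (e/4)" using U by simp
  have C3: "emeasure lborel (A - C) < ennreal (e/4)" using C by simp
  obtain K where K: "compact K" "K \<subseteq> A" "emeasure lborel (A - K) \<le> ennreal (e/4)"
  proof -
    define B where "B n = C \<inter> cball 0 (real n)" for n
    have "(\<lambda>n. emeasure lborel (A - B n)) \<longlonglongrightarrow> emeasure lborel (\<Inter>n. A - B n)"
    proof (rule Lim_emeasure_decseq)
      show "range (\<lambda>n. A - B n) \<subseteq> sets lborel" by (auto simp: B_def)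
      show "decseq (\<lambda>n. A - B n)" by (force simp: decseq_def B_def)
      fix n have "emeasure lborel (A - B n) \<le> emeasure lborel A" by (rule emeasure_mono) (auto simp: B_def)
      then show "emeasure lborel (A - B n) \<noteq> \<infinity>" using A(2) by auto
    qed
    moreover have "(\<Inter>n. A - B n) = A - C"
    proof -
      have "x \<notin> C" if "\<forall>n. x \<notin> B n" for x
        using that real_arch_simple[of "norm x"] by (auto simp: B_def)
      then show ?thesis using real_arch_simple by (auto simp: B_def)
    qed
    ultimately have "(\<lambda>n. emeasure lborel (A - B n)) \<longlonglongrightarrow> emeasure lborel (A - C)" by simp
    then have "eventually (\<lambda>n. emeasure lborel (A - B n) < ennreal (e/4)) sequentially"
      using C3 by (rule order_tendstoD)
    then obtain n where n: "emeasure lborel (A - B n) < ennreal (e/4)"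
      by (auto simp: eventually_sequentially)
    show thesis
    proof
      show "compact (B n)" unfolding B_def using C(1) by (intro closed_Int_compact) auto
      show "B n \<subseteq> A" using C by (auto simp: B_def)
      show "emeasure lborel (A - B n) \<le> ennreal (e/4)"
        using n by simp
    qed
  qed
  have [measurable]: "K \<in> sets borel" using K(1) by (rule borel_compact)
  obtain d where d: "d > 0" "(\<Union>x\<in>K. ball x d) \<subseteq> U"
    using compact_subset_open_imp_ball_epsilon_subset[of K U] K U by blast
  show ?thesis
  proof (intro exI[of _ d] conjI allI impI d(1))
    fix y :: 'a assume y: "norm y < d"
    have near: "x - y \<in> U" "x + y \<in> U" if "x \<in> K" for x
    proof -
      have "x - y \<in> ball x d" "x + y \<in> ball x d" using y by (auto simp: dist_norm)
      then show "x - y \<in> U" "x + y \<in> U" using d(2) that by blast+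
    qed
    \<comment> \<open>if exactly one of \<open>x\<close> and \<open>x - y\<close> is in \<open>A\<close>, then that point is outside \<open>K\<close> or the other one is inside \<open>U\<close>\<close>
    have pt: "norm (indicator A (x - y) - indicator A x :: real)
       \<le> indicator (A - K) (x + (- y)) + indicator (A - K) x + (indicator (U - A) x + indicator (U - A) (x + (- y)))" for x
      using near[of x] near[of "x - y"] K(2) U(2) by (auto simp: indicator_def)
    have "(\<integral>\<^sup>+x. ?n x y \<partial>lborel)
      \<le> (\<integral>\<^sup>+x. (indicator (A - K) (x + (- y)) + indicator (A - K) x) + (indicator (U - A) x + indicator (U - A) (x + (- y))) \<partial>lborel)"
    proof (rule nn_integral_mono)
      fix x
      have "?n x y \<le>
        ennreal (indicator (A - K) (x + (- y)) + indicator (A - K) x + (indicator (U - A) x + indicator (U - A) (x + (- y))))"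
        by (rule ennreal_leI[OF pt])
      then show "?n x y \<le>
        (indicator (A - K) (x + (- y)) + indicator (A - K) x) + (indicator (U - A) x + indicator (U - A) (x + (- y)))"
        by (simp add: ennreal_indicator)
    qed
    also have "\<dots> = (emeasure lborel (A - K) + emeasure lborel (A - K)) + (emeasure lborel (U - A) + emeasure lborel (U - A))"
      using lborel_nn_integral_plus[of "indicator (A - K)" "- y"] lborel_nn_integral_plus[of "indicator (U - A)" "- y"]
      by (simp add: nn_integral_add)
    also have "\<dots> \<le> (ennreal (e/4) + ennreal (e/4)) + (ennreal (e/4) + ennreal (e/4))"
      using K(3) U3 by (intro add_mono) auto
    also have "\<dots> = ennreal e" using e by (simp flip: ennreal_plus)
    finally show "(\<integral>\<^sup>+x. ?n x y \<partial>lborel) \<le> ennreal e" .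
  qed
qed

text \<open>The property holds for indicator functions and survives sums and \<open>L1\<close> limits, because translations
  preserve the \<open>L1\<close> norm.\<close>

lemma L1_translation_continuous:
  fixes f :: "'a::euclidean_space \<Rightarrow> 'b::{banach, second_countable_topology}"
  assumes f: "integrable lborel f"
  shows "\<forall>e>0. \<exists>d>0. \<forall>y. norm y < d \<longrightarrow> (\<integral>\<^sup>+x. ennreal (norm (f (x - y) - f x)) \<partial>lborel) \<le> ennreal e"
  using f
proof (induction rule: integrable_induct)
  case (base A c)
  let ?I = "\<lambda>y. \<integral>\<^sup>+x. ennreal (norm (indicator A (x - y) - indicator A x :: real)) \<partial>lborel"
  let ?T = "\<lambda>f y. \<integral>\<^sup>+x. ennreal (norm ((f :: 'a \<Rightarrow> 'b) (x - y) - f x)) \<partial>lborel"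
  show ?case
  proof (intro allI impI)
    fix e :: real assume e: "e > 0"
    define e' where "e' = e / (norm c + 1)"
    have e': "e' > 0" using e by (simp add: e'_def add_nonneg_pos)
    obtain d where d: "d > 0" "\<And>y. norm y < d \<Longrightarrow> ?I y \<le> ennreal e'"
      using indicator_translation_continuous[of A e'] base e' by auto
    have [measurable]: "A \<in> sets borel" using base by simp
    show "\<exists>d>0. \<forall>y. norm y < d \<longrightarrow> ?T (\<lambda>x. indicator A x *\<^sub>R c) y \<le> ennreal e"
    proof (intro exI[of _ d] conjI allI impI d(1))
      fix y :: 'a assume y: "norm y < d"
      have "?T (\<lambda>x. indicator A x *\<^sub>R c) y
        = (\<integral>\<^sup>+x. ennreal (norm c) * ennreal (norm (indicator A (x - y) - indicator A x :: real)) \<partial>lborel)"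
        by (intro nn_integral_cong) (simp flip: scaleR_diff_left ennreal_mult add: mult.commute)
      also have "\<dots> = ennreal (norm c) * ?I y"
        by (rule nn_integral_cmult) measurable
      also have "\<dots> \<le> ennreal (norm c) * ennreal e'"
        using d(2)[OF y] by (intro mult_left_mono) auto
      also have "\<dots> = ennreal (norm c * e')" using e' by (simp add: ennreal_mult)
      also have "\<dots> \<le> ennreal e"
        using e mult_left_mono[of "norm c" "norm c + 1" e]
        by (intro ennreal_leI) (simp add: e'_def pos_divide_le_eq add_nonneg_pos mult.commute)
      finally show "?T (\<lambda>x. indicator A x *\<^sub>R c) y \<le> ennreal e" .
    qed
  qed
next
  case (add f g)
  let ?T = "\<lambda>f y. \<integral>\<^sup>+x. ennreal (norm ((f :: 'a \<Rightarrow> 'b) (x - y) - f x)) \<partial>lborel"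
  have [measurable]: "f \<in> borel_measurable borel" "g \<in> borel_measurable borel" using add by auto
  show ?case
  proof (intro allI impI)
    fix e :: real assume e: "e > 0"
    obtain d1 where d1: "d1 > 0" "\<And>y. norm y < d1 \<Longrightarrow> ?T f y \<le> ennreal (e/2)"
      using add.IH(1) e half_gt_zero by blast
    obtain d2 where d2: "d2 > 0" "\<And>y. norm y < d2 \<Longrightarrow> ?T g y \<le> ennreal (e/2)"
      using add.IH(2) e half_gt_zero by blast
    show "\<exists>d>0. \<forall>y. norm y < d \<longrightarrow> ?T (\<lambda>x. f x + g x) y \<le> ennreal e"
    proof (intro exI[of _ "min d1 d2"] conjI allI impI)
      fix y :: 'a assume y: "norm y < min d1 d2"
      have "?T (\<lambda>x. f x + g x) y
        \<le> (\<integral>\<^sup>+x. ennreal (norm (f (x - y) - f x)) + ennreal (norm (g (x - y) - g x)) \<partial>lborel)"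
        by (intro nn_integral_mono) (simp flip: ennreal_plus add: norm_diff_triangle_ineq)
      also have "\<dots> \<le> ennreal (e/2) + ennreal (e/2)"
        using d1(2)[of y] d2(2)[of y] y by (subst nn_integral_add) (auto intro!: add_mono)
      also have "\<dots> = ennreal e" using e by (simp flip: ennreal_plus)
      finally show "?T (\<lambda>x. f x + g x) y \<le> ennreal e" .
    qed (use d1 d2 in auto)
  qed
next
  case (lim f s)
  let ?T = "\<lambda>f y. \<integral>\<^sup>+x. ennreal (norm ((f :: 'a \<Rightarrow> 'b) (x - y) - f x)) \<partial>lborel"
  have [measurable]: "f \<in> borel_measurable borel" "\<And>i. s i \<in> borel_measurable borel" using lim by auto
  show ?case
  proof (intro allI impI)
    fix e :: real assume e: "e > 0"
    have "(\<lambda>i. \<integral>\<^sup>+x. ennreal (norm (s i x - f x)) \<partial>lborel) \<longlonglongrightarrow> 0"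
    proof -
      have "(\<lambda>i. LINT x|lborel. norm (s i x - f x)) \<longlonglongrightarrow> (LINT (x::'a)|lborel. (0::real))"
      proof (rule integral_dominated_convergence[where w="\<lambda>x. 3 * norm (f x)"])
        show "AE x in lborel. (\<lambda>i. norm (s i x - f x)) \<longlonglongrightarrow> 0"
          using lim.hyps(2) by (auto intro!: AE_I2 tendsto_norm_zero LIM_zero)
        fix i
        have "norm (s i x - f x) \<le> 3 * norm (f x)" for x
          using norm_triangle_ineq4[of "s i x" "f x"] lim.hyps(3)[of x i] by simp
        then show "AE x in lborel. norm (norm (s i x - f x)) \<le> 3 * norm (f x)" by auto
      qed (use lim in auto)
      then have "(\<lambda>i. ennreal (LINT x|lborel. norm (s i x - f x))) \<longlonglongrightarrow> ennreal 0" by (intro tendsto_ennrealI) simp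
      moreover have "(\<integral>\<^sup>+x. ennreal (norm (s i x - f x)) \<partial>lborel) = ennreal (LINT x|lborel. norm (s i x - f x))" for i
        using lim by (intro nn_integral_eq_integral) auto
      ultimately show ?thesis by simp
    qed
    then have "eventually (\<lambda>i. (\<integral>\<^sup>+x. ennreal (norm (s i x - f x)) \<partial>lborel) < ennreal (e/3)) sequentially"
      by (rule order_tendstoD) (use e in auto)
    then obtain i where i: "(\<integral>\<^sup>+x. ennreal (norm (s i x - f x)) \<partial>lborel) < ennreal (e/3)"
      by (auto simp: eventually_sequentially)
    obtain d where d: "d > 0" "\<And>y. norm y < d \<Longrightarrow> ?T (s i) y \<le> ennreal (e/3)"
      using lim.IH[of i] e by (meson divide_pos_pos zero_less_numeral)
    show "\<exists>d>0. \<forall>y. norm y < d \<longrightarrow> ?T f y \<le> ennreal e"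
    proof (intro exI[of _ d] conjI allI impI d(1))
      fix y :: 'a assume y: "norm y < d"
      have shift: "(\<integral>\<^sup>+x. ennreal (norm (s i (x - y) - f (x - y))) \<partial>lborel) = (\<integral>\<^sup>+x. ennreal (norm (s i x - f x)) \<partial>lborel)"
        using lborel_nn_integral_plus[of "\<lambda>x. ennreal (norm (s i x - f x))" "- y"] by simp
      have tri: "norm (f (x - y) - f x) \<le> norm (s i (x - y) - f (x - y)) + (norm (s i (x - y) - s i x) + norm (s i x - f x))" for x
        using norm_triangle_ineq[of "s i (x - y) - s i x" "s i x - f x"]
          norm_triangle_ineq4[of "s i (x - y) - f x" "s i (x - y) - f (x - y)"] by simp
      have "?T f y
        \<le> (\<integral>\<^sup>+x. ennreal (norm (s i (x - y) - f (x - y))) + (ennreal (norm (s i (x - y) - s i x)) + ennreal (norm (s i x - f x))) \<partial>lborel)"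
        by (intro nn_integral_mono) (simp flip: ennreal_plus add: tri)
      also have "\<dots> \<le> ennreal (e/3) + (ennreal (e/3) + ennreal (e/3))"
        using d(2)[OF y] i shift by (simp add: nn_integral_add) (intro add_mono; simp)
      also have "\<dots> = ennreal e" using e by (simp flip: ennreal_plus)
      finally show "?T f y \<le> ennreal e" .
    qed
  qed
qed

definition convolution :: "('a::euclidean_space \<Rightarrow> real) \<Rightarrow> ('a \<Rightarrow> 'b::{banach, second_countable_topology}) \<Rightarrow> 'a \<Rightarrow> 'b"
  where "convolution w f x = (LINT y|lborel. w y *\<^sub>R f (x - y))"

context
  fixes w :: "'a::euclidean_space \<Rightarrow> real" and f :: "'a \<Rightarrow> 'b::{banach, second_countable_topology}"
  assumes w: "integrable lborel w" and f: "integrable lborel f"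
begin

lemma convolution_pair_integrable: "integrable (lborel \<Otimes>\<^sub>M lborel) (\<lambda>(x, y). w y *\<^sub>R f (x - y))"
proof -
  have [measurable]: "w \<in> borel_measurable borel" "f \<in> borel_measurable borel"
    using w f by auto
  have "integrable (lborel \<Otimes>\<^sub>M lborel) (\<lambda>(y, x). w y *\<^sub>R f (x - y))"
  proof (rule lborel_pair.Fubini_integrable)
    have "integrable lborel (\<lambda>x. f (x - y))" for y
      using lborel_integral_plus(2)[of f "- y"] f by simp
    then show "AE y in lborel. integrable lborel (\<lambda>x. case (y, x) of (y, x) \<Rightarrow> w y *\<^sub>R f (x - y))"
      by auto
    have "(LINT x|lborel. norm (f (x - y))) = (LINT x|lborel. norm (f x))" for y
      using lborel_integral_plus(1)[of "\<lambda>x. norm (f x)" "- y"] by simp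
    then show "integrable lborel (\<lambda>y. LINT x|lborel. norm (case (y, x) of (y, x) \<Rightarrow> w y *\<^sub>R f (x - y)))"
      using w by (simp del: Bochner_Integration.integral_mult_right_zero add: integral_mult_right_zero)
  qed measurable
  then show ?thesis by (subst lborel_pair.integrable_product_swap_iff[symmetric]) (simp add: case_prod_beta')
qed

lemma convolution_AE_integrable: "AE x in lborel. integrable lborel (\<lambda>y. w y *\<^sub>R f (x - y))"
  by (rule lborel_pair.AE_integrable_fst) (rule convolution_pair_integrable)

lemma convolution_integrable: "integrable lborel (convolution w f)"
  unfolding convolution_def[abs_def] by (rule lborel_pair.integrable_fst) (rule convolution_pair_integrable)

end

lemma convolution_commute:
  fixes w :: "'a::euclidean_space \<Rightarrow> real"
  assumes [measurable]: "w \<in> borel_measurable borel" "f \<in> borel_measurable borel"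
  shows "convolution w f x = (LINT y|lborel. w (x - y) *\<^sub>R f y)"
  unfolding convolution_def using lborel_integral_diff(1)[of "\<lambda>y. w (x - y) *\<^sub>R f y" x] by simp

text \<open>The error is the average of \<open>f (x - y) - f x\<close> over the small \<open>y\<close> in the support of \<open>w n\<close>; its \<open>L1\<close> norm
  is at most the same average of the \<open>L1\<close> norms of \<open>f (\<cdot> - y) - f\<close>, which tend to zero with \<open>y\<close>.\<close>

lemma approximate_identity:
  fixes f :: "'a::euclidean_space \<Rightarrow> 'b::{banach, second_countable_topology}"
  assumes f: "integrable lborel f"
    and w: "\<And>n. integrable lborel (w n)" "\<And>n x. w n x \<ge> 0" "\<And>n. (LINT x|lborel. w n x) = 1"
    and supp: "\<And>n x. w n x \<noteq> 0 \<Longrightarrow> norm x \<le> r n" and r: "r \<longlonglongrightarrow> 0"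
  shows "(\<lambda>n. LINT x|lborel. norm (convolution (w n) f x - f x)) \<longlonglongrightarrow> 0"
proof (rule LIMSEQ_I)
  fix e :: real assume e: "e > 0"
  have [measurable]: "f \<in> borel_measurable borel" "\<And>n. w n \<in> borel_measurable borel"
    using f w(1) by auto
  obtain d where d: "d > 0" "\<And>y. norm y < d \<Longrightarrow> (\<integral>\<^sup>+x. ennreal (norm (f (x - y) - f x)) \<partial>lborel) \<le> ennreal (e/2)"
    using L1_translation_continuous[OF f] e half_gt_zero by blast
  have "eventually (\<lambda>n. r n < d) sequentially" using r d(1) by (rule order_tendstoD)
  then obtain n0 where n0: "\<And>n. n \<ge> n0 \<Longrightarrow> r n < d" by (auto simp: eventually_sequentially)
  show "\<exists>n0. \<forall>n\<ge>n0. norm ((LINT x|lborel. norm (convolution (w n) f x - f x)) - 0) < e"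
  proof (intro exI[of _ n0] allI impI)
    fix n assume n: "n \<ge> n0"
    have int: "integrable lborel (\<lambda>x. norm (convolution (w n) f x - f x))"
      using convolution_integrable[OF w(1) f] f by auto
    have "ennreal (LINT x|lborel. norm (convolution (w n) f x - f x)) =
      (\<integral>\<^sup>+x. ennreal (norm (convolution (w n) f x - f x)) \<partial>lborel)"
      using int by (intro nn_integral_eq_integral[symmetric]) auto
    also have "\<dots> \<le> (\<integral>\<^sup>+x. (\<integral>\<^sup>+y. ennreal (w n y) * ennreal (norm (f (x - y) - f x)) \<partial>lborel) \<partial>lborel)"
    proof (rule nn_integral_mono_AE)
      show "AE x in lborel. ennreal (norm (convolution (w n) f x - f x))
         \<le> (\<integral>\<^sup>+y. ennreal (w n y) * ennreal (norm (f (x - y) - f x)) \<partial>lborel)"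
        using convolution_AE_integrable[OF w(1) f, of n]
      proof eventually_elim
        case (elim x)
        have i2: "integrable lborel (\<lambda>y. w n y *\<^sub>R f x)" using w(1) by simp
        have "convolution (w n) f x - f x = (LINT y|lborel. w n y *\<^sub>R f (x - y)) - (LINT y|lborel. w n y *\<^sub>R f x)"
          using w by (simp add: convolution_def)
        also have "\<dots> = (LINT y|lborel. w n y *\<^sub>R (f (x - y) - f x))"
          using elim i2 by (simp add: scaleR_diff_right)
        finally have eq: "convolution (w n) f x - f x = \<dots>" .
        have "integrable lborel (\<lambda>y. w n y *\<^sub>R (f (x - y) - f x))"
          using elim i2 by (simp add: scaleR_diff_right)
        from integral_norm_bound_ennreal[OF this] show ?case
          unfolding eq using w(2) by (simp add: ennreal_mult)
      qed
    qed
    also have "\<dots> = (\<integral>\<^sup>+y. (\<integral>\<^sup>+x. ennreal (w n y) * ennreal (norm (f (x - y) - f x)) \<partial>lborel) \<partial>lborel)"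
      by (rule lborel_pair.Fubini'[symmetric]) measurable
    also have "\<dots> \<le> (\<integral>\<^sup>+y. ennreal (w n y) * ennreal (e/2) \<partial>lborel)"
    proof (rule nn_integral_mono)
      fix y
      show "(\<integral>\<^sup>+x. ennreal (w n y) * ennreal (norm (f (x - y) - f x)) \<partial>lborel) \<le> ennreal (w n y) * ennreal (e/2)"
      proof (cases "w n y = 0")
        case False
        then have "norm y < d" using supp[of n y] n0[OF n] by auto
        then show ?thesis using d(2)[of y] by (simp add: nn_integral_cmult mult_left_mono)
      qed simp
    qed
    also have "\<dots> = ennreal (e/2)"
      using w nn_integral_eq_integral[OF w(1)] e by (simp add: nn_integral_multc)
    finally have "(LINT x|lborel. norm (convolution (w n) f x - f x)) \<le> e/2"
      using e by (subst (asm) ennreal_le_iff) auto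
    moreover have "(LINT x|lborel. norm (convolution (w n) f x - f x)) \<ge> 0" by simp
    ultimately show "norm ((LINT x|lborel. norm (convolution (w n) f x - f x)) - 0) < e" using e by simp
  qed
qed

section \<open>A mollifier with Lipschitz gradient\<close>

lemma integrable_continuous_compact_support:
  fixes f :: "'a::euclidean_space \<Rightarrow> 'b::{banach, second_countable_topology}"
  assumes f: "continuous_on UNIV f" and K: "compact K" "\<And>x. x \<notin> K \<Longrightarrow> f x = 0"
  shows "integrable lborel f"
proof -
  have "integrable lborel (\<lambda>x. indicator K x *\<^sub>R f x)"
    using K(1) f by (intro borel_integrable_compact) (auto intro: continuous_on_subset)
  also have "(\<lambda>x. indicator K x *\<^sub>R f x) = f"
    using K(2) by (auto simp: indicator_def)
  finally show ?thesis .
qed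

lemma bounded_continuous_compact_support:
  fixes f :: "'a::euclidean_space \<Rightarrow> 'b::real_normed_vector"
  assumes f: "continuous_on UNIV f" and K: "compact K" "\<And>x. x \<notin> K \<Longrightarrow> f x = 0"
  obtains B where "B > 0" "\<And>x. norm (f x) \<le> B"
proof -
  have "compact (f ` K)" using f K(1) by (intro compact_continuous_image) (auto intro: continuous_on_subset)
  then have "bounded (f ` K)" by (rule compact_imp_bounded)
  then obtain B where B: "B > 0" "\<And>x. x \<in> K \<Longrightarrow> norm (f x) \<le> B" by (auto simp: bounded_pos)
  then have "norm (f x) \<le> B" for x using K(2)[of x] by (cases "x \<in> K") auto
  then show thesis using B(1) that by blast
qed

text \<open>The square of a truncated quadratic is just smooth enough: its gradient is Lipschitz, which is all
  that differentiating a convolution requires.\<close>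

definition bump :: "real \<Rightarrow> 'a::euclidean_space \<Rightarrow> real"
  where "bump r x = (max 0 (r\<^sup>2 - x \<bullet> x))\<^sup>2"

definition bump_grad :: "real \<Rightarrow> 'a::euclidean_space \<Rightarrow> 'a"
  where "bump_grad r x = (- 4 * max 0 (r\<^sup>2 - x \<bullet> x)) *\<^sub>R x"

lemma DERIV_max_power2: "((\<lambda>s::real. (max 0 s)\<^sup>2) has_real_derivative 2 * max 0 s) (at s)"
proof -
  consider "s > 0" | "s < 0" | "s = 0" by linarith
  then show ?thesis
  proof cases
    case 1
    have "((\<lambda>s::real. s\<^sup>2) has_real_derivative 2 * max 0 s) (at s)"
      using 1 by (auto intro!: derivative_eq_intros)
    then show ?thesis
      by (rule has_field_derivative_transform_within_open[of _ _ _ "{0<..}"]) (use 1 in auto)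
  next
    case 2
    have "((\<lambda>s::real. 0) has_real_derivative 2 * max 0 s) (at s)"
      using 2 by (auto intro!: derivative_eq_intros)
    then show ?thesis
      by (rule has_field_derivative_transform_within_open[of _ _ _ "{..<0}"]) (use 2 in auto)
  next
    case 3
    have "((\<lambda>h::real. ((max 0 (0 + h))\<^sup>2 - (max 0 0)\<^sup>2) / h) \<longlongrightarrow> 0) (at 0)"
    proof (rule Lim_null_comparison[of _ "\<lambda>h. \<bar>h\<bar>"])
      have "norm (((max 0 (0 + h))\<^sup>2 - (max 0 0)\<^sup>2) / h) \<le> \<bar>h\<bar>" for h :: real
        by (auto simp: max_def power2_eq_square)
      then show "\<forall>\<^sub>F h in at 0. norm (((max 0 (0 + h))\<^sup>2 - (max 0 0)\<^sup>2) / h) \<le> \<bar>h :: real\<bar>"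
        by (intro always_eventually allI)
      show "((\<lambda>h::real. \<bar>h\<bar>) \<longlongrightarrow> 0) (at 0)" by (rule tendsto_rabs_zero) simp
    qed
    then show ?thesis using 3 by (simp add: DERIV_def)
  qed
qed

lemma GDERIV_bump: "GDERIV (bump r) x :> bump_grad r x"
proof -
  have "GDERIV (\<lambda>x::'a. r\<^sup>2 - x \<bullet> x) x :> (- 2) *\<^sub>R x"
    unfolding gderiv_def by (auto intro!: derivative_eq_intros simp: inner_commute)
  from GDERIV_DERIV_compose[OF this DERIV_max_power2]
  show ?thesis by (simp add: bump_def[abs_def] bump_grad_def)
qed

lemma bump_zero: "norm x \<ge> r \<Longrightarrow> r \<ge> 0 \<Longrightarrow> bump r x = 0"
  using power_mono[of r "norm x" 2] by (simp add: bump_def dot_square_norm)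

lemma bump_grad_lipschitz:
  assumes r: "r > 0"
  shows "norm (bump_grad r x - bump_grad r y) \<le> 12 * r\<^sup>2 * norm (x - y)"
proof -
  define m where "m x = max 0 (r\<^sup>2 - x \<bullet> x)" for x :: 'a
  have m0: "m x = 0" if "norm x > r" for x
    using power_mono[of r "norm x" 2] that r by (simp add: m_def dot_square_norm)
  have m1: "m x = r\<^sup>2 - (norm x)\<^sup>2" if "norm x \<le> r" for x
    using power_mono[of "norm x" r 2] that r by (simp add: m_def dot_square_norm)
  have out: "norm (m x *\<^sub>R x) \<le> 3 * r\<^sup>2 * norm (x - y)" if "norm x \<le> r" "norm y > r" for x y
  proof -
    have "norm (m x *\<^sub>R x) = ((r - norm x) * (r + norm x)) * norm x"
    proof -
      have "norm (m x *\<^sub>R x) = m x * norm x" by (simp add: m_def)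
      then show ?thesis unfolding m1[OF that(1)] by (simp add: power2_eq_square algebra_simps)
    qed
    also have "\<dots> \<le> (norm (x - y) * (2 * r)) * r"
      using that r norm_triangle_ineq2[of y x] by (intro mult_mono) (auto simp: norm_minus_commute)
    also have "\<dots> \<le> 3 * r\<^sup>2 * norm (x - y)" using r by (simp add: power2_eq_square)
    finally show ?thesis .
  qed
  have "norm (m x *\<^sub>R x - m y *\<^sub>R y) \<le> 3 * r\<^sup>2 * norm (x - y)"
  proof -
    consider "norm x \<le> r" "norm y \<le> r" | "norm x \<le> r" "norm y > r" | "norm x > r" "norm y \<le> r" | "norm x > r" "norm y > r"
      by linarith
    then show ?thesis
    proof cases
      case 1
      have mx: "\<bar>m x\<bar> \<le> r\<^sup>2" by (simp add: m_def)
      have "m x - m y = (y - x) \<bullet> (y + x)"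
        using 1 by (simp add: m1 algebra_simps inner_commute flip: dot_square_norm)
      then have "\<bar>m x - m y\<bar> \<le> norm (y - x) * norm (y + x)" by (simp add: Cauchy_Schwarz_ineq2)
      also have "\<dots> \<le> norm (x - y) * (2 * r)"
        using norm_triangle_ineq[of y x] 1 by (intro mult_mono) (auto simp: norm_minus_commute)
      finally have d: "\<bar>m x - m y\<bar> \<le> norm (x - y) * (2 * r)" .
      have "m x *\<^sub>R x - m y *\<^sub>R y = m x *\<^sub>R (x - y) + (m x - m y) *\<^sub>R y"
        by (simp add: algebra_simps)
      then have "norm (m x *\<^sub>R x - m y *\<^sub>R y) \<le> \<bar>m x\<bar> * norm (x - y) + \<bar>m x - m y\<bar> * norm y"
        using norm_triangle_ineq[of "m x *\<^sub>R (x - y)" "(m x - m y) *\<^sub>R y"] by simp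
      also have "\<dots> \<le> r\<^sup>2 * norm (x - y) + norm (x - y) * (2 * r) * r"
        using mx d 1 r by (intro add_mono mult_mono) auto
      also have "\<dots> = 3 * r\<^sup>2 * norm (x - y)" by (simp add: power2_eq_square)
      finally show ?thesis .
    next
      case 2 then show ?thesis using out[of x y] m0[of y] by simp
    next
      case 3 then show ?thesis using out[of y x] m0[of x] by (simp add: norm_minus_commute)
    next
      case 4 then show ?thesis using r by (simp add: m0)
    qed
  qed
  moreover have "bump_grad r x - bump_grad r y = (- 4) *\<^sub>R (m x *\<^sub>R x - m y *\<^sub>R y)"
    by (simp add: bump_grad_def m_def algebra_simps)
  then have "norm (bump_grad r x - bump_grad r y) = 4 * norm (m x *\<^sub>R x - m y *\<^sub>R y)"
    by simp
  ultimately show ?thesis by linarith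
qed

lemma continuous_bump: "continuous_on UNIV (bump r)"
  unfolding bump_def[abs_def] by (intro continuous_intros)

lemma integrable_bump: "r \<ge> 0 \<Longrightarrow> integrable lborel (bump r)"
  by (rule integrable_continuous_compact_support[OF continuous_bump, of "cball 0 r"]) (auto intro: bump_zero)

lemma integral_bump_pos:
  assumes r: "r > 0"
  shows "(LINT x|lborel. bump r (x :: 'a::euclidean_space)) > 0"
proof -
  have nn: "bump r x \<ge> 0" for x :: 'a by (simp add: bump_def)
  have "(LINT x|lborel. bump r (x :: 'a)) \<noteq> 0"
  proof
    assume "(LINT x|lborel. bump r (x :: 'a)) = 0"
    then have "AE x in lborel. bump r (x :: 'a) = 0"
      using integral_nonneg_eq_0_iff_AE[OF integrable_bump[of r]] nn r by auto
    then have "AE x in lborel. x \<in> - ball (0::'a) r"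
    proof eventually_elim
      case (elim x)
      have "r\<^sup>2 - x \<bullet> x > 0" if "norm x < r"
        using power_strict_mono[OF that, of 2] by (simp add: dot_square_norm)
      then show ?case using elim by (force simp: bump_def)
    qed
    then have "(0::'a) \<in> - ball 0 r"
      by (intro mem_closed_if_AE_lebesgue AE_completion) auto
    then show False using r by simp
  qed
  then show ?thesis using nn by (simp add: less_le)
qed

definition mollifier :: "real \<Rightarrow> 'a::euclidean_space \<Rightarrow> real"
  where "mollifier r x = bump r x / (LINT y|lborel. bump r (y :: 'a))"

definition mollifier_grad :: "real \<Rightarrow> 'a::euclidean_space \<Rightarrow> 'a"
  where "mollifier_grad r x = bump_grad r x /\<^sub>R (LINT y|lborel. bump r (y :: 'a))"

lemma
  fixes x :: "'a::euclidean_space"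
  assumes r: "r > 0"
  shows mollifier_nonneg: "mollifier r x \<ge> 0"
    and mollifier_zero: "norm x \<ge> r \<Longrightarrow> mollifier r x = 0"
    and integrable_mollifier: "integrable lborel (mollifier r :: 'a \<Rightarrow> real)"
    and integral_mollifier: "(LINT x|lborel. mollifier r (x :: 'a)) = 1"
    and continuous_mollifier: "continuous_on UNIV (mollifier r :: 'a \<Rightarrow> real)"
    and GDERIV_mollifier: "GDERIV (mollifier r) x :> mollifier_grad r x"
proof -
  have pos: "(LINT x|lborel. bump r (x :: 'a)) > 0" by (rule integral_bump_pos[OF r])
  show "mollifier r x \<ge> 0" using pos by (simp add: mollifier_def bump_def)
  show "mollifier r x = 0" if "norm x \<ge> r" using bump_zero[OF that] r by (simp add: mollifier_def)
  show "integrable lborel (mollifier r :: 'a \<Rightarrow> real)"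
    unfolding mollifier_def[abs_def] using integrable_bump[of r] r by auto
  show "(LINT x|lborel. mollifier r (x :: 'a)) = 1"
    using pos by (simp add: mollifier_def[abs_def])
  show "continuous_on UNIV (mollifier r :: 'a \<Rightarrow> real)"
    unfolding mollifier_def[abs_def] using pos continuous_bump by (auto intro!: continuous_intros)
  have "GDERIV (\<lambda>x. bump r x * (1 / (LINT y|lborel. bump r (y :: 'a)))) x :> mollifier_grad r x"
    using GDERIV_mult[OF GDERIV_bump[of r x] GDERIV_const] by (simp add: mollifier_grad_def divide_inverse)
  then show "GDERIV (mollifier r) x :> mollifier_grad r x"
    by (simp add: mollifier_def[abs_def])
qed

lemma mollifier_grad_lipschitz:
  assumes r: "r > 0"
  obtains L where "\<And>x y :: 'a::euclidean_space. norm (mollifier_grad r x - mollifier_grad r y) \<le> L * norm (x - y)"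
proof
  define c where "c = (LINT y|lborel. bump r (y :: 'a))"
  have c: "c > 0" unfolding c_def by (rule integral_bump_pos[OF r])
  fix x y :: 'a
  have "norm (mollifier_grad r x - mollifier_grad r y) = norm (bump_grad r x - bump_grad r y) / c"
    using c by (simp add: mollifier_grad_def c_def[symmetric] divide_inverse mult.commute flip: scaleR_diff_right)
  also have "\<dots> \<le> 12 * r\<^sup>2 * norm (x - y) / c"
    using c bump_grad_lipschitz[OF r, of x y] by (intro divide_right_mono) auto
  finally show "norm (mollifier_grad r x - mollifier_grad r y) \<le> (12 * r\<^sup>2 / c) * norm (x - y)" by simp
qed

lemma lipschitz_imp_continuous:
  fixes G :: "'a::real_normed_vector \<Rightarrow> 'b::real_normed_vector"
  assumes "\<And>x y. norm (G x - G y) \<le> L * norm (x - y)"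
  shows "continuous_on UNIV G"
proof (rule lipschitz_on_continuous_on)
  show "\<bar>L\<bar>-lipschitz_on UNIV G"
  proof (rule lipschitz_onI)
    fix x y
    have "norm (G x - G y) \<le> \<bar>L\<bar> * norm (x - y)"
      by (rule order_trans[OF assms mult_right_mono]) auto
    then show "dist (G x) (G y) \<le> \<bar>L\<bar> * dist x y" by (simp add: dist_norm)
  qed simp
qed

text \<open>Since \<open>w'\<close> is Lipschitz, the first order Taylor remainder of \<open>w\<close> is quadratic uniformly in the base
  point. Integrating it against \<open>f\<close> bounds the remainder of the convolution, with no limit to
  interchange.\<close>

lemma GDERIV_convolution:
  fixes w :: "'a::euclidean_space \<Rightarrow> real" and f :: "'a \<Rightarrow> real"
  assumes w: "\<And>x. GDERIV w x :> w' x" "\<And>x y. norm (w' x - w' y) \<le> L * norm (x - y)"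
    and supp: "compact K" "\<And>x. x \<notin> K \<Longrightarrow> w x = 0" "\<And>x. x \<notin> K \<Longrightarrow> w' x = 0"
    and f: "integrable lborel f"
  shows "GDERIV (convolution w f) x :> (LINT y|lborel. f y *\<^sub>R w' (x - y))"
    and "continuous_on UNIV (\<lambda>x. LINT y|lborel. f y *\<^sub>R w' (x - y))"
proof -
  have [measurable]: "f \<in> borel_measurable borel" using f by auto
  have cw': "continuous_on UNIV w'" using w(2) by (rule lipschitz_imp_continuous)
  have cw: "continuous_on UNIV w"
    using w(1) unfolding gderiv_def by (intro continuous_at_imp_continuous_on ballI has_derivative_continuous)
  have [measurable]: "w \<in> borel_measurable borel" "w' \<in> borel_measurable borel"
    using cw cw' by (auto intro: borel_measurable_continuous_onI)
  obtain B where B: "\<And>x. norm (w x) \<le> B" using bounded_continuous_compact_support[OF cw supp(1,2)] by metis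
  obtain B' where B': "\<And>x. norm (w' x) \<le> B'" using bounded_continuous_compact_support[OF cw' supp(1,3)] by metis
  have i: "integrable lborel (\<lambda>y. w (x - y) * f y)" for x
  proof (rule Bochner_Integration.integrable_bound[of _ "\<lambda>y. B * f y"])
    show "AE y in lborel. norm (w (x - y) * f y) \<le> norm (B * f y)"
      using B by (auto intro!: AE_I2 simp: abs_mult intro!: mult_right_mono) (metis abs_ge_self order_trans real_norm_def)
  qed (use f in auto)
  have i': "integrable lborel (\<lambda>y. f y *\<^sub>R w' (x - y))" for x
  proof (rule Bochner_Integration.integrable_bound[of _ "\<lambda>y. B' * f y"])
    show "AE y in lborel. norm (f y *\<^sub>R w' (x - y)) \<le> norm (B' * f y)"
      using B' by (auto intro!: AE_I2 simp: abs_mult mult.commute[of "\<bar>B'\<bar>"] intro!: mult_left_mono) (metis abs_ge_self order_trans)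
  qed (use f in auto)
  define G where "G x = (LINT y|lborel. f y *\<^sub>R w' (x - y))" for x
  define N where "N = (LINT y|lborel. \<bar>f y\<bar>)"
  have L0: "L \<ge> 0"
  proof -
    obtain b :: 'a where "b \<in> Basis" using nonempty_Basis by blast
    then show ?thesis using order_trans[OF norm_ge_zero w(2)[of b 0]] by simp
  qed
  have conv: "convolution w f x = (LINT y|lborel. w (x - y) * f y)" for x
    using convolution_commute[of w f x] by simp
  have taylor: "\<bar>w (z + h) - w z - h \<bullet> w' z\<bar> \<le> L * (norm h)\<^sup>2" for z h
  proof -
    have "norm (w (z + h) - w z - (z + h - z) \<bullet> w' z) \<le> norm (z + h - z) * (L * norm h)"
    proof (rule differentiable_bound_linearization[where S="closed_segment z (z + h)" and f'="\<lambda>x v. v \<bullet> w' x"])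
      fix x assume x: "x \<in> closed_segment z (z + h)"
      show "(w has_derivative (\<lambda>v. v \<bullet> w' x)) (at x within closed_segment z (z + h))"
        using w(1)[of x] unfolding gderiv_def by (rule has_derivative_at_withinI)
      have xz: "norm (x - z) \<le> norm h" using segment_bound(1)[OF x] by simp
      have "onorm ((\<lambda>v. v \<bullet> w' x) - (\<lambda>v. v \<bullet> w' z)) \<le> norm (w' x - w' z)"
      proof (rule onorm_le)
        fix v
        show "norm (((\<lambda>v. v \<bullet> w' x) - (\<lambda>v. v \<bullet> w' z)) v) \<le> norm (w' x - w' z) * norm v"
          using Cauchy_Schwarz_ineq2[of v "w' x - w' z"] by (simp add: inner_diff_right mult.commute)
      qed
      also have "\<dots> \<le> L * norm h" using w(2)[of x z] xz L0 by (meson mult_left_mono order_trans)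
      finally show "onorm ((\<lambda>v. v \<bullet> w' x) - (\<lambda>v. v \<bullet> w' z)) \<le> L * norm h" .
    qed (auto simp: closed_segment_def algebra_simps)
    then show ?thesis by (simp add: power2_eq_square mult.commute mult.left_commute)
  qed
  have rem: "norm (convolution w f (x + h) - convolution w f x - h \<bullet> G x) \<le> L * N * (norm h)\<^sup>2" for h
  proof -
    have "h \<bullet> G x = (LINT y|lborel. h \<bullet> (f y *\<^sub>R w' (x - y)))"
      unfolding G_def by (rule integral_inner_right[symmetric]) (rule i')
    then have "convolution w f (x + h) - convolution w f x - h \<bullet> G x =
      (LINT y|lborel. w (x + h - y) * f y - w (x - y) * f y - h \<bullet> (f y *\<^sub>R w' (x - y)))"
      using i integrable_inner_right[of h lborel, OF i'[of x]] by (simp add: conv)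
    also have "norm \<dots> \<le> (LINT y|lborel. L * (norm h)\<^sup>2 * \<bar>f y\<bar>)"
    proof (rule Bochner_Integration.integral_norm_bound_integral)
      fix y
      have "w (x + h - y) * f y - w (x - y) * f y - h \<bullet> (f y *\<^sub>R w' (x - y)) =
        (w ((x - y) + h) - w (x - y) - h \<bullet> w' (x - y)) * f y"
        by (simp add: algebra_simps)
      then show "norm (w (x + h - y) * f y - w (x - y) * f y - h \<bullet> (f y *\<^sub>R w' (x - y))) \<le> L * (norm h)\<^sup>2 * \<bar>f y\<bar>"
        using taylor[of "x - y" h] by (simp add: abs_mult mult_right_mono)
    qed (use i integrable_inner_right[of h lborel, OF i'[of x]] f in auto)
    also have "\<dots> = L * N * (norm h)\<^sup>2" by (simp add: N_def)
    finally show ?thesis .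
  qed
  show "GDERIV (convolution w f) x :> (LINT y|lborel. f y *\<^sub>R w' (x - y))"
    unfolding gderiv_def has_derivative_at G_def[symmetric]
  proof (intro conjI)
    show "bounded_linear (\<lambda>h. h \<bullet> G x)" by (rule bounded_linear_inner_left)
    show "(\<lambda>h. norm (convolution w f (x + h) - convolution w f x - h \<bullet> G x) / norm h) \<midarrow>0\<rightarrow> 0"
    proof (rule Lim_null_comparison[of _ "\<lambda>h. L * N * norm h"])
      have "norm (norm (convolution w f (x + h) - convolution w f x - h \<bullet> G x) / norm h) \<le> L * N * norm h" for h
        using rem[of h] by (cases "h = 0") (simp_all add: pos_divide_le_eq power2_eq_square mult.assoc)
      then show "\<forall>\<^sub>F h in at 0. norm (norm (convolution w f (x + h) - convolution w f x - h \<bullet> G x) / norm h) \<le> L * N * norm h"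
        by (intro always_eventually allI)
      show "(\<lambda>h. L * N * norm h) \<midarrow>0\<rightarrow> 0" by (intro tendsto_mult_right_zero tendsto_norm_zero tendsto_ident_at)
    qed
  qed
  show "continuous_on UNIV (\<lambda>x. LINT y|lborel. f y *\<^sub>R w' (x - y))"
  proof (rule lipschitz_imp_continuous)
    fix x z
    have "(LINT y|lborel. f y *\<^sub>R w' (x - y)) - (LINT y|lborel. f y *\<^sub>R w' (z - y)) =
      (LINT y|lborel. f y *\<^sub>R w' (x - y) - f y *\<^sub>R w' (z - y))"
      using i' by simp
    also have "norm \<dots> \<le> (LINT y|lborel. L * norm (x - z) * \<bar>f y\<bar>)"
    proof (rule Bochner_Integration.integral_norm_bound_integral)
      fix y
      show "norm (f y *\<^sub>R w' (x - y) - f y *\<^sub>R w' (z - y)) \<le> L * norm (x - z) * \<bar>f y\<bar>"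
        using mult_left_mono[OF w(2)[of "x - y" "z - y"], of "\<bar>f y\<bar>"] by (simp add: mult.commute flip: scaleR_diff_right)
    qed (use i' f in auto)
    also have "\<dots> = (L * N) * norm (x - z)" by (simp add: N_def)
    finally show "norm ((LINT y|lborel. f y *\<^sub>R w' (x - y)) - (LINT y|lborel. f y *\<^sub>R w' (z - y))) \<le> (L * N) * norm (x - z)" .
  qed
qed

section \<open>Test functions and the fundamental lemma of the calculus of variations\<close>

lemma test_functionD:
  assumes "test_function \<Omega> \<phi> \<phi>'"
  obtains K where "compact K" "K \<subseteq> \<Omega>" "\<And>x. x \<notin> K \<Longrightarrow> \<phi> x = 0" "\<And>x. x \<notin> K \<Longrightarrow> \<phi>' x = 0"
    "continuous_on UNIV \<phi>" "continuous_on UNIV \<phi>'" "\<And>x. GDERIV \<phi> x :> \<phi>' x"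
proof -
  from assms obtain K where K: "compact K" "K \<subseteq> \<Omega>" "\<And>x. x \<notin> K \<Longrightarrow> \<phi> x = 0"
    and d: "\<And>x. GDERIV \<phi> x :> \<phi>' x" and c: "continuous_on UNIV \<phi>'"
    unfolding test_function_def by blast
  have "\<phi>' x = 0" if x: "x \<notin> K" for x
  proof -
    have "GDERIV \<phi> x :> 0"
      unfolding gderiv_def
    proof (rule has_derivative_transform_within_open[of "\<lambda>_. 0"])
      show "open (- K)" using K(1) by (simp add: compact_imp_closed open_Compl)
    qed (use x K(3) in auto)
    then have "(\<lambda>h. h \<bullet> \<phi>' x) = (\<lambda>h. h \<bullet> 0)"
      using d[of x] unfolding gderiv_def by (rule has_derivative_unique[rotated])
    then have "\<phi>' x \<bullet> \<phi>' x = \<phi>' x \<bullet> 0" by (rule fun_cong)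
    then show ?thesis by simp
  qed
  note z = this
  have c\<phi>: "continuous_on UNIV \<phi>"
    using d unfolding gderiv_def by (intro continuous_at_imp_continuous_on ballI has_derivative_continuous)
  show thesis by (rule that[OF K z c\<phi> c d])
qed

text \<open>Lebesgue measure is translation invariant, so all difference quotients of \<open>\<phi>\<close> integrate to zero; they
  converge boundedly, on a bounded set, to the partial derivatives.\<close>

lemma integral_test_gradient:
  assumes "test_function \<Omega> \<phi> \<phi>'"
  shows "(LINT x|lborel. \<phi>' x) = (0 :: 'a::euclidean_space)"
proof -
  from assms obtain K where K: "compact K" "K \<subseteq> \<Omega>" "\<And>x. x \<notin> K \<Longrightarrow> \<phi> x = 0" "\<And>x. x \<notin> K \<Longrightarrow> \<phi>' x = 0"
    and c: "continuous_on UNIV \<phi>" "continuous_on UNIV \<phi>'" and d: "\<And>x. GDERIV \<phi> x :> \<phi>' x"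
    by (rule test_functionD) (rule that)
  have [measurable]: "\<phi> \<in> borel_measurable borel" "\<phi>' \<in> borel_measurable borel"
    using c by (auto intro: borel_measurable_continuous_onI)
  have i: "integrable lborel \<phi>" "integrable lborel \<phi>'"
    using K c by (auto intro: integrable_continuous_compact_support)
  obtain B where B: "\<And>x. norm (\<phi>' x) \<le> B" using bounded_continuous_compact_support[OF c(2) K(1,4)] by metis
  obtain R where R: "\<And>x. x \<in> K \<Longrightarrow> norm x \<le> R" using compact_imp_bounded[OF K(1)] by (auto simp: bounded_iff)
  have lip: "\<bar>\<phi> y - \<phi> x\<bar> \<le> B * norm (y - x)" for x y
  proof -
    have "norm (\<phi> y - \<phi> x) \<le> B * norm (y - x)"
    proof (rule differentiable_bound[of UNIV \<phi> "\<lambda>x h. h \<bullet> \<phi>' x"])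
      show "onorm (\<lambda>h. h \<bullet> \<phi>' x) \<le> B" for x
        by (rule onorm_le) (metis B Cauchy_Schwarz_ineq2 mult.commute mult_left_mono norm_ge_zero order_trans real_norm_def)
    qed (use d in \<open>auto simp: gderiv_def\<close>)
    then show ?thesis by simp
  qed
  have zero: "(LINT x|lborel. \<phi>' x \<bullet> b) = 0" if b: "b \<in> Basis" for b
  proof -
    define t where "t n = 1 / real (Suc n)" for n
    have t: "t n > 0" "t n \<le> 1" for n by (auto simp: t_def)
    have t0: "t \<longlonglongrightarrow> 0" using LIMSEQ_inverse_real_of_nat by (simp add: t_def[abs_def] inverse_eq_divide)
    have ic: "integrable lborel (indicator (cball (0::'a) (R + 1)) :: 'a \<Rightarrow> real)"
      by (rule integrable_real_indicator) (use emeasure_bounded_finite[of "cball (0::'a) (R + 1)"] in auto)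
    have "(\<lambda>n. LINT x|lborel. (\<phi> (x + t n *\<^sub>R b) - \<phi> x) / t n) \<longlonglongrightarrow> (LINT x|lborel. \<phi>' x \<bullet> b)"
    proof (rule integral_dominated_convergence[where w="\<lambda>x. B * indicator (cball 0 (R + 1)) x"])
      show "AE x in lborel. (\<lambda>n. (\<phi> (x + t n *\<^sub>R b) - \<phi> x) / t n) \<longlonglongrightarrow> \<phi>' x \<bullet> b"
      proof (rule AE_I2)
        fix x
        have "((\<lambda>s. \<phi> (x + s *\<^sub>R b)) has_derivative (\<lambda>s. (s *\<^sub>R b) \<bullet> \<phi>' (x + 0 *\<^sub>R b))) (at 0)"
          using d[of "x + 0 *\<^sub>R b"] unfolding gderiv_def
          by (intro has_derivative_compose[of "\<lambda>s. x + s *\<^sub>R b" "\<lambda>s. s *\<^sub>R b" 0 UNIV \<phi>])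
            (auto intro!: derivative_eq_intros)
        then have "((\<lambda>s. \<phi> (x + s *\<^sub>R b)) has_real_derivative (\<phi>' x \<bullet> b)) (at 0)"
          by (simp add: has_field_derivative_def inner_commute mult.commute[of _ "b \<bullet> \<phi>' x"])
        then have "((\<lambda>h. (\<phi> (x + h *\<^sub>R b) - \<phi> x) / h) \<longlongrightarrow> \<phi>' x \<bullet> b) (at 0)"
          by (simp add: DERIV_def)
        moreover have "filterlim t (at 0) sequentially"
          using t0 t by (auto simp: filterlim_at less_imp_neq[THEN not_sym] intro!: always_eventually)
        ultimately show "(\<lambda>n. (\<phi> (x + t n *\<^sub>R b) - \<phi> x) / t n) \<longlonglongrightarrow> \<phi>' x \<bullet> b"
          by (rule filterlim_compose)
      qed
      fix n
      show "AE x in lborel. norm ((\<phi> (x + t n *\<^sub>R b) - \<phi> x) / t n) \<le> B * indicator (cball 0 (R + 1)) x"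
      proof (rule AE_I2)
        fix x
        show "norm ((\<phi> (x + t n *\<^sub>R b) - \<phi> x) / t n) \<le> B * indicator (cball 0 (R + 1)) x"
        proof (cases "norm x \<le> R + 1")
          case True
          have "\<bar>\<phi> (x + t n *\<^sub>R b) - \<phi> x\<bar> \<le> B * t n"
            using lip[of "x + t n *\<^sub>R b" x] b t(1)[of n] by simp
          then show ?thesis using True t(1)[of n] by (simp add: pos_divide_le_eq)
        next
          case False
          have "norm x \<le> norm (x + t n *\<^sub>R b) + norm (t n *\<^sub>R b)"
            using norm_triangle_ineq4[of "x + t n *\<^sub>R b" "t n *\<^sub>R b"] by simp
          then have "x \<notin> K" "x + t n *\<^sub>R b \<notin> K" using R[of x] R[of "x + t n *\<^sub>R b"] b t[of n] False by auto
          then show ?thesis using K(3) False by simp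
        qed
      qed
    qed (use ic in auto)
    moreover have "(LINT x|lborel. (\<phi> (x + t n *\<^sub>R b) - \<phi> x) / t n) = 0" for n
      using lborel_integral_plus[of \<phi> "t n *\<^sub>R b"] i by simp
    ultimately have "(\<lambda>n::nat. 0::real) \<longlonglongrightarrow> (LINT x|lborel. \<phi>' x \<bullet> b)" by (simp only:)
    then show ?thesis by (simp add: LIMSEQ_const_iff)
  qed
  show ?thesis
  proof (rule euclidean_eqI)
    fix b :: 'a assume "b \<in> Basis"
    then show "(LINT x|lborel. \<phi>' x) \<bullet> b = 0 \<bullet> b" using zero[of b] i by simp
  qed
qed

lemma test_functionI:
  assumes "\<And>x. GDERIV \<phi> x :> \<phi>' x" "continuous_on UNIV \<phi>'" "compact K" "K \<subseteq> \<Omega>" "\<And>x. x \<notin> K \<Longrightarrow> \<phi> x = 0"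
  shows "test_function \<Omega> \<phi> \<phi>'"
  using assms unfolding test_function_def by blast

lemma compact_thickening:
  fixes K :: "'a::euclidean_space set"
  assumes "compact K" "K \<subseteq> \<Omega>" "open \<Omega>"
  obtains \<delta> K' where "\<delta> > 0" "compact K'" "K' \<subseteq> \<Omega>" "\<And>x. x \<in> K \<Longrightarrow> cball x \<delta> \<subseteq> K'"
proof -
  obtain e where e: "e > 0" "(\<Union>x\<in>K. cball x e) \<subseteq> \<Omega>"
    using compact_subset_open_imp_cball_epsilon_subset[OF assms(1,3,2)] by blast
  have "(\<Union>x\<in>K. cball x e) = (\<Union>x\<in>K. \<Union>y\<in>cball 0 e. {x + y})"
  proof -
    have "z \<in> cball x e \<longleftrightarrow> (\<exists>y\<in>cball 0 e. z = x + y)" for x z :: 'a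
      using bexI[of "\<lambda>y. z = x + y" "z - x" "cball 0 e"] by (auto simp: dist_norm norm_minus_commute)
    then have "cball x e = (\<Union>y\<in>cball 0 e. {x + y})" for x :: 'a by blast
    then show ?thesis by (intro SUP_cong refl)
  qed
  then have "compact (\<Union>x\<in>K. cball x e)"
    using compact_sums'[OF assms(1) compact_cball[of 0 e]] by (simp only:)
  then show thesis
  proof (rule that[OF e(1)])
    show "(\<Union>x\<in>K. cball x e) \<subseteq> \<Omega>" by (rule e(2))
    show "cball x e \<subseteq> (\<Union>x\<in>K. cball x e)" if "x \<in> K" for x using that by (rule UN_upper)
  qed
qed

lemma local_representative:
  fixes f :: "'a::euclidean_space \<Rightarrow> 'b::euclidean_space"
  assumes f: "locally_integrable_on \<Omega> f" and K: "compact K" "K \<subseteq> \<Omega>"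
  obtains F where "F \<in> borel_measurable borel" "integrable lborel F" "AE x in lborel. F x = indicator K x *\<^sub>R f x"
  by (rule integrable_representative[OF _ f[unfolded locally_integrable_on_def, rule_format, OF conjI[OF K]]])
    (use K(1) in \<open>simp add: borel_compact\<close>, rule that)

lemma AE_lebesgue_on_iff:
  "S \<in> sets lebesgue \<Longrightarrow> (AE x in lebesgue_on S. P x) \<longleftrightarrow> (AE x in lborel. x \<in> S \<longrightarrow> P x)"
  by (subst AE_restrict_space_iff) (auto simp: AE_completion_iff)

lemma GDERIV_reflect:
  assumes "GDERIV w (x - y) :> g"
  shows "GDERIV (\<lambda>y. w (x - y)) y :> - g"
proof -
  have "((\<lambda>y. x - y) has_derivative (\<lambda>h. - h)) (at y)"
    by (auto intro!: derivative_eq_intros)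
  from has_derivative_compose[OF this, of w "\<lambda>h. h \<bullet> g"] assms show ?thesis
    by (simp add: gderiv_def)
qed

lemma test_function_mollifier:
  fixes x :: "'a::euclidean_space"
  assumes r: "r > 0" and sub: "cball x r \<subseteq> \<Omega>"
  shows "test_function \<Omega> (\<lambda>y. mollifier r (x - y)) (\<lambda>y. - mollifier_grad r (x - y))"
proof (rule test_functionI)
  show "GDERIV (\<lambda>y. mollifier r (x - y)) y :> - mollifier_grad r (x - y)" for y
    by (rule GDERIV_reflect) (rule GDERIV_mollifier[OF r])
  obtain L where L: "\<And>x y :: 'a. norm (mollifier_grad r x - mollifier_grad r y) \<le> L * norm (x - y)"
    by (rule mollifier_grad_lipschitz[OF r]) (rule that)
  show "continuous_on UNIV (\<lambda>y. - mollifier_grad r (x - y))"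
  proof (rule lipschitz_imp_continuous)
    show "norm (- mollifier_grad r (x - y) - - mollifier_grad r (x - z)) \<le> L * norm (y - z)" for y z
      using L[of "x - z" "x - y"] by (simp add: algebra_simps)
  qed
  show "compact (cball x r)" "cball x r \<subseteq> \<Omega>" using sub by auto
  show "mollifier r (x - y) = 0" if "y \<notin> cball x r" for y
    using that by (intro mollifier_zero[OF r]) (simp add: dist_norm)
qed

lemma mollification_tendsto:
  fixes f :: "'a::euclidean_space \<Rightarrow> 'b::{banach, second_countable_topology}"
  assumes f: "integrable lborel f" and \<delta>: "\<delta> > 0"
  shows "(\<lambda>n. LINT x|lborel. norm (convolution (mollifier (\<delta> / real (Suc n))) f x - f x)) \<longlonglongrightarrow> 0"
proof (rule approximate_identity[OF f])
  have r: "\<delta> / real (Suc n) > 0" for n using \<delta> by simp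
  show "integrable lborel (mollifier (\<delta> / real (Suc n)) :: 'a \<Rightarrow> real)"
    "(LINT x|lborel. mollifier (\<delta> / real (Suc n)) (x :: 'a)) = 1"
    "mollifier (\<delta> / real (Suc n)) (x :: 'a) \<ge> 0" for n x
    using integrable_mollifier[OF r] integral_mollifier[OF r] mollifier_nonneg[OF r] by blast+
  show "norm x \<le> \<delta> / real (Suc n)" if "mollifier (\<delta> / real (Suc n)) (x :: 'a) \<noteq> 0" for n x
    using mollifier_zero[OF r, of n x] that by linarith
  show "(\<lambda>n. \<delta> / real (Suc n)) \<longlonglongrightarrow> 0"
    using tendsto_mult_right_zero[OF LIMSEQ_inverse_real_of_nat, of \<delta>] by (simp add: divide_inverse)
qed

text \<open>Testing with the translates of a mollifier shows that the mollifications of \<open>u\<close> vanish on any given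
  compact subset once the radius is small, and they converge to \<open>u\<close> in \<open>L1\<close>.\<close>

lemma fundamental_lemma:
  fixes u :: "'a::euclidean_space \<Rightarrow> 'b::euclidean_space"
  assumes \<Omega>: "open \<Omega>" and u: "locally_integrable_on \<Omega> u"
    and zero: "\<And>\<phi> \<phi>'. test_function \<Omega> \<phi> \<phi>' \<Longrightarrow> (LINT x|lebesgue_on \<Omega>. \<phi> x *\<^sub>R u x) = 0"
  shows "AE x in lebesgue_on \<Omega>. u x = 0"
proof -
  have \<Omega>l: "\<Omega> \<in> sets lebesgue" using \<Omega> by simp
  have local: "AE x in lborel. x \<in> K \<longrightarrow> u x = 0" if K: "compact K" "K \<subseteq> \<Omega>" for K
  proof -
    obtain \<delta> K' where \<delta>: "\<delta> > 0" and K': "compact K'" "K' \<subseteq> \<Omega>" "\<And>x. x \<in> K \<Longrightarrow> cball x \<delta> \<subseteq> K'"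
      by (rule compact_thickening[OF K \<Omega>]) (rule that)
    obtain U where U: "U \<in> borel_measurable borel" "integrable lborel U" "AE x in lborel. U x = indicator K' x *\<^sub>R u x"
      by (rule local_representative[OF u K'(1,2)]) (rule that)
    note [measurable] = U(1)
    have r: "\<delta> / real (Suc n) > 0" "\<delta> / real (Suc n) \<le> \<delta>" for n using \<delta> by (auto simp: divide_le_eq)
    define w :: "nat \<Rightarrow> 'a \<Rightarrow> real" where "w n = mollifier (\<delta> / real (Suc n))" for n
    have [measurable]: "w n \<in> borel_measurable borel" for n
      unfolding w_def using continuous_mollifier[OF r(1)] by (rule borel_measurable_continuous_onI)
    have conv0: "convolution (w n) U x = 0" if x: "x \<in> K" for n x
    proof -
      have "convolution (w n) U x = (LINT y|lborel. w n (x - y) *\<^sub>R U y)"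
        by (rule convolution_commute) measurable
      also have "\<dots> = (LINT y|lebesgue_on \<Omega>. w n (x - y) *\<^sub>R u y)"
      proof (rule lebesgue_on_eq_lborel(2)[OF \<Omega>l, symmetric])
        show "AE y in lborel. w n (x - y) *\<^sub>R U y = indicator \<Omega> y *\<^sub>R (w n (x - y) *\<^sub>R u y)"
          using U(3)
        proof eventually_elim
          case (elim y)
          show ?case
          proof (cases "y \<in> K'")
            case False
            then have "y \<notin> cball x \<delta>" using K'(3)[OF x] by blast
            then have "norm (x - y) > \<delta>" by (simp add: dist_norm)
            then have "norm (x - y) \<ge> \<delta> / real (Suc n)" using r(2)[of n] by linarith
            then have "w n (x - y) = 0" unfolding w_def by (rule mollifier_zero[OF r(1)])
            then show ?thesis by simp
          qed (use elim K'(2) in auto)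
        qed
      qed measurable
      also have "\<dots> = 0"
        unfolding w_def
      proof (rule zero[OF test_function_mollifier[OF r(1)]])
        show "cball x (\<delta> / real (Suc n)) \<subseteq> \<Omega>" using K'(2) K'(3)[OF x] subset_cball[OF r(2)[of n], of x] by (meson order_trans)
      qed
      finally show ?thesis .
    qed
    have "integrable lborel (\<lambda>x. convolution (w n) U x - U x)" for n
      using convolution_integrable[OF integrable_mollifier[OF r(1)] U(2)] U(2) by (auto simp: w_def)
    then obtain s :: "nat \<Rightarrow> nat" where "AE x in lborel. (\<lambda>n. convolution (w (s n)) U x - U x) \<longlonglongrightarrow> 0"
      using tendsto_L1_AE_subseq[OF _ mollification_tendsto[OF U(2) \<delta>, folded w_def]] by blast
    then show ?thesis
      using U(3)
    proof eventually_elim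
      case (elim x)
      show ?case
      proof
        assume x: "x \<in> K"
        have "x \<in> K'" using subsetD[OF K'(3)[OF x], of x] \<delta> by simp
        then show "u x = 0" using elim conv0[OF x] by (simp add: LIMSEQ_const_iff)
      qed
    qed
  qed
  obtain C where C: "\<And>n::nat. compact (C n)" "\<And>n. C n \<subseteq> \<Omega>" "\<And>n. C n \<subseteq> interior (C (Suc n))" "\<Union>(range C) = \<Omega>"
    by (rule open_Union_compact_subsets[OF \<Omega>]) (rule that)
  have "AE x in lborel. \<forall>n. x \<in> C n \<longrightarrow> u x = 0"
    unfolding AE_all_countable by (intro allI local C(1,2))
  then have "AE x in lborel. x \<in> \<Omega> \<longrightarrow> u x = 0"
    by eventually_elim (auto simp: C(4)[symmetric])
  then show ?thesis by (simp add: AE_lebesgue_on_iff \<Omega>l)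
qed

section \<open>The chain rule for weak gradients\<close>

lemma mollifier_grad_zero: 
  fixes x :: "'a::euclidean_space"
  assumes "r > 0" "norm x \<ge> r" shows "mollifier_grad r x = 0"
  using power_mono[OF assms(2), of 2] assms(1) by (simp add: mollifier_grad_def bump_grad_def dot_square_norm)

text \<open>Near the support of the test function, the mollification \<open>f\<^sub>n\<close> of \<open>f\<close> is \<open>C1\<close> and its gradient is the
  mollification \<open>g\<^sub>n\<close> of \<open>g\<close>; for it the identity is the classical chain rule. In the limit, the left-hand
  side only needs \<open>f\<^sub>n \<longrightarrow> f\<close> in \<open>L1\<close>, as \<open>h\<close> is Lipschitz. On the right-hand side, \<open>h' (f\<^sub>n) g\<^sub>n\<close> is split into
  \<open>h' (f\<^sub>n) (g\<^sub>n - g)\<close>, which tends to zero in \<open>L1\<close>, and \<open>h' (f\<^sub>n) g\<close>, for which dominated convergence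
  applies along a subsequence converging almost everywhere.\<close>

lemma weak_chain_rule:
  fixes f :: "'a::euclidean_space \<Rightarrow> real"
  assumes \<Omega>: "open \<Omega>" and wg: "has_weak_gradient \<Omega> f g"
    and h: "\<And>t. (h has_real_derivative h' t) (at t)" and h': "continuous_on UNIV h'" "\<And>t. \<bar>h' t\<bar> \<le> B"
  shows "has_weak_gradient \<Omega> (\<lambda>x. h (f x)) (\<lambda>x. h' (f x) *\<^sub>R g x)"
proof -
  let ?L = "lebesgue_on \<Omega>"
  have f: "locally_integrable_on \<Omega> f" and g: "locally_integrable_on \<Omega> g"
    and ibp: "\<And>\<phi> \<phi>'. test_function \<Omega> \<phi> \<phi>' \<Longrightarrow>
        (LINT x|?L. f x *\<^sub>R \<phi>' x) = - (LINT x|?L. \<phi> x *\<^sub>R g x)"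
    using wg unfolding has_weak_gradient_def by blast+
  have \<Omega>l: "\<Omega> \<in> sets lebesgue" using \<Omega> by simp
  have B0: "B \<ge> 0" using h'(2)[of 0] by linarith
  have ch: "continuous_on UNIV h"
    using h by (intro continuous_at_imp_continuous_on ballI DERIV_isCont)
  have [measurable]: "h \<in> borel_measurable borel" "h' \<in> borel_measurable borel"
    using ch h'(1) by (auto intro: borel_measurable_continuous_onI)
  have lip: "\<bar>h s - h t\<bar> \<le> B * \<bar>s - t\<bar>" for s t
  proof -
    have "norm (h s - h t) \<le> B * norm (s - t)"
      by (rule field_differentiable_bound[of UNIV h h']) (use h h'(2) in simp_all)
    then show ?thesis by simp
  qed
  have grow: "\<bar>h t\<bar> \<le> \<bar>h 0\<bar> + B * \<bar>t\<bar>" for t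
  proof -
    have "\<bar>h t\<bar> \<le> \<bar>h 0\<bar> + \<bar>h t - h 0\<bar>" by linarith
    also have "\<dots> \<le> \<bar>h 0\<bar> + B * \<bar>t\<bar>" using lip[of t 0] by simp
    finally show ?thesis .
  qed
  have loc: "integrable (lebesgue_on K) (\<lambda>x. h (f x))" "integrable (lebesgue_on K) (\<lambda>x. h' (f x) *\<^sub>R g x)"
    if K: "compact K" "K \<subseteq> \<Omega>" for K
  proof -
    have Kb[measurable]: "K \<in> sets borel" using K(1) by (rule borel_compact)
    then have Kl: "K \<in> sets lebesgue" by simp
    have iK: "integrable lborel (indicator K :: 'a \<Rightarrow> real)"
      by (rule integrable_real_indicator) (use emeasure_compact_finite[OF K(1)] Kb in auto)
    obtain F where F: "F \<in> borel_measurable borel" "integrable lborel F" "AE x in lborel. F x = indicator K x *\<^sub>R f x"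
      by (rule local_representative[OF f K]) (rule that)
    obtain G where G: "G \<in> borel_measurable borel" "integrable lborel G" "AE x in lborel. G x = indicator K x *\<^sub>R g x"
      by (rule local_representative[OF g K]) (rule that)
    note [measurable] = F(1) G(1)
    have "integrable lborel (\<lambda>x. indicator K x * h (F x))"
    proof (rule Bochner_Integration.integrable_bound[of _ "\<lambda>x. indicator K x * \<bar>h 0\<bar> + B * \<bar>F x\<bar>"])
      show "AE x in lborel. norm (indicator K x * h (F x)) \<le> norm (indicator K x * \<bar>h 0\<bar> + B * \<bar>F x\<bar>)"
        using grow B0 by (intro AE_I2) (auto simp: indicator_def)
    qed (use iK F(2) in auto)
    moreover have "AE x in lborel. indicator K x * h (F x) = indicator K x *\<^sub>R h (f x)"
      using F(3) by eventually_elim (auto simp: indicator_def)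
    ultimately show "integrable (lebesgue_on K) (\<lambda>x. h (f x))"
      by (subst lebesgue_on_eq_lborel(3)[OF Kl, of "\<lambda>x. indicator K x * h (F x)"]) auto
    have "integrable lborel (\<lambda>x. h' (F x) *\<^sub>R G x)"
    proof (rule Bochner_Integration.integrable_bound[of _ "\<lambda>x. B *\<^sub>R G x"])
      show "AE x in lborel. norm (h' (F x) *\<^sub>R G x) \<le> norm (B *\<^sub>R G x)"
        using h'(2) B0 by (intro AE_I2) (auto intro!: mult_right_mono)
    qed (use G(2) in auto)
    moreover have "AE x in lborel. h' (F x) *\<^sub>R G x = indicator K x *\<^sub>R h' (f x) *\<^sub>R g x"
      using F(3) G(3) by eventually_elim (auto simp: indicator_def)
    ultimately show "integrable (lebesgue_on K) (\<lambda>x. h' (f x) *\<^sub>R g x)"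
      by (subst lebesgue_on_eq_lborel(3)[OF Kl, of "\<lambda>x. h' (F x) *\<^sub>R G x"]) auto
  qed
  have main: "(LINT x|?L. h (f x) *\<^sub>R \<phi>' x) = - (LINT x|?L. \<phi> x *\<^sub>R h' (f x) *\<^sub>R g x)"
    if test: "test_function \<Omega> \<phi> \<phi>'" for \<phi> \<phi>'
  proof -
    from test obtain K where K: "compact K" "K \<subseteq> \<Omega>" "\<And>x. x \<notin> K \<Longrightarrow> \<phi> x = 0" "\<And>x. x \<notin> K \<Longrightarrow> \<phi>' x = 0"
      and c: "continuous_on UNIV \<phi>" "continuous_on UNIV \<phi>'" and d: "\<And>x. GDERIV \<phi> x :> \<phi>' x"
      by (rule test_functionD) (rule that)
    have [measurable]: "\<phi> \<in> borel_measurable borel" "\<phi>' \<in> borel_measurable borel"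
      using c by (auto intro: borel_measurable_continuous_onI)
    obtain C where C: "C > 0" "\<And>x. norm (\<phi> x) \<le> C"
      using bounded_continuous_compact_support[OF c(1) K(1,3)] by metis
    obtain C' where C': "C' > 0" "\<And>x. norm (\<phi>' x) \<le> C'"
      using bounded_continuous_compact_support[OF c(2) K(1,4)] by metis
    obtain \<delta> K' where \<delta>: "\<delta> > 0" and K': "compact K'" "K' \<subseteq> \<Omega>" "\<And>x. x \<in> K \<Longrightarrow> cball x \<delta> \<subseteq> K'"
      by (rule compact_thickening[OF K(1,2) \<Omega>]) (rule that)
    have KK': "K \<subseteq> K'" using K'(3) \<delta> by (meson centre_in_cball less_imp_le subset_iff)
    obtain F where F: "F \<in> borel_measurable borel" "integrable lborel F" "AE x in lborel. F x = indicator K' x *\<^sub>R f x"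
      by (rule local_representative[OF f K'(1,2)]) (rule that)
    obtain G where G: "G \<in> borel_measurable borel" "integrable lborel G" "AE x in lborel. G x = indicator K' x *\<^sub>R g x"
      by (rule local_representative[OF g K'(1,2)]) (rule that)
    note [measurable] = F(1) G(1)
    define rad where "rad n = \<delta> / real (Suc n)" for n
    have r: "rad n > 0" "rad n \<le> \<delta>" for n using \<delta> by (auto simp: rad_def divide_le_eq)
    define w :: "nat \<Rightarrow> 'a \<Rightarrow> real" where "w n = mollifier (rad n)" for n
    define w' :: "nat \<Rightarrow> 'a \<Rightarrow> 'a" where "w' n = mollifier_grad (rad n)" for n
    \<comment> \<open>for \<open>x\<close> in the support of \<open>\<phi>\<close>, the convolutions at \<open>x\<close> only see the compact neighbourhood\<close>
    have w_out: "w n (x - y) = 0" "w' n (x - y) = 0" if "x \<in> K" "y \<notin> K'" for n x y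
    proof -
      have "y \<notin> cball x \<delta>" using K'(3)[OF that(1)] that(2) by blast
      then have "norm (x - y) > \<delta>" by (simp add: dist_norm)
      then have "norm (x - y) \<ge> rad n" using r(2)[of n] by linarith
      then show "w n (x - y) = 0" "w' n (x - y) = 0"
        unfolding w_def w'_def using mollifier_zero[OF r(1)] mollifier_grad_zero[OF r(1)] by blast+
    qed
    define D where "D n x = (LINT y|lborel. F y *\<^sub>R w' n (x - y))" for n x
    define fn where "fn n = convolution (w n) F" for n
    define gn where "gn n = convolution (w n) G" for n
    have wi: "integrable lborel (w n)" for n unfolding w_def by (rule integrable_mollifier[OF r(1)])
    have [measurable]: "w n \<in> borel_measurable borel" for n using wi[of n] by auto
    have fn_i: "integrable lborel (fn n)" and gn_i: "integrable lborel (gn n)" for n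
      unfolding fn_def gn_def by (auto intro: convolution_integrable wi F(2) G(2))
    have [measurable]: "fn n \<in> borel_measurable borel" "gn n \<in> borel_measurable borel" for n
      using fn_i[of n] gn_i[of n] by auto
    have fn_deriv: "GDERIV (fn n) x :> D n x" and D_cont: "continuous_on UNIV (D n)"
      and [measurable]: "w' n \<in> borel_measurable borel" for n x
    proof -
      obtain L where "\<And>x y :: 'a. norm (mollifier_grad (rad n) x - mollifier_grad (rad n) y) \<le> L * norm (x - y)"
        by (rule mollifier_grad_lipschitz[OF r(1)[of n]]) (rule that)
      note L = this[folded w'_def]
      then show "w' n \<in> borel_measurable borel"
        by (intro borel_measurable_continuous_onI lipschitz_imp_continuous)
      have supp: "compact (cball (0::'a) (rad n))"
        "x \<notin> cball 0 (rad n) \<Longrightarrow> w n x = 0" "x \<notin> cball 0 (rad n) \<Longrightarrow> w' n x = 0" for x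
        using mollifier_zero[OF r(1), of n x] mollifier_grad_zero[OF r(1), of n x] by (auto simp: w_def w'_def)
      have dw: "GDERIV (w n) x :> w' n x" for x unfolding w_def w'_def by (rule GDERIV_mollifier[OF r(1)])
      show "GDERIV (fn n) x :> D n x" "continuous_on UNIV (D n)"
        unfolding fn_def D_def[abs_def] by (rule GDERIV_convolution[OF dw L supp F(2)]; assumption)+
    qed
    have fn_cont: "continuous_on UNIV (fn n)" for n
      using fn_deriv unfolding gderiv_def by (intro continuous_at_imp_continuous_on ballI has_derivative_continuous)
    \<comment> \<open>the weak gradient tested with a translated mollifier\<close>
    have D_eq: "D n x = gn n x" if x: "x \<in> K" for n x
    proof -
      have "cball x (rad n) \<subseteq> \<Omega>" using K'(2) K'(3)[OF x] subset_cball[OF r(2)[of n], of x] by (meson order_trans)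
      then have "test_function \<Omega> (\<lambda>y. w n (x - y)) (\<lambda>y. - w' n (x - y))"
        unfolding w_def w'_def by (rule test_function_mollifier[OF r(1)])
      from ibp[OF this] have "(LINT y|?L. f y *\<^sub>R w' n (x - y)) = (LINT y|?L. w n (x - y) *\<^sub>R g y)"
        by simp
      also have "(LINT y|?L. f y *\<^sub>R w' n (x - y)) = D n x"
        unfolding D_def
      proof (rule lebesgue_on_eq_lborel(2)[OF \<Omega>l])
        show "AE y in lborel. F y *\<^sub>R w' n (x - y) = indicator \<Omega> y *\<^sub>R f y *\<^sub>R w' n (x - y)"
          using F(3) by eventually_elim (use w_out[OF x] K'(2) in \<open>auto simp: indicator_def\<close>)
      qed measurable
      also have "(LINT y|?L. w n (x - y) *\<^sub>R g y) = (LINT y|lborel. w n (x - y) *\<^sub>R G y)"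
      proof (rule lebesgue_on_eq_lborel(2)[OF \<Omega>l])
        show "AE y in lborel. w n (x - y) *\<^sub>R G y = indicator \<Omega> y *\<^sub>R w n (x - y) *\<^sub>R g y"
          using G(3) by eventually_elim (use w_out[OF x] K'(2) in \<open>auto simp: indicator_def\<close>)
      qed measurable
      also have "\<dots> = gn n x" unfolding gn_def by (rule convolution_commute[symmetric]) measurable
      finally show ?thesis .
    qed
    have smooth: "(LINT x|lborel. h (fn n x) *\<^sub>R \<phi>' x) = - (LINT x|lborel. \<phi> x *\<^sub>R h' (fn n x) *\<^sub>R gn n x)" for n
    proof -
      have c1: "continuous_on UNIV (\<lambda>x. h (fn n x) *\<^sub>R \<phi>' x)"
        and c2: "continuous_on UNIV (\<lambda>x. \<phi> x *\<^sub>R h' (fn n x) *\<^sub>R D n x)"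
        using continuous_on_compose2[OF ch fn_cont[of n]] continuous_on_compose2[OF h'(1) fn_cont[of n]] c D_cont[of n]
        by (auto intro!: continuous_intros)
      have i1: "integrable lborel (\<lambda>x. h (fn n x) *\<^sub>R \<phi>' x)"
        by (rule integrable_continuous_compact_support[OF c1 K(1)]) (simp add: K(4))
      have i2: "integrable lborel (\<lambda>x. \<phi> x *\<^sub>R h' (fn n x) *\<^sub>R D n x)"
        by (rule integrable_continuous_compact_support[OF c2 K(1)]) (simp add: K(3))
      have "test_function \<Omega> (\<lambda>x. h (fn n x) * \<phi> x) (\<lambda>x. h (fn n x) *\<^sub>R \<phi>' x + \<phi> x *\<^sub>R h' (fn n x) *\<^sub>R D n x)"
      proof (rule test_functionI[OF _ _ K(1,2)])
        show "GDERIV (\<lambda>x. h (fn n x) * \<phi> x) x :> h (fn n x) *\<^sub>R \<phi>' x + \<phi> x *\<^sub>R h' (fn n x) *\<^sub>R D n x" for x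
          by (rule GDERIV_mult[OF GDERIV_DERIV_compose[OF fn_deriv h] d])
        show "continuous_on UNIV (\<lambda>x. h (fn n x) *\<^sub>R \<phi>' x + \<phi> x *\<^sub>R h' (fn n x) *\<^sub>R D n x)"
          using c1 c2 by (rule continuous_on_add)
      qed (simp add: K(3))
      from integral_test_gradient[OF this]
      have "(LINT x|lborel. h (fn n x) *\<^sub>R \<phi>' x) = - (LINT x|lborel. \<phi> x *\<^sub>R h' (fn n x) *\<^sub>R D n x)"
        using i1 i2 by (simp add: eq_neg_iff_add_eq_0)
      also have "(\<lambda>x. \<phi> x *\<^sub>R h' (fn n x) *\<^sub>R D n x) = (\<lambda>x. \<phi> x *\<^sub>R h' (fn n x) *\<^sub>R gn n x)"
      proof
        show "\<phi> x *\<^sub>R h' (fn n x) *\<^sub>R D n x = \<phi> x *\<^sub>R h' (fn n x) *\<^sub>R gn n x" for x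
          using D_eq[of x n] K(3)[of x] by (cases "x \<in> K") auto
      qed
      finally show ?thesis .
    qed
    have fn_L1: "(\<lambda>n. LINT x|lborel. norm (fn n x - F x)) \<longlonglongrightarrow> 0"
      unfolding fn_def w_def rad_def by (rule mollification_tendsto[OF F(2) \<delta>])
    have gn_L1: "(\<lambda>n. LINT x|lborel. norm (gn n x - G x)) \<longlonglongrightarrow> 0"
      unfolding gn_def w_def rad_def by (rule mollification_tendsto[OF G(2) \<delta>])
    obtain s :: "nat \<Rightarrow> nat" where s: "strict_mono s" "AE x in lborel. (\<lambda>n. fn (s n) x - F x) \<longlonglongrightarrow> 0"
      using tendsto_L1_AE_subseq[OF _ fn_L1] fn_i F(2) by blast
    have h\<phi>: "integrable lborel (\<lambda>x. h (u x) *\<^sub>R \<phi>' x)" if "integrable lborel u" for u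
    proof (rule Bochner_Integration.integrable_bound[of _ "\<lambda>x. \<bar>h 0\<bar> * norm (\<phi>' x) + B * C' * \<bar>u x\<bar>"])
      have "integrable lborel \<phi>'" by (rule integrable_continuous_compact_support[OF c(2) K(1,4)])
      then show "integrable lborel (\<lambda>x. \<bar>h 0\<bar> * norm (\<phi>' x) + B * C' * \<bar>u x\<bar>)" using that by auto
      have [measurable]: "u \<in> borel_measurable borel" using that by auto
      show "(\<lambda>x. h (u x) *\<^sub>R \<phi>' x) \<in> borel_measurable lborel" by measurable
      show "AE x in lborel. norm (h (u x) *\<^sub>R \<phi>' x) \<le> norm (\<bar>h 0\<bar> * norm (\<phi>' x) + B * C' * \<bar>u x\<bar>)"
      proof (rule AE_I2)
        fix x
        have "norm (h (u x) *\<^sub>R \<phi>' x) \<le> (\<bar>h 0\<bar> + B * \<bar>u x\<bar>) * norm (\<phi>' x)"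
          using grow[of "u x"] by (simp add: mult_right_mono)
        also have "\<dots> \<le> \<bar>h 0\<bar> * norm (\<phi>' x) + B * C' * \<bar>u x\<bar>"
          using mult_left_mono[OF C'(2)[of x], of "B * \<bar>u x\<bar>"] B0 by (simp add: algebra_simps)
        finally show "norm (h (u x) *\<^sub>R \<phi>' x) \<le> norm (\<bar>h 0\<bar> * norm (\<phi>' x) + B * C' * \<bar>u x\<bar>)" by simp
      qed
    qed
    have lim1: "(\<lambda>n. LINT x|lborel. h (fn n x) *\<^sub>R \<phi>' x) \<longlonglongrightarrow> (LINT x|lborel. h (F x) *\<^sub>R \<phi>' x)"
    proof (rule LIM_zero_cancel, rule Lim_null_comparison)
      show "(\<lambda>n. B * C' * (LINT x|lborel. norm (fn n x - F x))) \<longlonglongrightarrow> 0"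
        by (rule tendsto_mult_right_zero[OF fn_L1])
      have "norm ((LINT x|lborel. h (fn n x) *\<^sub>R \<phi>' x) - (LINT x|lborel. h (F x) *\<^sub>R \<phi>' x)) \<le>
         B * C' * (LINT x|lborel. norm (fn n x - F x))" for n
      proof -
        have "(LINT x|lborel. h (fn n x) *\<^sub>R \<phi>' x) - (LINT x|lborel. h (F x) *\<^sub>R \<phi>' x) =
          (LINT x|lborel. h (fn n x) *\<^sub>R \<phi>' x - h (F x) *\<^sub>R \<phi>' x)"
          by (rule Bochner_Integration.integral_diff[symmetric]) (rule h\<phi>[OF fn_i] h\<phi>[OF F(2)])+
        also have "norm \<dots> \<le> (LINT x|lborel. B * C' * norm (fn n x - F x))"
        proof (rule Bochner_Integration.integral_norm_bound_integral)
          fix x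
          have "norm (h (fn n x) *\<^sub>R \<phi>' x - h (F x) *\<^sub>R \<phi>' x) = \<bar>h (fn n x) - h (F x)\<bar> * norm (\<phi>' x)"
            by (simp flip: scaleR_diff_left)
          also have "\<dots> \<le> (B * \<bar>fn n x - F x\<bar>) * C'"
            using lip C' B0 by (intro mult_mono) auto
          finally show "norm (h (fn n x) *\<^sub>R \<phi>' x - h (F x) *\<^sub>R \<phi>' x) \<le> B * C' * norm (fn n x - F x)"
            by (simp add: mult_ac)
        qed (use h\<phi>[OF fn_i] h\<phi>[OF F(2)] fn_i F(2) in auto)
        finally show ?thesis by simp
      qed
      then show "\<forall>\<^sub>F n in sequentially. norm ((LINT x|lborel. h (fn n x) *\<^sub>R \<phi>' x) - (LINT x|lborel. h (F x) *\<^sub>R \<phi>' x)) \<le>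
         B * C' * (LINT x|lborel. norm (fn n x - F x))"
        by (intro always_eventually allI)
    qed
    have \<phi>h_bound: "norm (\<phi> x *\<^sub>R h' t *\<^sub>R v) \<le> C * B * norm v" for x t and v :: 'a
    proof -
      have "norm (\<phi> x *\<^sub>R h' t *\<^sub>R v) = (\<bar>\<phi> x\<bar> * \<bar>h' t\<bar>) * norm v" by (simp add: abs_mult)
      also have "\<dots> \<le> (C * B) * norm v" using C h'(2)[of t] by (intro mult_right_mono mult_mono) auto
      finally show ?thesis .
    qed
    have \<phi>h: "integrable lborel (\<lambda>x. \<phi> x *\<^sub>R h' (u x) *\<^sub>R v x)"
      if "integrable lborel u" "integrable lborel v" for u and v :: "'a \<Rightarrow> 'a"
    proof (rule Bochner_Integration.integrable_bound[of _ "\<lambda>x. (C * B) *\<^sub>R v x"])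
      have [measurable]: "u \<in> borel_measurable borel" "v \<in> borel_measurable borel" using that by auto
      show "(\<lambda>x. \<phi> x *\<^sub>R h' (u x) *\<^sub>R v x) \<in> borel_measurable lborel" by measurable
      show "AE x in lborel. norm (\<phi> x *\<^sub>R h' (u x) *\<^sub>R v x) \<le> norm ((C * B) *\<^sub>R v x)"
        using \<phi>h_bound C(1) B0 by (intro AE_I2) simp
    qed (use that in auto)
    have lim2: "(\<lambda>n. LINT x|lborel. \<phi> x *\<^sub>R h' (fn n x) *\<^sub>R (gn n x - G x)) \<longlonglongrightarrow> 0"
    proof (rule Lim_null_comparison)
      show "(\<lambda>n. C * B * (LINT x|lborel. norm (gn n x - G x))) \<longlonglongrightarrow> 0"
        by (rule tendsto_mult_right_zero[OF gn_L1])
      have "norm (LINT x|lborel. \<phi> x *\<^sub>R h' (fn n x) *\<^sub>R (gn n x - G x)) \<le> (LINT x|lborel. C * B * norm (gn n x - G x))" for n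
        by (rule Bochner_Integration.integral_norm_bound_integral) (use \<phi>h_bound \<phi>h fn_i gn_i G(2) in auto)
      then show "\<forall>\<^sub>F n in sequentially. norm (LINT x|lborel. \<phi> x *\<^sub>R h' (fn n x) *\<^sub>R (gn n x - G x)) \<le> C * B * (LINT x|lborel. norm (gn n x - G x))"
        by (intro always_eventually allI) simp
    qed
    have lim3: "(\<lambda>n. LINT x|lborel. \<phi> x *\<^sub>R h' (fn (s n) x) *\<^sub>R G x) \<longlonglongrightarrow> (LINT x|lborel. \<phi> x *\<^sub>R h' (F x) *\<^sub>R G x)"
    proof (rule integral_dominated_convergence[where w="\<lambda>x. C * B * norm (G x)"])
      show "AE x in lborel. (\<lambda>n. \<phi> x *\<^sub>R h' (fn (s n) x) *\<^sub>R G x) \<longlonglongrightarrow> \<phi> x *\<^sub>R h' (F x) *\<^sub>R G x"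
        using s(2)
      proof eventually_elim
        case (elim x)
        then have "(\<lambda>n. fn (s n) x) \<longlonglongrightarrow> F x" by (rule LIM_zero_cancel)
        then have "(\<lambda>n. h' (fn (s n) x)) \<longlonglongrightarrow> h' (F x)"
          by (intro continuous_on_tendsto_compose[OF h'(1)]) auto
        then show ?case by (intro tendsto_intros)
      qed
      show "AE x in lborel. norm (\<phi> x *\<^sub>R h' (fn (s n) x) *\<^sub>R G x) \<le> C * B * norm (G x)" for n
        using \<phi>h_bound by (intro AE_I2)
    qed (use G(2) in auto)
    have "(\<lambda>n. - ((LINT x|lborel. \<phi> x *\<^sub>R h' (fn (s n) x) *\<^sub>R (gn (s n) x - G x)) + (LINT x|lborel. \<phi> x *\<^sub>R h' (fn (s n) x) *\<^sub>R G x)))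
       \<longlonglongrightarrow> - (0 + (LINT x|lborel. \<phi> x *\<^sub>R h' (F x) *\<^sub>R G x))"
      using LIMSEQ_subseq_LIMSEQ[OF lim2 s(1)] by (intro tendsto_intros lim3) (simp add: o_def)
    moreover have "- ((LINT x|lborel. \<phi> x *\<^sub>R h' (fn n x) *\<^sub>R (gn n x - G x)) + (LINT x|lborel. \<phi> x *\<^sub>R h' (fn n x) *\<^sub>R G x))
       = (LINT x|lborel. h (fn n x) *\<^sub>R \<phi>' x)" for n
      using smooth[of n] \<phi>h[OF fn_i[of n] gn_i[of n]] \<phi>h[OF fn_i[of n] G(2)] by (simp add: scaleR_diff_right)
    ultimately have "(\<lambda>n. LINT x|lborel. h (fn (s n) x) *\<^sub>R \<phi>' x) \<longlonglongrightarrow> - (LINT x|lborel. \<phi> x *\<^sub>R h' (F x) *\<^sub>R G x)"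
      by simp
    moreover have "(\<lambda>n. LINT x|lborel. h (fn (s n) x) *\<^sub>R \<phi>' x) \<longlonglongrightarrow> (LINT x|lborel. h (F x) *\<^sub>R \<phi>' x)"
      using LIMSEQ_subseq_LIMSEQ[OF lim1 s(1)] by (simp add: o_def)
    ultimately have eq: "(LINT x|lborel. h (F x) *\<^sub>R \<phi>' x) = - (LINT x|lborel. \<phi> x *\<^sub>R h' (F x) *\<^sub>R G x)"
      using LIMSEQ_unique by blast
    have "(LINT x|?L. h (f x) *\<^sub>R \<phi>' x) = (LINT x|lborel. h (F x) *\<^sub>R \<phi>' x)"
    proof (rule lebesgue_on_eq_lborel(2)[OF \<Omega>l])
      show "AE x in lborel. h (F x) *\<^sub>R \<phi>' x = indicator \<Omega> x *\<^sub>R h (f x) *\<^sub>R \<phi>' x"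
        using F(3) by eventually_elim (use K(4) KK' K'(2) in \<open>auto simp: indicator_def\<close>)
    qed measurable
    moreover have "(LINT x|?L. \<phi> x *\<^sub>R h' (f x) *\<^sub>R g x) = (LINT x|lborel. \<phi> x *\<^sub>R h' (F x) *\<^sub>R G x)"
    proof (rule lebesgue_on_eq_lborel(2)[OF \<Omega>l])
      show "AE x in lborel. \<phi> x *\<^sub>R h' (F x) *\<^sub>R G x = indicator \<Omega> x *\<^sub>R \<phi> x *\<^sub>R h' (f x) *\<^sub>R g x"
        using F(3) G(3) by eventually_elim (use K(3) KK' K'(2) in \<open>auto simp: indicator_def\<close>)
    qed measurable
    ultimately show ?thesis using eq by simp
  qed
  show ?thesis
    unfolding has_weak_gradient_def locally_integrable_on_def using loc main by blast
qed

section \<open>Calculus of weak gradients and square-integrable functions\<close>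

text \<open>Completeness transfers measurability along almost everywhere equality; if neither function is
  measurable, both integrals take the default value.\<close>

lemma lebesgue_on_cong_AE:
  fixes f g :: "'a::euclidean_space \<Rightarrow> 'b::euclidean_space"
  assumes S: "S \<in> sets lebesgue" and eq: "AE x in lebesgue_on S. f x = g x"
  shows "f \<in> borel_measurable (lebesgue_on S) \<longleftrightarrow> g \<in> borel_measurable (lebesgue_on S)"
    and "integrable (lebesgue_on S) f \<longleftrightarrow> integrable (lebesgue_on S) g"
    and "(LINT x|lebesgue_on S. f x) = (LINT x|lebesgue_on S. g x)"
proof -
  have transfer: "v \<in> borel_measurable (lebesgue_on S)"
    if eq: "AE x in lebesgue_on S. u x = v x" and u: "u \<in> borel_measurable (lebesgue_on S)"
    for u v :: "'a \<Rightarrow> 'b"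
  proof -
    obtain U where U: "U \<in> borel_measurable borel" "AE x in lborel. U x = indicator S x *\<^sub>R u x"
      by (rule borel_representative[OF S u]) (rule that)
    have "AE x in lborel. x \<in> S \<longrightarrow> u x = v x" using eq by (simp add: AE_lebesgue_on_iff S)
    with U(2) have "AE x in lborel. U x = indicator S x *\<^sub>R v x"
      by eventually_elim (auto simp: indicator_def)
    then show ?thesis by (rule lebesgue_on_eq_lborel(1)[OF S U(1)])
  qed
  have eq': "AE x in lebesgue_on S. g x = f x" using eq by eventually_elim simp
  show m: "f \<in> borel_measurable (lebesgue_on S) \<longleftrightarrow> g \<in> borel_measurable (lebesgue_on S)"
    using transfer[OF eq] transfer[OF eq'] by blast
  show i: "integrable (lebesgue_on S) f \<longleftrightarrow> integrable (lebesgue_on S) g"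
    using m integrable_cong_AE[OF _ _ eq] borel_measurable_integrable by blast
  show "(LINT x|lebesgue_on S. f x) = (LINT x|lebesgue_on S. g x)"
  proof (cases "f \<in> borel_measurable (lebesgue_on S)")
    case True
    then show ?thesis using m by (intro integral_cong_AE eq) auto
  next
    case False
    then have "\<not> integrable (lebesgue_on S) f" "\<not> integrable (lebesgue_on S) g"
      using i borel_measurable_integrable by blast+
    then show ?thesis by (simp add: not_integrable_integral_eq)
  qed
qed

lemma AE_lebesgue_on_subset:
  assumes "S \<in> sets lebesgue" "T \<in> sets lebesgue" "T \<subseteq> S" "AE x in lebesgue_on S. P x"
  shows "AE x in lebesgue_on T. P x"
proof -
  have "AE x in lborel. x \<in> S \<longrightarrow> P x" using assms(1,4) by (simp add: AE_lebesgue_on_iff)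
  then have "AE x in lborel. x \<in> T \<longrightarrow> P x" by eventually_elim (use assms(3) in blast)
  then show ?thesis using assms(2) by (simp add: AE_lebesgue_on_iff)
qed

lemma compact_lebesgue: "compact K \<Longrightarrow> K \<in> sets lebesgue" for K :: "'a::euclidean_space set"
  by (simp add: borel_compact)

lemma locally_integrable_cong_AE:
  assumes \<Omega>: "\<Omega> \<in> sets lebesgue" and eq: "AE x in lebesgue_on \<Omega>. f x = g x"
    and f: "locally_integrable_on \<Omega> f"
  shows "locally_integrable_on \<Omega> g"
  unfolding locally_integrable_on_def
proof (intro allI impI, elim conjE)
  fix K assume K: "compact K" "K \<subseteq> \<Omega>"
  have "AE x in lebesgue_on K. f x = g x"
    using \<Omega> compact_lebesgue[OF K(1)] K(2) eq by (rule AE_lebesgue_on_subset)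
  then show "integrable (lebesgue_on K) g"
    using f K lebesgue_on_cong_AE(2)[OF compact_lebesgue[OF K(1)], of f g] by (simp add: locally_integrable_on_def)
qed

lemma has_weak_gradient_cong_AE:
  assumes \<Omega>: "\<Omega> \<in> sets lebesgue" and eq: "AE x in lebesgue_on \<Omega>. f x = f' x" "AE x in lebesgue_on \<Omega>. g x = g' x"
    and wg: "has_weak_gradient \<Omega> f g"
  shows "has_weak_gradient \<Omega> f' g'"
  unfolding has_weak_gradient_def
proof (intro conjI allI impI)
  show "locally_integrable_on \<Omega> f'" "locally_integrable_on \<Omega> g'"
    using locally_integrable_cong_AE[OF \<Omega> eq(1)] locally_integrable_cong_AE[OF \<Omega> eq(2)] wg
    by (auto simp: has_weak_gradient_def)
  fix \<phi> \<phi>' assume t: "test_function \<Omega> \<phi> \<phi>'"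
  have "(LINT x|lebesgue_on \<Omega>. f x *\<^sub>R \<phi>' x) = (LINT x|lebesgue_on \<Omega>. f' x *\<^sub>R \<phi>' x)"
    by (rule lebesgue_on_cong_AE(3)[OF \<Omega>]) (use eq(1) in eventually_elim, simp)
  moreover have "(LINT x|lebesgue_on \<Omega>. \<phi> x *\<^sub>R g x) = (LINT x|lebesgue_on \<Omega>. \<phi> x *\<^sub>R g' x)"
    by (rule lebesgue_on_cong_AE(3)[OF \<Omega>]) (use eq(2) in eventually_elim, simp)
  ultimately show "(LINT x|lebesgue_on \<Omega>. f' x *\<^sub>R \<phi>' x) = - (LINT x|lebesgue_on \<Omega>. \<phi> x *\<^sub>R g' x)"
    using wg t by (simp add: has_weak_gradient_def)
qed

lemma borel_measurable_bilinear:
  fixes prod :: "'b::euclidean_space \<Rightarrow> 'c::euclidean_space \<Rightarrow> 'd::euclidean_space"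
  assumes "bounded_bilinear prod" and "f \<in> borel_measurable M" "g \<in> borel_measurable M"
  shows "(\<lambda>x. prod (f x) (g x)) \<in> borel_measurable M"
  by (rule borel_measurable_continuous_Pair[OF assms(2,3)])
    (rule bounded_bilinear.continuous_on[OF assms(1)], auto intro!: continuous_intros)

lemma integrable_bilinear_bounded:
  fixes prod :: "'b::euclidean_space \<Rightarrow> 'c::euclidean_space \<Rightarrow> 'd::euclidean_space"
  assumes p: "bounded_bilinear prod" and f: "f \<in> borel_measurable M" "AE x in M. norm (f x) \<le> B"
    and g: "integrable M g"
  shows "integrable M (\<lambda>x. prod (f x) (g x))"
proof -
  obtain c where c: "c > 0" "\<And>x y. norm (prod x y) \<le> norm x * norm y * c"
    using bounded_bilinear.pos_bounded[OF p] by blast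
  show ?thesis
  proof (rule Bochner_Integration.integrable_bound)
    show "integrable M (\<lambda>x. (B * c) *\<^sub>R g x)" using g by simp
    show "(\<lambda>x. prod (f x) (g x)) \<in> borel_measurable M"
      by (rule borel_measurable_bilinear[OF p f(1)]) (use g in auto)
    show "AE x in M. norm (prod (f x) (g x)) \<le> norm ((B * c) *\<^sub>R g x)"
      using f(2)
    proof eventually_elim
      case (elim x)
      have "norm (prod (f x) (g x)) \<le> norm (f x) * norm (g x) * c" by (rule c)
      also have "\<dots> \<le> B * norm (g x) * c" using elim c(1) by (intro mult_right_mono) auto
      also have "\<dots> = (B * c) * norm (g x)" by simp
      also have "\<dots> \<le> \<bar>B * c\<bar> * norm (g x)" by (intro mult_right_mono) auto
      finally show ?case by simp
    qed
  qed
qed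

lemma integrable_locally_mult:
  fixes prod :: "'b::euclidean_space \<Rightarrow> 'c::euclidean_space \<Rightarrow> 'd::euclidean_space" and \<Omega> :: "'a::euclidean_space set"
  assumes p: "bounded_bilinear prod" and \<Omega>: "\<Omega> \<in> sets lebesgue"
    and c: "continuous_on UNIV c" and K: "compact K" "K \<subseteq> \<Omega>" "\<And>x. x \<notin> K \<Longrightarrow> c x = 0"
    and g: "locally_integrable_on \<Omega> g"
  shows "integrable (lebesgue_on \<Omega>) (\<lambda>x. prod (c x) (g x))"
proof -
  obtain G where G: "G \<in> borel_measurable borel" "integrable lborel G" "AE x in lborel. G x = indicator K x *\<^sub>R g x"
    by (rule local_representative[OF g K(1,2)]) (rule that)
  obtain B where B: "\<And>x. norm (c x) \<le> B" using bounded_continuous_compact_support[OF c K(1,3)] by metis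
  have cb: "c \<in> borel_measurable borel" using c by (rule borel_measurable_continuous_onI)
  have "integrable lborel (\<lambda>x. prod (c x) (G x))"
    by (rule integrable_bilinear_bounded[OF p _ _ G(2), where B=B]) (use B cb in auto)
  moreover have "(\<lambda>x. prod (c x) (G x)) \<in> borel_measurable borel"
    by (rule borel_measurable_bilinear[OF p cb G(1)])
  moreover have "AE x in lborel. prod (c x) (G x) = indicator \<Omega> x *\<^sub>R prod (c x) (g x)"
    using G(3)
  proof eventually_elim
    case (elim x)
    then show ?case
      using subsetD[OF K(2), of x] K(3)[of x] bounded_bilinear.zero_left[OF p] by (cases "x \<in> K") (auto simp: indicator_def)
  qed
  ultimately show ?thesis 
    using lebesgue_on_eq_lborel(3)[OF \<Omega>, of "\<lambda>x. prod (c x) (G x)" "\<lambda>x. prod (c x) (g x)"] by simp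
qed

lemma integrable_test_mult:
  fixes f :: "'a::euclidean_space \<Rightarrow> real" and g :: "'a \<Rightarrow> 'b::euclidean_space"
  assumes \<Omega>: "\<Omega> \<in> sets lebesgue" and t: "test_function \<Omega> \<phi> \<phi>'"
  shows "locally_integrable_on \<Omega> f \<Longrightarrow> integrable (lebesgue_on \<Omega>) (\<lambda>x. f x *\<^sub>R \<phi>' x)"
    and "locally_integrable_on \<Omega> g \<Longrightarrow> integrable (lebesgue_on \<Omega>) (\<lambda>x. \<phi> x *\<^sub>R g x)"
proof -
  from t obtain K where K: "compact K" "K \<subseteq> \<Omega>" "\<And>x. x \<notin> K \<Longrightarrow> \<phi> x = 0" "\<And>x. x \<notin> K \<Longrightarrow> \<phi>' x = 0"
    and c: "continuous_on UNIV \<phi>" "continuous_on UNIV \<phi>'" and d: "\<And>x. GDERIV \<phi> x :> \<phi>' x"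
    by (rule test_functionD) (rule that)
  show "locally_integrable_on \<Omega> f \<Longrightarrow> integrable (lebesgue_on \<Omega>) (\<lambda>x. f x *\<^sub>R \<phi>' x)"
    by (rule integrable_locally_mult[OF bounded_bilinear.flip[OF bounded_bilinear_scaleR] \<Omega> c(2) K(1,2,4)])
  show "locally_integrable_on \<Omega> g \<Longrightarrow> integrable (lebesgue_on \<Omega>) (\<lambda>x. \<phi> x *\<^sub>R g x)"
    by (rule integrable_locally_mult[OF bounded_bilinear_scaleR \<Omega> c(1) K(1,2,3)])
qed

lemma locally_integrable_add:
  "locally_integrable_on \<Omega> f \<Longrightarrow> locally_integrable_on \<Omega> g \<Longrightarrow> locally_integrable_on \<Omega> (\<lambda>x. f x + g x)"
  unfolding locally_integrable_on_def by auto

lemma locally_integrable_uminus: "locally_integrable_on \<Omega> f \<Longrightarrow> locally_integrable_on \<Omega> (\<lambda>x. - f x)"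
  unfolding locally_integrable_on_def by auto

lemma has_weak_gradient_add:
  assumes \<Omega>: "\<Omega> \<in> sets lebesgue" and "has_weak_gradient \<Omega> f f'" "has_weak_gradient \<Omega> g g'"
  shows "has_weak_gradient \<Omega> (\<lambda>x. f x + g x) (\<lambda>x. f' x + g' x)"
  unfolding has_weak_gradient_def
proof (intro conjI allI impI)
  have loc: "locally_integrable_on \<Omega> f" "locally_integrable_on \<Omega> g" "locally_integrable_on \<Omega> f'" "locally_integrable_on \<Omega> g'"
    using assms by (auto simp: has_weak_gradient_def)
  then show "locally_integrable_on \<Omega> (\<lambda>x. f x + g x)" "locally_integrable_on \<Omega> (\<lambda>x. f' x + g' x)"
    by (auto intro: locally_integrable_add)
  fix \<phi> \<phi>' assume t: "test_function \<Omega> \<phi> \<phi>'"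
  note i = integrable_test_mult(1)[OF \<Omega> t loc(1)] integrable_test_mult(1)[OF \<Omega> t loc(2)]
    integrable_test_mult(2)[OF \<Omega> t loc(3)] integrable_test_mult(2)[OF \<Omega> t loc(4)]
  show "(LINT x|lebesgue_on \<Omega>. (f x + g x) *\<^sub>R \<phi>' x) = - (LINT x|lebesgue_on \<Omega>. \<phi> x *\<^sub>R (f' x + g' x))"
    using i assms(2,3) t by (simp add: has_weak_gradient_def scaleR_add_left scaleR_add_right)
qed

lemma has_weak_gradient_uminus:
  assumes "has_weak_gradient \<Omega> f f'"
  shows "has_weak_gradient \<Omega> (\<lambda>x. - f x) (\<lambda>x. - f' x)"
  using assms unfolding has_weak_gradient_def by (auto intro: locally_integrable_uminus)

lemma locally_integrable_continuous:
  fixes f :: "'a::euclidean_space \<Rightarrow> 'b::euclidean_space"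
  assumes "continuous_on UNIV f"
  shows "locally_integrable_on \<Omega> f"
  unfolding locally_integrable_on_def
proof (intro allI impI, elim conjE)
  fix K assume K: "compact K" "K \<subseteq> \<Omega>"
  have "integrable lborel (\<lambda>x. indicator K x *\<^sub>R f x)"
    using K(1) assms by (intro borel_integrable_compact) (auto intro: continuous_on_subset)
  moreover from this have "(\<lambda>x. indicator K x *\<^sub>R f x) \<in> borel_measurable borel"
    using borel_measurable_integrable by force
  ultimately show "integrable (lebesgue_on K) f"
    using lebesgue_on_eq_lborel(3)[OF compact_lebesgue[OF K(1)], of "\<lambda>x. indicator K x *\<^sub>R f x" f] by simp
qed

lemma has_weak_gradient_const:
  assumes \<Omega>: "\<Omega> \<in> sets lebesgue"
  shows "has_weak_gradient \<Omega> (\<lambda>_. c) (\<lambda>_. 0)"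
  unfolding has_weak_gradient_def
proof (intro conjI allI impI)
  show "locally_integrable_on \<Omega> (\<lambda>_. c)" "locally_integrable_on \<Omega> (\<lambda>_. 0 :: 'a)"
    by (auto intro: locally_integrable_continuous)
  fix \<phi> and \<phi>' :: "'a \<Rightarrow> 'a" assume t: "test_function \<Omega> \<phi> \<phi>'"
  then obtain K where K: "K \<subseteq> \<Omega>" "\<And>x. x \<notin> K \<Longrightarrow> \<phi>' x = 0" and c: "continuous_on UNIV \<phi>'"
    by (rule test_functionD) (rule that)
  have "(LINT x|lebesgue_on \<Omega>. \<phi>' x) = (LINT x|lborel. \<phi>' x)"
    using c by (intro lebesgue_on_eq_lborel(2)[OF \<Omega>] borel_measurable_continuous_onI)
      (use K in \<open>auto intro!: AE_I2 simp: indicator_def\<close>)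
  then show "(LINT x|lebesgue_on \<Omega>. c *\<^sub>R \<phi>' x) = - (LINT x|lebesgue_on \<Omega>. \<phi> x *\<^sub>R (0::'a))"
    using integral_test_gradient[OF t] by simp
qed

lemma has_weak_gradient_unique:
  fixes f :: "'a::euclidean_space \<Rightarrow> real"
  assumes \<Omega>: "open \<Omega>" and "has_weak_gradient \<Omega> f g" "has_weak_gradient \<Omega> f g'"
  shows "AE x in lebesgue_on \<Omega>. g x = g' x"
proof -
  have \<Omega>l: "\<Omega> \<in> sets lebesgue" using \<Omega> by simp
  have wg: "has_weak_gradient \<Omega> (\<lambda>x. f x + - f x) (\<lambda>x. g x + - g' x)"
    by (intro has_weak_gradient_add[OF \<Omega>l] has_weak_gradient_uminus assms)
  have "AE x in lebesgue_on \<Omega>. g x + - g' x = 0"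
  proof (rule fundamental_lemma[OF \<Omega>])
    show "locally_integrable_on \<Omega> (\<lambda>x. g x + - g' x)" using wg by (simp add: has_weak_gradient_def)
    show "(LINT x|lebesgue_on \<Omega>. \<phi> x *\<^sub>R (g x + - g' x)) = 0" if "test_function \<Omega> \<phi> \<phi>'" for \<phi> \<phi>'
      using wg that unfolding has_weak_gradient_def by fastforce
  qed
  then show ?thesis by eventually_elim simp
qed

lemma wgrad:
  assumes "has_weak_gradient \<Omega> f g"
  shows "has_weak_gradient \<Omega> f (wgrad \<Omega> f)"
  unfolding wgrad_def using assms by (rule someI[of "\<lambda>g. has_weak_gradient \<Omega> f g"])

lemma wgrad_AE_eq:
  assumes "open \<Omega>" "has_weak_gradient \<Omega> f g"
  shows "AE x in lebesgue_on \<Omega>. wgrad \<Omega> f x = g x"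
  using has_weak_gradient_unique[OF assms(1) wgrad[OF assms(2)] assms(2)] .

lemma has_weak_divergence_unique:
  fixes a :: "'a::euclidean_space \<Rightarrow> 'a"
  assumes \<Omega>: "open \<Omega>" and "has_weak_divergence \<Omega> a f" "has_weak_divergence \<Omega> a g"
  shows "AE x in lebesgue_on \<Omega>. f x = g x"
proof -
  let ?L = "lebesgue_on \<Omega>"
  have \<Omega>l: "\<Omega> \<in> sets lebesgue" using \<Omega> by simp
  have loc: "locally_integrable_on \<Omega> f" "locally_integrable_on \<Omega> g"
    using assms by (auto simp: has_weak_divergence_def)
  have "AE x in ?L. f x + - g x = 0"
  proof (rule fundamental_lemma[OF \<Omega>])
    show "locally_integrable_on \<Omega> (\<lambda>x. f x + - g x)"
      by (intro locally_integrable_add locally_integrable_uminus loc)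
    fix \<phi> \<phi>' assume t: "test_function \<Omega> \<phi> \<phi>'"
    have "(LINT x|?L. a x \<bullet> \<phi>' x) = - (LINT x|?L. f x * \<phi> x)"
      "(LINT x|?L. a x \<bullet> \<phi>' x) = - (LINT x|?L. g x * \<phi> x)"
      using assms(2,3) t unfolding has_weak_divergence_def by blast+
    then have "(LINT x|?L. f x * \<phi> x) = (LINT x|?L. g x * \<phi> x)" by simp
    then show "(LINT x|?L. \<phi> x *\<^sub>R (f x + - g x)) = 0"
      using integrable_test_mult(2)[OF \<Omega>l t loc(1)] integrable_test_mult(2)[OF \<Omega>l t loc(2)]
      by (simp add: algebra_simps)
  qed
  then show ?thesis by eventually_elim simp
qed

lemma L2_on_cong_AE:
  assumes "S \<in> sets lebesgue" "AE x in lebesgue_on S. f x = g x" "L2_on S f"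
  shows "L2_on S g"
proof -
  have "AE x in lebesgue_on S. (norm (f x))\<^sup>2 = (norm (g x))\<^sup>2" using assms(2) by eventually_elim simp
  from lebesgue_on_cong_AE(2)[OF assms(1) this] lebesgue_on_cong_AE(1)[OF assms(1,2)] assms(3)
  show ?thesis by (simp add: L2_on_def)
qed

lemma L2_on_bound:
  assumes "f \<in> borel_measurable (lebesgue_on S)" "integrable (lebesgue_on S) w"
    and "AE x in lebesgue_on S. (norm (f x))\<^sup>2 \<le> w x"
  shows "L2_on S f"
  unfolding L2_on_def
proof
  show "integrable (lebesgue_on S) (\<lambda>x. (norm (f x))\<^sup>2)"
    by (rule Bochner_Integration.integrable_bound[OF assms(2)])
      (use assms(1,3) in \<open>auto elim!: eventually_mono\<close>)
qed (rule assms(1))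

lemma L2_on_add:
  assumes "L2_on S f" "L2_on S g"
  shows "L2_on S (\<lambda>x. f x + g x)"
proof (rule L2_on_bound[where w="\<lambda>x. 2 * (norm (f x))\<^sup>2 + 2 * (norm (g x))\<^sup>2"])
  show "(\<lambda>x. f x + g x) \<in> borel_measurable (lebesgue_on S)" using assms by (auto simp: L2_on_def)
  show "integrable (lebesgue_on S) (\<lambda>x. 2 * (norm (f x))\<^sup>2 + 2 * (norm (g x))\<^sup>2)" using assms by (auto simp: L2_on_def)
  have "(norm (f x + g x))\<^sup>2 \<le> 2 * (norm (f x))\<^sup>2 + 2 * (norm (g x))\<^sup>2" for x
  proof -
    have "(norm (f x + g x))\<^sup>2 \<le> (norm (f x) + norm (g x))\<^sup>2"
      by (intro power_mono norm_triangle_ineq) simp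
    also have "\<dots> \<le> 2 * (norm (f x))\<^sup>2 + 2 * (norm (g x))\<^sup>2"
      using sum_squares_bound[of "norm (f x)" "norm (g x)"] by (simp add: power2_sum)
    finally show ?thesis .
  qed
  then show "AE x in lebesgue_on S. (norm (f x + g x))\<^sup>2 \<le> 2 * (norm (f x))\<^sup>2 + 2 * (norm (g x))\<^sup>2" by simp
qed

lemma L2_on_inner_integrable:
  assumes "L2_on S f" "L2_on S g"
  shows "integrable (lebesgue_on S) (\<lambda>x. f x \<bullet> g x)"
proof (rule Bochner_Integration.integrable_bound[of _ "\<lambda>x. (norm (f x))\<^sup>2 + (norm (g x))\<^sup>2"])
  show "integrable (lebesgue_on S) (\<lambda>x. (norm (f x))\<^sup>2 + (norm (g x))\<^sup>2)" "(\<lambda>x. f x \<bullet> g x) \<in> borel_measurable (lebesgue_on S)"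
    using assms by (auto simp: L2_on_def)
  have "norm (f x \<bullet> g x) \<le> norm ((norm (f x))\<^sup>2 + (norm (g x))\<^sup>2)" for x
  proof -
    have "norm (f x \<bullet> g x) \<le> norm (f x) * norm (g x)" by (simp add: Cauchy_Schwarz_ineq2)
    also have "\<dots> \<le> (norm (f x))\<^sup>2 + (norm (g x))\<^sup>2"
      using sum_squares_bound[of "norm (f x)" "norm (g x)"] mult_nonneg_nonneg[of "norm (f x)" "norm (g x)"] by (simp del: mult_nonneg_nonneg)
    finally show ?thesis by simp
  qed
  then show "AE x in lebesgue_on S. norm (f x \<bullet> g x) \<le> norm ((norm (f x))\<^sup>2 + (norm (g x))\<^sup>2)" by simp
qed

lemma L2_on_bounded_mult:
  fixes prod :: "'b::euclidean_space \<Rightarrow> 'c::euclidean_space \<Rightarrow> 'd::euclidean_space"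
  assumes p: "bounded_bilinear prod" and c: "c \<in> borel_measurable (lebesgue_on S)" "AE x in lebesgue_on S. norm (c x) \<le> B"
    and f: "L2_on S f"
  shows "L2_on S (\<lambda>x. prod (c x) (f x))"
proof -
  obtain k where k: "k > 0" "\<And>x y. norm (prod x y) \<le> norm x * norm y * k"
    using bounded_bilinear.pos_bounded[OF p] by blast
  show ?thesis
  proof (rule L2_on_bound)
    show "(\<lambda>x. prod (c x) (f x)) \<in> borel_measurable (lebesgue_on S)"
      using f by (intro borel_measurable_bilinear[OF p c(1)]) (auto simp: L2_on_def)
    show "integrable (lebesgue_on S) (\<lambda>x. (B * k)\<^sup>2 * (norm (f x))\<^sup>2)" using f by (auto simp: L2_on_def)
    show "AE x in lebesgue_on S. (norm (prod (c x) (f x)))\<^sup>2 \<le> (B * k)\<^sup>2 * (norm (f x))\<^sup>2"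
      using c(2)
    proof eventually_elim
      case (elim x)
      have "norm (prod (c x) (f x)) \<le> norm (c x) * norm (f x) * k" by (rule k)
      also have "\<dots> \<le> B * norm (f x) * k" using elim k(1) by (intro mult_right_mono) auto
      finally have "norm (prod (c x) (f x)) \<le> (B * k) * norm (f x)" by (simp add: mult_ac)
      then show ?case by (metis norm_ge_zero power_mono power_mult_distrib)
    qed
  qed
qed

lemma emeasure_lebesgue_on_finite:
  assumes "S \<in> sets lebesgue" "bounded S"
  shows "finite_measure (lebesgue_on S)"
  using assms by (intro finite_measure_lebesgue_on bounded_set_imp_lmeasurable)

lemma L2_on_imp_integrable:
  assumes S: "S \<in> sets lebesgue" "bounded S" and f: "L2_on S f"
  shows "integrable (lebesgue_on S) f"
proof (rule Bochner_Integration.integrable_bound[of _ "\<lambda>x. 1 + (norm (f x))\<^sup>2"])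
  interpret finite_measure "lebesgue_on S" using S by (rule emeasure_lebesgue_on_finite)
  show "integrable (lebesgue_on S) (\<lambda>x. 1 + (norm (f x))\<^sup>2)" "f \<in> borel_measurable (lebesgue_on S)"
    using f by (auto simp: L2_on_def)
  have "norm (f x) \<le> norm (1 + (norm (f x))\<^sup>2)" for x
  proof -
    have "2 * norm (f x) \<le> 1 + (norm (f x))\<^sup>2" using sum_squares_bound[of 1 "norm (f x)"] by simp
    then have "norm (f x) \<le> 1 + (norm (f x))\<^sup>2" using norm_ge_zero[of "f x"] by linarith
    then show ?thesis by simp
  qed
  then show "AE x in lebesgue_on S. norm (f x) \<le> norm (1 + (norm (f x))\<^sup>2)" by simp
qed

lemma integrable_imp_locally_integrable:
  assumes \<Omega>: "\<Omega> \<in> sets lebesgue" and f: "integrable (lebesgue_on \<Omega>) f"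
  shows "locally_integrable_on \<Omega> f"
  unfolding locally_integrable_on_def
proof (intro allI impI, elim conjE)
  fix K assume K: "compact K" "K \<subseteq> \<Omega>"
  have "integrable lebesgue (\<lambda>x. indicator \<Omega> x *\<^sub>R f x)"
    using f \<Omega> by (simp add: integrable_restrict_space)
  then have "integrable lebesgue (\<lambda>x. indicator K x *\<^sub>R indicator \<Omega> x *\<^sub>R f x)"
    by (rule integrable_mult_indicator[OF compact_lebesgue[OF K(1)]])
  also have "(\<lambda>x. indicator K x *\<^sub>R indicator \<Omega> x *\<^sub>R f x) = (\<lambda>x. indicator K x *\<^sub>R f x)"
    using K(2) by (intro ext) (auto simp: indicator_def)
  finally show "integrable (lebesgue_on K) f"
    using compact_lebesgue[OF K(1)] by (simp add: integrable_restrict_space)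
qed

section \<open>Convolution with two-body kernels\<close>

lemma open_diff_set:
  assumes "open \<Omega>" shows "open (diff_set (\<Omega> :: 'a::real_normed_vector set))"
proof -
  have "diff_set \<Omega> = (\<Union>r'\<in>\<Omega>. (\<lambda>r. r - r') ` \<Omega>)" by (auto simp: diff_set_def)
  then show ?thesis using assms by (simp add: open_UN open_translation_subtract)
qed

lemma bounded_diff_set:
  assumes "bounded \<Omega>" shows "bounded (diff_set (\<Omega> :: 'a::real_normed_vector set))"
proof -
  obtain R where R: "\<And>x. x \<in> \<Omega> \<Longrightarrow> norm x \<le> R" using assms by (auto simp: bounded_iff)
  show ?thesis unfolding bounded_iff
  proof (intro exI ballI)
    fix z assume "z \<in> diff_set \<Omega>"
    then obtain r r' where "z = r - r'" "r \<in> \<Omega>" "r' \<in> \<Omega>" by (auto simp: diff_set_def)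
    then show "norm z \<le> R + R" using norm_triangle_ineq4[of r r'] R[of r] R[of r'] by simp
  qed
qed

lemma diff_setI: "r \<in> \<Omega> \<Longrightarrow> r' \<in> \<Omega> \<Longrightarrow> r - r' \<in> diff_set \<Omega>"
  by (auto simp: diff_set_def)

text \<open>For \<open>r\<close> and \<open>r'\<close> in the domain \<open>r - r'\<close> lies in the difference set, so the zero extensions do not
  change the integral. Null sets of kernels are harmless for every single \<open>r\<close>, since reflections preserve
  null sets.\<close>

lemma conv_eq_convolution:
  fixes K :: "'a::euclidean_space \<Rightarrow> 'b::euclidean_space"
  assumes \<Omega>: "\<Omega> \<in> sets lebesgue"
    and R: "R \<in> borel_measurable borel" "AE x in lborel. R x = indicator \<Omega> x *\<^sub>R \<rho> x"
    and L: "L \<in> borel_measurable borel" "AE z in lborel. L z = indicator (diff_set \<Omega>) z *\<^sub>R K z"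
    and r: "r \<in> \<Omega>"
  shows "conv \<Omega> K \<rho> r = convolution R L r"
  unfolding conv_def convolution_def
proof (rule lebesgue_on_eq_lborel(2)[OF \<Omega>])
  note [measurable] = R(1) L(1)
  show "(\<lambda>y. R y *\<^sub>R L (r - y)) \<in> borel_measurable borel" by measurable
  show "AE y in lborel. R y *\<^sub>R L (r - y) = indicator \<Omega> y *\<^sub>R \<rho> y *\<^sub>R K (r - y)"
    using R(2) AE_lborel_diff[OF L(2), of r]
    by eventually_elim (use r in \<open>auto simp: indicator_def diff_setI\<close>)
qed

lemma conv_integrable:
  fixes K :: "'a::euclidean_space \<Rightarrow> 'b::euclidean_space"
  assumes \<Omega>: "open \<Omega>" and \<rho>: "integrable (lebesgue_on \<Omega>) \<rho>" and K: "integrable (lebesgue_on (diff_set \<Omega>)) K"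
  shows "integrable (lebesgue_on \<Omega>) (conv \<Omega> K \<rho>)"
proof -
  have \<Omega>l: "\<Omega> \<in> sets lebesgue" "diff_set \<Omega> \<in> sets lebesgue" and [measurable]: "\<Omega> \<in> sets borel"
    using \<Omega> open_diff_set[OF \<Omega>] by auto
  obtain R where R: "R \<in> borel_measurable borel" "integrable lborel R" "AE x in lborel. R x = indicator \<Omega> x *\<^sub>R \<rho> x"
    by (rule integrable_representative[OF \<Omega>l(1) \<rho>]) (rule that)
  obtain L where L: "L \<in> borel_measurable borel" "integrable lborel L" "AE x in lborel. L x = indicator (diff_set \<Omega>) x *\<^sub>R K x"
    by (rule integrable_representative[OF \<Omega>l(2) K]) (rule that)
  note i = convolution_integrable[OF R(2) L(2)]
  have "integrable lborel (\<lambda>x. indicator \<Omega> x *\<^sub>R convolution R L x)"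
    using integrable_mult_indicator[OF _ i, of \<Omega>] by simp
  moreover have "AE x in lborel. indicator \<Omega> x *\<^sub>R convolution R L x = indicator \<Omega> x *\<^sub>R conv \<Omega> K \<rho> x"
    using conv_eq_convolution[OF \<Omega>l(1) R(1,3) L(1,3)] by (intro AE_I2) (auto simp: indicator_def)
  moreover from i have [measurable]: "convolution R L \<in> borel_measurable borel" by auto
  ultimately show ?thesis
    by (subst lebesgue_on_eq_lborel(3)[OF \<Omega>l(1), of "\<lambda>x. indicator \<Omega> x *\<^sub>R convolution R L x"]) auto
qed

lemma test_function_shift:
  fixes y :: "'a::euclidean_space"
  assumes t: "test_function \<Omega> \<phi> \<phi>'" and y: "y \<in> \<Omega>"
  shows "test_function (diff_set \<Omega>) (\<lambda>z. \<phi> (z + y)) (\<lambda>z. \<phi>' (z + y))"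
proof -
  from t obtain K where K: "compact K" "K \<subseteq> \<Omega>" "\<And>x. x \<notin> K \<Longrightarrow> \<phi> x = 0" 
    and c: "continuous_on UNIV \<phi>'" and d: "\<And>x. GDERIV \<phi> x :> \<phi>' x"
    by (rule test_functionD) (rule that)
  show ?thesis
  proof (rule test_functionI)
    show "GDERIV (\<lambda>z. \<phi> (z + y)) z :> \<phi>' (z + y)" for z
    proof -
      have "((\<lambda>z. z + y) has_derivative (\<lambda>h. h)) (at z)" by (auto intro!: derivative_eq_intros)
      from has_derivative_compose[OF this, of \<phi> "\<lambda>h. h \<bullet> \<phi>' (z + y)"] d[of "z + y"] show ?thesis
        by (simp add: gderiv_def)
    qed
    show "continuous_on UNIV (\<lambda>z. \<phi>' (z + y))"
      by (rule continuous_on_compose2[OF c]) (auto intro!: continuous_intros)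
    show "compact ((\<lambda>x. x - y) ` K)" using K(1) by (rule compact_translation_subtract)
    show "(\<lambda>x. x - y) ` K \<subseteq> diff_set \<Omega>" using K(2) y by (auto intro: diff_setI)
    show "\<phi> (z + y) = 0" if "z \<notin> (\<lambda>x. x - y) ` K" for z
      using that by (intro K(3)) (force simp: image_iff)
  qed
qed

text \<open>By Fubini's theorem the integral against a test function is a \<open>\<rho>\<close>-average of integrals of \<open>V\<close> against
  translated test functions, and a translate by a point of the domain is a test function on the
  difference set.\<close>

lemma has_weak_gradient_conv:
  fixes V :: "'a::euclidean_space \<Rightarrow> real"
  assumes \<Omega>: "open \<Omega>" and \<rho>: "integrable (lebesgue_on \<Omega>) \<rho>"
    and V: "integrable (lebesgue_on (diff_set \<Omega>)) V" and G: "integrable (lebesgue_on (diff_set \<Omega>)) G"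
    and wg: "has_weak_gradient (diff_set \<Omega>) V G"
  shows "has_weak_gradient \<Omega> (conv \<Omega> V \<rho>) (conv \<Omega> G \<rho>)"
  unfolding has_weak_gradient_def
proof (intro conjI allI impI)
  let ?L = "lebesgue_on \<Omega>" and ?S = "lebesgue_on (diff_set \<Omega>)"
  have \<Omega>l: "\<Omega> \<in> sets lebesgue" "diff_set \<Omega> \<in> sets lebesgue"
    using \<Omega> open_diff_set[OF \<Omega>] by auto
  show "locally_integrable_on \<Omega> (conv \<Omega> V \<rho>)" "locally_integrable_on \<Omega> (conv \<Omega> G \<rho>)"
    by (intro integrable_imp_locally_integrable[OF \<Omega>l(1)] conv_integrable \<Omega> \<rho> V G)+
  fix \<phi> \<phi>' assume t: "test_function \<Omega> \<phi> \<phi>'"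
  then obtain K where K: "compact K" "K \<subseteq> \<Omega>" "\<And>x. x \<notin> K \<Longrightarrow> \<phi> x = 0" "\<And>x. x \<notin> K \<Longrightarrow> \<phi>' x = 0"
    and c: "continuous_on UNIV \<phi>" "continuous_on UNIV \<phi>'" and d: "\<And>x. GDERIV \<phi> x :> \<phi>' x"
    by (rule test_functionD) (rule that)
  have [measurable]: "\<phi> \<in> borel_measurable borel" "\<phi>' \<in> borel_measurable borel"
    using c by (auto intro: borel_measurable_continuous_onI)
  obtain C where C: "C > 0" "\<And>x. norm (\<phi> x) \<le> C" using bounded_continuous_compact_support[OF c(1) K(1,3)] by metis
  obtain C' where C': "C' > 0" "\<And>x. norm (\<phi>' x) \<le> C'" using bounded_continuous_compact_support[OF c(2) K(1,4)] by metis
  obtain R where R: "R \<in> borel_measurable borel" "integrable lborel R" "AE x in lborel. R x = indicator \<Omega> x *\<^sub>R \<rho> x"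
    by (rule integrable_representative[OF \<Omega>l(1) \<rho>]) (rule that)
  obtain U where U: "U \<in> borel_measurable borel" "integrable lborel U" "AE x in lborel. U x = indicator (diff_set \<Omega>) x *\<^sub>R V x"
    by (rule integrable_representative[OF \<Omega>l(2) V]) (rule that)
  obtain H where H: "H \<in> borel_measurable borel" "integrable lborel H" "AE x in lborel. H x = indicator (diff_set \<Omega>) x *\<^sub>R G x"
    by (rule integrable_representative[OF \<Omega>l(2) G]) (rule that)
  note [measurable] = R(1) U(1) H(1)
  have [measurable]: "convolution R U \<in> borel_measurable borel" "convolution R H \<in> borel_measurable borel"
    using convolution_integrable[OF R(2) U(2)] convolution_integrable[OF R(2) H(2)] by auto
  have p1: "integrable (lborel \<Otimes>\<^sub>M lborel) (\<lambda>(x, y). (R y * U (x - y)) *\<^sub>R \<phi>' x)"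
  proof (rule Bochner_Integration.integrable_bound)
    show "integrable (lborel \<Otimes>\<^sub>M lborel) (\<lambda>p. C' * (case p of (x, y) \<Rightarrow> R y *\<^sub>R U (x - y)))"
      using convolution_pair_integrable[OF R(2) U(2)] by (rule integrable_mult_right)
    show "AE p in lborel \<Otimes>\<^sub>M lborel. norm (case p of (x, y) \<Rightarrow> (R y * U (x - y)) *\<^sub>R \<phi>' x)
       \<le> norm (C' * (case p of (x, y) \<Rightarrow> R y *\<^sub>R U (x - y)))"
    proof (rule AE_I2)
      fix p :: "'a \<times> 'a"
      obtain x y where p: "p = (x, y)" by (cases p)
      show "norm (case p of (x, y) \<Rightarrow> (R y * U (x - y)) *\<^sub>R \<phi>' x) \<le> norm (C' * (case p of (x, y) \<Rightarrow> R y *\<^sub>R U (x - y)))"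
        using mult_right_mono[OF C'(2)[of x], of "\<bar>R y * U (x - y)\<bar>"] C'(1) by (simp add: p abs_mult mult_ac)
    qed
  qed measurable
  have p2: "integrable (lborel \<Otimes>\<^sub>M lborel) (\<lambda>(x, y). \<phi> x *\<^sub>R R y *\<^sub>R H (x - y))"
  proof (rule Bochner_Integration.integrable_bound)
    show "integrable (lborel \<Otimes>\<^sub>M lborel) (\<lambda>p. C *\<^sub>R (case p of (x, y) \<Rightarrow> R y *\<^sub>R H (x - y)))"
      using convolution_pair_integrable[OF R(2) H(2)] by simp
    show "AE p in lborel \<Otimes>\<^sub>M lborel. norm (case p of (x, y) \<Rightarrow> \<phi> x *\<^sub>R R y *\<^sub>R H (x - y))
       \<le> norm (C *\<^sub>R (case p of (x, y) \<Rightarrow> R y *\<^sub>R H (x - y)))"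
    proof (rule AE_I2)
      fix p :: "'a \<times> 'a"
      obtain x y where p: "p = (x, y)" by (cases p)
      show "norm (case p of (x, y) \<Rightarrow> \<phi> x *\<^sub>R R y *\<^sub>R H (x - y)) \<le> norm (C *\<^sub>R (case p of (x, y) \<Rightarrow> R y *\<^sub>R H (x - y)))"
        using mult_right_mono[OF C(2)[of x], of "norm (R y *\<^sub>R H (x - y))"] C(1) by (simp add: p abs_mult mult.assoc)
    qed
  qed measurable
  have inner: "(LINT x|lborel. (R y * U (x - y)) *\<^sub>R \<phi>' x) = - (LINT x|lborel. \<phi> x *\<^sub>R R y *\<^sub>R H (x - y))"
    if y: "R y = indicator \<Omega> y *\<^sub>R \<rho> y" for y
  proof (cases "y \<in> \<Omega>")
    case False then show ?thesis using y by simp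
  next
    case True
    note ts = test_function_shift[OF t True]
    have "(LINT x|lborel. U (x - y) *\<^sub>R \<phi>' x) = (LINT z|lborel. U z *\<^sub>R \<phi>' (z + y))"
      using lborel_integral_plus(1)[of "\<lambda>z. U z *\<^sub>R \<phi>' (z + y)" "- y"] by simp
    also have "\<dots> = (LINT z|?S. V z *\<^sub>R \<phi>' (z + y))"
      by (rule lebesgue_on_eq_lborel(2)[OF \<Omega>l(2), symmetric], measurable)
        (use U(3) in eventually_elim, simp)
    also have "\<dots> = - (LINT z|?S. \<phi> (z + y) *\<^sub>R G z)"
      using wg ts unfolding has_weak_gradient_def by blast
    also have "(LINT z|?S. \<phi> (z + y) *\<^sub>R G z) = (LINT z|lborel. \<phi> (z + y) *\<^sub>R H z)"
      by (rule lebesgue_on_eq_lborel(2)[OF \<Omega>l(2)], measurable)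
        (use H(3) in eventually_elim, simp)
    also have "\<dots> = (LINT x|lborel. \<phi> x *\<^sub>R H (x - y))"
      using lborel_integral_plus(1)[of "\<lambda>z. \<phi> (z + y) *\<^sub>R H z" "- y"] by simp
    finally have "(LINT x|lborel. U (x - y) *\<^sub>R \<phi>' x) = - (LINT x|lborel. \<phi> x *\<^sub>R H (x - y))" .
    then have "R y *\<^sub>R (LINT x|lborel. U (x - y) *\<^sub>R \<phi>' x) = - (R y *\<^sub>R (LINT x|lborel. \<phi> x *\<^sub>R H (x - y)))"
      by simp
    then show ?thesis
      unfolding integral_scaleR_right[symmetric] by (simp add: mult.commute scaleR_left_commute)
  qed
  have "(LINT x|?L. conv \<Omega> V \<rho> x *\<^sub>R \<phi>' x) = (LINT x|lborel. convolution R U x *\<^sub>R \<phi>' x)"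
  proof (rule lebesgue_on_eq_lborel(2)[OF \<Omega>l(1)])
    show "AE x in lborel. convolution R U x *\<^sub>R \<phi>' x = indicator \<Omega> x *\<^sub>R conv \<Omega> V \<rho> x *\<^sub>R \<phi>' x"
      using conv_eq_convolution[OF \<Omega>l(1) R(1,3) U(1,3)] K(4) K(2) by (intro AE_I2) (auto simp: indicator_def)
  qed measurable
  also have "\<dots> = (LINT x|lborel. LINT y|lborel. (R y * U (x - y)) *\<^sub>R \<phi>' x)"
    using convolution_AE_integrable[OF R(2) U(2)]
    by (intro integral_cong_AE) (auto simp: convolution_def elim!: eventually_mono)
  also have "\<dots> = (LINT y|lborel. LINT x|lborel. (R y * U (x - y)) *\<^sub>R \<phi>' x)"
    by (rule lborel_pair.Fubini_integral[symmetric]) (rule p1)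
  also have "\<dots> = (LINT y|lborel. - (LINT x|lborel. \<phi> x *\<^sub>R R y *\<^sub>R H (x - y)))"
    by (intro integral_cong_AE, measurable) (use R(3) in eventually_elim, rule inner)
  also have "\<dots> = - (LINT x|lborel. LINT y|lborel. \<phi> x *\<^sub>R R y *\<^sub>R H (x - y))"
    using lborel_pair.Fubini_integral[OF p2] by simp
  also have "(LINT x|lborel. LINT y|lborel. \<phi> x *\<^sub>R R y *\<^sub>R H (x - y)) = (LINT x|lborel. \<phi> x *\<^sub>R convolution R H x)"
    by (simp only: convolution_def integral_scaleR_right)
  also have "\<dots> = (LINT x|?L. \<phi> x *\<^sub>R conv \<Omega> G \<rho> x)"
  proof (rule lebesgue_on_eq_lborel(2)[OF \<Omega>l(1), symmetric])
    show "AE x in lborel. \<phi> x *\<^sub>R convolution R H x = indicator \<Omega> x *\<^sub>R \<phi> x *\<^sub>R conv \<Omega> G \<rho> x"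
      using conv_eq_convolution[OF \<Omega>l(1) R(1,3) H(1,3)] K(3) K(2) by (intro AE_I2) (auto simp: indicator_def)
  qed measurable
  finally show "(LINT x|?L. conv \<Omega> V \<rho> x *\<^sub>R \<phi>' x) = - (LINT x|?L. \<phi> x *\<^sub>R conv \<Omega> G \<rho> x)" .
qed

text \<open>Young's inequality for \<open>L1 \<star> L2\<close>. As \<open>\<rho>\<close> is a probability density, Jensen's inequality bounds
  \<open>|K \<star> \<rho>|\<^sup>2\<close> by \<open>|K|\<^sup>2 \<star> \<rho>\<close>, which is integrable.\<close>

lemma L2_on_conv:
  fixes K :: "'a::euclidean_space \<Rightarrow> 'b::euclidean_space"
  assumes \<Omega>: "open \<Omega>" "bounded \<Omega>" and \<rho>: "integrable (lebesgue_on \<Omega>) \<rho>" "AE r in lebesgue_on \<Omega>. \<rho> r > 0" "(LINT r|lebesgue_on \<Omega>. \<rho> r) = 1"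
    and K: "L2_on (diff_set \<Omega>) K"
  shows "L2_on \<Omega> (conv \<Omega> K \<rho>)"
proof -
  let ?L = "lebesgue_on \<Omega>"
  have \<Omega>l: "\<Omega> \<in> sets lebesgue" "diff_set \<Omega> \<in> sets lebesgue" and [measurable]: "\<Omega> \<in> sets borel"
    using \<Omega> open_diff_set[OF \<Omega>(1)] by auto
  have Ki: "integrable (lebesgue_on (diff_set \<Omega>)) K"
    using L2_on_imp_integrable[OF \<Omega>l(2) bounded_diff_set[OF \<Omega>(2)] K] .
  obtain R where R: "R \<in> borel_measurable borel" "integrable lborel R" "AE x in lborel. R x = indicator \<Omega> x *\<^sub>R \<rho> x"
    by (rule integrable_representative[OF \<Omega>l(1) \<rho>(1)]) (rule that)
  obtain L where L: "L \<in> borel_measurable borel" "integrable lborel L" "AE x in lborel. L x = indicator (diff_set \<Omega>) x *\<^sub>R K x"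
    by (rule integrable_representative[OF \<Omega>l(2) Ki]) (rule that)
  note [measurable] = R(1) L(1)
  have L2: "integrable lborel (\<lambda>z. (norm (L z))\<^sup>2)"
  proof -
    have "AE z in lborel. (norm (L z))\<^sup>2 = indicator (diff_set \<Omega>) z *\<^sub>R (norm (K z))\<^sup>2"
      using L(3) by eventually_elim (auto simp: indicator_def)
    from lebesgue_on_eq_lborel(3)[OF \<Omega>l(2) _ this] show ?thesis using K by (simp add: L2_on_def)
  qed
  have R1: "(LINT y|lborel. R y) = 1" using lebesgue_on_eq_lborel(2)[OF \<Omega>l(1) R(1,3)] \<rho>(3) by simp
  have Rpos: "AE y in lborel. R y \<ge> 0"
    using R(3) \<rho>(2)[unfolded AE_lebesgue_on_iff[OF \<Omega>l(1)]] by eventually_elim (auto simp: indicator_def)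
  define A where "A = convolution R (\<lambda>z. (norm (L z))\<^sup>2)"
  have Ai: "integrable lborel A" unfolding A_def by (rule convolution_integrable[OF R(2) L2])
  have jensen: "AE x in lborel. (norm (convolution R L x))\<^sup>2 \<le> A x"
    using convolution_AE_integrable[OF R(2) integrable_norm[OF L(2)]] convolution_AE_integrable[OF R(2) L2]
  proof eventually_elim
    case (elim x)
    define B where "B = (LINT y|lborel. R y * norm (L (x - y)))"
    have "norm (convolution R L x) \<le> (LINT y|lborel. norm (R y *\<^sub>R L (x - y)))"
      unfolding convolution_def by (rule integral_norm_bound)
    also have "\<dots> = B"
      unfolding B_def by (intro integral_cong_AE, measurable) (use Rpos in eventually_elim, simp)
    finally have nB: "norm (convolution R L x) \<le> B" .
    \<comment> \<open>Jensen's inequality: the variance of \<open>norm (L (x - y))\<close> under the density \<open>R\<close> is nonnegative\<close>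
    have "0 \<le> (LINT y|lborel. R y * (norm (L (x - y)) - B)\<^sup>2)"
      by (intro integral_nonneg_AE) (use Rpos in eventually_elim, simp)
    also have "(\<lambda>y. R y * (norm (L (x - y)) - B)\<^sup>2) =
      (\<lambda>y. R y * (norm (L (x - y)))\<^sup>2 - 2 * B * (R y * norm (L (x - y))) + B\<^sup>2 * R y)"
      by (auto simp: power2_diff algebra_simps)
    also have "(LINT y|lborel. R y * (norm (L (x - y)))\<^sup>2 - 2 * B * (R y * norm (L (x - y))) + B\<^sup>2 * R y) = A x - 2 * B * B + B\<^sup>2"
      using elim R(2) R1 by (simp add: A_def convolution_def B_def)
    finally have "B\<^sup>2 \<le> A x" by (simp add: power2_eq_square)
    moreover have "(norm (convolution R L x))\<^sup>2 \<le> B\<^sup>2" using nB by (intro power_mono) auto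
    ultimately show ?case by simp
  qed
  show ?thesis
  proof (rule L2_on_bound)
    show "conv \<Omega> K \<rho> \<in> borel_measurable (?L)"
      using conv_integrable[OF \<Omega>(1) \<rho>(1) Ki] by auto
    have [measurable]: "A \<in> borel_measurable borel" using Ai by auto
    show "integrable (?L) A"
      using lebesgue_on_eq_lborel(3)[OF \<Omega>l(1), of "\<lambda>x. indicator \<Omega> x *\<^sub>R A x" A] integrable_mult_indicator[OF _ Ai, of \<Omega>] by simp
    show "AE x in ?L. (norm (conv \<Omega> K \<rho> x))\<^sup>2 \<le> A x"
      unfolding AE_lebesgue_on_iff[OF \<Omega>l(1)] using jensen
      by eventually_elim (use conv_eq_convolution[OF \<Omega>l(1) R(1,3) L(1,3)] in auto)
  qed
qed

section \<open>Coercivity of the resistance tensor and bounds for matrix kernels\<close>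

lemma bilinear_matrix_vector_mult: "bounded_bilinear ((*v) :: real^'n^'m \<Rightarrow> real^'n \<Rightarrow> real^'m)"
proof -
  have "bilinear ((*v) :: real^'n^'m \<Rightarrow> real^'n \<Rightarrow> real^'m)"
    unfolding bilinear_def
    by (auto intro!: linearI simp: matrix_vector_mult_add_rdistrib matrix_vector_right_distrib
        matrix_vector_mult_scaleR scaleR_matrix_vector_assoc)
  then show ?thesis by (simp add: bilinear_conv_bounded_bilinear)
qed

text \<open>A minimizer \<open>v\<close> of the Rayleigh quotient is an eigenvector, because the nonnegative quadratic form
  \<open>w \<bullet> M w - l (w \<bullet> w)\<close> vanishes at \<open>v\<close>, so it cannot decrease along the residual \<open>M v - l v\<close>.\<close>

lemma symmetric_min_eigenvector:
  fixes M :: "real^'n^'n"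
  assumes sym: "\<And>x y. x \<bullet> (M *v y) = (M *v x) \<bullet> y"
  obtains l v where "norm v = 1" "M *v v = l *\<^sub>R v" "\<And>w. l * (w \<bullet> w) \<le> w \<bullet> (M *v w)"
proof -
  have cont: "continuous_on (sphere 0 1) (\<lambda>v. v \<bullet> (M *v v))"
    by (intro continuous_intros linear_continuous_on) (simp add: linear_linear)
  have "sphere (0::real^'n) 1 \<noteq> {}" by simp
  then obtain v where v: "norm v = 1" and min: "\<And>w. norm w = 1 \<Longrightarrow> v \<bullet> (M *v v) \<le> w \<bullet> (M *v w)"
    using continuous_attains_inf[OF compact_sphere _ cont] by auto
  define l where "l = v \<bullet> (M *v v)"
  have ray: "l * (w \<bullet> w) \<le> w \<bullet> (M *v w)" for w
  proof (cases "w = 0")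
    case False
    define u where "u = w /\<^sub>R norm w"
    have w: "w = norm w *\<^sub>R u" using False by (simp add: u_def)
    have "norm u = 1" using False by (simp add: u_def)
    then have "l \<le> u \<bullet> (M *v u)" unfolding l_def by (rule min)
    then have "(norm w)\<^sup>2 * l \<le> (norm w)\<^sup>2 * (u \<bullet> (M *v u))" by (rule mult_left_mono) simp
    also have "\<dots> = w \<bullet> (M *v w)"
      by (subst (2 3) w) (simp add: matrix_vector_mult_scaleR power2_eq_square)
    finally show ?thesis by (simp add: dot_square_norm mult.commute)
  qed simp
  define u where "u = M *v v - l *\<^sub>R v"
  define Q where "Q w = w \<bullet> (M *v w) - l * (w \<bullet> w)" for w
  have Q: "Q w \<ge> 0" for w using ray[of w] by (simp add: Q_def)
  have Qv: "Q v = 0" using v by (simp add: Q_def l_def dot_square_norm)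
  have expand: "Q (v - s *\<^sub>R u) = s\<^sup>2 * Q u - 2 * s * (u \<bullet> u)" for s
  proof -
    have "v \<bullet> (M *v u) = u \<bullet> (M *v v)" using sym[of v u] by (simp add: inner_commute)
    then have "Q (v - s *\<^sub>R u) = Q v + s\<^sup>2 * Q u - 2 * s * (u \<bullet> (M *v v) - l * (u \<bullet> v))"
      by (simp add: Q_def matrix_vector_mult_diff_distrib matrix_vector_mult_scaleR inner_diff_left inner_diff_right
          inner_commute[of v u] power2_eq_square algebra_simps)
    also have "u \<bullet> (M *v v) - l * (u \<bullet> v) = u \<bullet> u" by (simp add: u_def inner_diff_right)
    finally show ?thesis using Qv by simp
  qed
  have "u \<bullet> u = 0"
  proof (rule ccontr)
    assume "u \<bullet> u \<noteq> 0"
    then have uu: "u \<bullet> u > 0" using inner_ge_zero[of u] by linarith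
    \<comment> \<open>small enough for the linear term to dominate the quadratic one\<close>
    define s where "s = (u \<bullet> u) / (Q u + 1)"
    have s: "s > 0" using uu Q[of u] by (simp add: s_def)
    have "s * Q u \<le> u \<bullet> u"
      using uu Q[of u] mult_left_mono[of "Q u" "Q u + 1" "u \<bullet> u"] by (simp add: s_def pos_divide_le_eq)
    then have "s * (s * Q u) \<le> s * (u \<bullet> u)" using s by (intro mult_left_mono) auto
    moreover have "0 \<le> s\<^sup>2 * Q u - 2 * s * (u \<bullet> u)" using Q[of "v - s *\<^sub>R u"] by (simp add: expand)
    moreover have "s * (u \<bullet> u) > 0" using s uu by simp
    ultimately show False by (simp add: power2_eq_square)
  qed
  then have "M *v v = l *\<^sub>R v" by (simp add: u_def)
  then show thesis using v ray that by blast
qed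

text \<open>Substituting \<open>x = D y\<close> carries symmetry and positivity from \<open>D\<close> to its inverse.\<close>

lemma inverse_sym_pos_def:
  fixes M :: "real^'n^'n"
  assumes inv: "invertible M" and D: "sym_pos_def (matrix_inv M)"
  shows "x \<bullet> (M *v y) = (M *v x) \<bullet> y" and "v \<noteq> 0 \<Longrightarrow> v \<bullet> (M *v v) > 0" 
    and "M *v v = l *\<^sub>R v \<Longrightarrow> v \<noteq> 0 \<Longrightarrow> l > 0 \<and> is_eigenvalue (matrix_inv M) (1 / l)"
proof -
  define D where "D = matrix_inv M"
  have DM: "D *v (M *v x) = x" for x
  proof -
    have "M ** D = mat 1 \<and> D ** M = mat 1"
      unfolding D_def matrix_inv_def using inv unfolding invertible_def by (rule someI_ex)
    then show ?thesis by (simp add: matrix_vector_mul_assoc)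
  qed
  have Dsym: "x \<bullet> (D *v y) = (D *v x) \<bullet> y" for x y
  proof -
    have "transpose D = D" using D by (simp add: D_def sym_pos_def_def)
    then have "x v* D = D *v x" using transpose_matrix_vector[of D x] by simp
    then show ?thesis using dot_lmul_matrix[of x D y] by simp
  qed
  have Dpos: "v \<bullet> (D *v v) > 0" if "v \<noteq> 0" for v
    using D that by (simp add: D_def sym_pos_def_def)
  show "x \<bullet> (M *v y) = (M *v x) \<bullet> y" for x y
    using Dsym[of "M *v x" "M *v y"] by (simp add: DM)
  show pos: "v \<bullet> (M *v v) > 0" if "v \<noteq> 0" for v
  proof -
    have "M *v v \<noteq> 0" using DM[of v] that by auto
    from Dpos[OF this] show ?thesis by (simp add: DM inner_commute)
  qed
  assume e: "M *v v = l *\<^sub>R v" and v: "v \<noteq> 0"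
  have l: "l > 0" using pos[OF v] inner_ge_zero[of v] by (auto simp: e zero_less_mult_iff)
  have "l *\<^sub>R (D *v v) = v" using DM[of v] by (simp add: e matrix_vector_mult_scaleR)
  then have "D *v v = (1 / l) *\<^sub>R v" using l by (metis divide_inverse_commute inverse_eq_divide less_irrefl mult.right_neutral scaleR_one scaleR_scaleR left_inverse)
  then show "l > 0 \<and> is_eigenvalue (matrix_inv M) (1 / l)" using l v by (auto simp: is_eigenvalue_def D_def)
qed

text \<open>The least eigenvalue of \<open>M = 1 + Z \<star> \<rho>\<close> is the reciprocal of an eigenvalue of \<open>D = M\<^sup>-\<^sup>1\<close>, hence at least
  \<open>1 / mu_max\<close>. Stating the bound with the product \<open>\<theta> = mu_max k\<close> covers the case \<open>mu_max = \<infinity>\<close>, in which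
  the assumption forces \<open>k = 0\<close>.\<close>

lemma small_kernel_coercive:
  fixes \<Omega> :: "(real^'n) set"
  assumes ne: "\<Omega> \<noteq> {}" and D: "D_sym_pos_def \<Omega> Z \<rho>" and k: "k \<ge> 0" and small: "mu_max \<Omega> Z \<rho> * ereal k < 1"
  obtains \<theta> where "0 \<le> \<theta>" "\<theta> < 1" "\<And>r v. r \<in> \<Omega> \<Longrightarrow> k * (v \<bullet> v) \<le> \<theta> * (v \<bullet> (resistance \<Omega> Z \<rho> r *v v))"
proof -
  let ?M = "resistance \<Omega> Z \<rho>" and ?\<mu> = "mu_max \<Omega> Z \<rho>"
  have inv: "invertible (?M r)" "sym_pos_def (matrix_inv (?M r))" if "r \<in> \<Omega>" for r
    using D that by (auto simp: D_sym_pos_def_def D_tensor_def)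
  have eig: "\<exists>l>0. ereal (1 / l) \<le> ?\<mu> \<and> (\<forall>w. l * (w \<bullet> w) \<le> w \<bullet> (?M r *v w))" if r: "r \<in> \<Omega>" for r
  proof -
    obtain l v where lv: "norm v = 1" "?M r *v v = l *\<^sub>R v"
      "\<And>w. l * (w \<bullet> w) \<le> w \<bullet> (?M r *v w)"
      by (rule symmetric_min_eigenvector[OF inverse_sym_pos_def(1)[OF inv[OF r]]]) (rule that)
    have v0: "v \<noteq> 0" using lv(1) by auto
    have l: "l > 0" "is_eigenvalue (D_tensor \<Omega> Z \<rho> r) (1 / l)"
      using inverse_sym_pos_def(3)[OF inv[OF r] lv(2) v0] by (auto simp: D_tensor_def)
    have "ereal (1 / l) \<le> (SUP l\<in>{l. is_eigenvalue (D_tensor \<Omega> Z \<rho> r) l}. ereal l)"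
      using l(2) by (intro SUP_upper) auto
    also have "\<dots> \<le> ?\<mu>" unfolding mu_max_def using r by (intro SUP_upper)
    finally show ?thesis using l(1) lv(3) by blast
  qed
  show thesis
  proof (cases "k = 0")
    case True
    show thesis by (rule that[of 0]) (use True in auto)
  next
    case False
    then have k0: "k > 0" using k by simp
    obtain r0 where "r0 \<in> \<Omega>" using ne by blast
    from eig[OF this] obtain l0 where l0: "l0 > 0" "ereal (1 / l0) \<le> ?\<mu>" by blast
    obtain \<mu> where \<mu>: "?\<mu> = ereal \<mu>"
      using small k0 l0 by (cases "?\<mu>") auto
    have \<mu>0: "\<mu> > 0" using l0 \<mu> by (metis ereal_less_eq(3) less_le_trans zero_less_divide_1_iff)
    show thesis
    proof (rule that[of "\<mu> * k"])
      show "0 \<le> \<mu> * k" using \<mu>0 k by simp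
      show "\<mu> * k < 1" using small by (simp add: \<mu> one_ereal_def)
      fix r v assume "r \<in> \<Omega>"
      from eig[OF this] obtain l where l: "l > 0" "1 / l \<le> \<mu>" "l * (v \<bullet> v) \<le> v \<bullet> (?M r *v v)"
        using \<mu> by auto
      have "v \<bullet> v \<le> (1 / l) * (v \<bullet> (?M r *v v))"
        using l(1,3) by (simp add: field_simps)
      also have "\<dots> \<le> \<mu> * (v \<bullet> (?M r *v v))"
        using l by (intro mult_right_mono) (auto intro: order_trans[OF _ l(3)])
      finally have "k * (v \<bullet> v) \<le> k * (\<mu> * (v \<bullet> (?M r *v v)))"
        using k by (rule mult_left_mono)
      then show "k * (v \<bullet> v) \<le> \<mu> * k * (v \<bullet> (?M r *v v))" by (simp add: mult_ac)
    qed
  qed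
qed

text \<open>A real supremum is meaningful only over a set bounded above; here boundedness of the kernel provides
  this, as the operator norm is at most a constant times the norm of the matrix.\<close>

lemma kernel_norm_bound:
  fixes Z :: "real^'n \<Rightarrow> real^'n^'n"
  assumes Z: "bounded (Z ` diff_set \<Omega>)" and z: "z \<in> diff_set \<Omega>"
  shows "norm (Z z *v v) \<le> kernel_norm \<Omega> Z * norm v" and "kernel_norm \<Omega> Z \<ge> 0"
proof -
  obtain B where B: "\<And>z. z \<in> diff_set \<Omega> \<Longrightarrow> norm (Z z) \<le> B" using Z by (auto simp: bounded_iff)
  obtain c where c: "c > 0" "\<And>(A::real^'n^'n) x. norm (A *v x) \<le> norm A * norm x * c"
    using bounded_bilinear.pos_bounded[OF bilinear_matrix_vector_mult[where 'n='n and 'm='n]] by blast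
  have bdd: "bdd_above ((\<lambda>z. onorm (\<lambda>v. Z z *v v)) ` diff_set \<Omega>)"
  proof (rule bdd_aboveI2)
    fix z assume z: "z \<in> diff_set \<Omega>"
    show "onorm (\<lambda>v. Z z *v v) \<le> B * c"
    proof (rule onorm_le)
      fix x
      have "norm (Z z *v x) \<le> norm (Z z) * norm x * c" by (rule c)
      also have "\<dots> \<le> B * norm x * c" using B[OF z] c(1) by (intro mult_right_mono) auto
      finally show "norm (Z z *v x) \<le> B * c * norm x" by (simp add: mult_ac)
    qed
  qed
  have le: "onorm (\<lambda>v. Z z *v v) \<le> kernel_norm \<Omega> Z"
    unfolding kernel_norm_def by (rule cSUP_upper[OF z bdd])
  have bl: "bounded_linear (\<lambda>v. Z z *v v)" by (simp add: linear_linear)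
  show "kernel_norm \<Omega> Z \<ge> 0" using onorm_pos_le[OF bl] le by linarith
  have "norm (Z z *v v) \<le> onorm (\<lambda>v. Z z *v v) * norm v" by (rule onorm[OF bl])
  also have "\<dots> \<le> kernel_norm \<Omega> Z * norm v" using le by (rule mult_right_mono) simp
  finally show "norm (Z z *v v) \<le> kernel_norm \<Omega> Z * norm v" .
qed

lemma integrable_bounded_measurable:
  fixes f :: "'a::euclidean_space \<Rightarrow> 'b::euclidean_space"
  assumes S: "S \<in> sets lebesgue" "bounded S" and f: "f \<in> borel_measurable (lebesgue_on S)" "bounded (f ` S)"
  shows "integrable (lebesgue_on S) f"
proof -
  interpret finite_measure "lebesgue_on S" using S by (rule emeasure_lebesgue_on_finite)
  obtain B where B: "\<And>x. x \<in> S \<Longrightarrow> norm (f x) \<le> B" using f(2) by (auto simp: bounded_iff)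
  show ?thesis
    by (rule integrable_const_bound[of _ B]) (use B f(1) in \<open>auto intro!: AE_I2\<close>)
qed

lemma conv_bound:
  fixes K :: "'a::euclidean_space \<Rightarrow> 'b::euclidean_space"
  assumes f: "integrable (lebesgue_on \<Omega>) f" and B: "\<And>z. z \<in> diff_set \<Omega> \<Longrightarrow> norm (K z) \<le> B" and r: "r \<in> \<Omega>"
  shows "norm (conv \<Omega> K f r) \<le> B * (LINT y|lebesgue_on \<Omega>. \<bar>f y\<bar>)"
proof -
  have B0: "B \<ge> 0" using B[OF diff_setI[OF r r]] norm_ge_zero order_trans by blast
  have "norm (conv \<Omega> K f r) \<le> (LINT y|lebesgue_on \<Omega>. norm (f y *\<^sub>R K (r - y)))"
    unfolding conv_def by (rule integral_norm_bound)
  also have "\<dots> \<le> (LINT y|lebesgue_on \<Omega>. B * \<bar>f y\<bar>)"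
  proof (rule integral_mono')
    fix y assume "y \<in> space (lebesgue_on \<Omega>)"
    then have "y \<in> \<Omega>" by simp
    then show "norm (f y *\<^sub>R K (r - y)) \<le> B * \<bar>f y\<bar>"
      using mult_left_mono[OF B[OF diff_setI[OF r]], of y "\<bar>f y\<bar>"] by (simp add: mult.commute)
    show "0 \<le> B * \<bar>f y\<bar>" using B0 by simp
  qed (use f in auto)
  finally show ?thesis by simp
qed

lemma conv_integrand_integrable:
  fixes K :: "'a::euclidean_space \<Rightarrow> 'b::euclidean_space"
  assumes \<Omega>: "open \<Omega>" "bounded \<Omega>" and f: "integrable (lebesgue_on \<Omega>) f"
    and K: "K \<in> borel_measurable (lebesgue_on (diff_set \<Omega>))" "bounded (K ` diff_set \<Omega>)" and r: "r \<in> \<Omega>"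
  shows "integrable (lebesgue_on \<Omega>) (\<lambda>y. f y *\<^sub>R K (r - y))"
proof -
  have \<Omega>l: "\<Omega> \<in> sets lebesgue" "diff_set \<Omega> \<in> sets lebesgue"
    using \<Omega> open_diff_set[OF \<Omega>(1)] by auto
  obtain B where B: "B > 0" "\<And>z. z \<in> diff_set \<Omega> \<Longrightarrow> norm (K z) \<le> B" using K(2) by (auto simp: bounded_pos)
  obtain R where R: "R \<in> borel_measurable borel" "integrable lborel R" "AE x in lborel. R x = indicator \<Omega> x *\<^sub>R f x"
    by (rule integrable_representative[OF \<Omega>l(1) f]) (rule that)
  obtain L where L: "L \<in> borel_measurable borel" "AE x in lborel. L x = indicator (diff_set \<Omega>) x *\<^sub>R K x"
    by (rule borel_representative[OF \<Omega>l(2) K(1)]) (rule that)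
  note [measurable] = R(1) L(1)
  have "AE y in lborel. norm (L (r - y)) \<le> B"
    using AE_lborel_diff[OF L(2), of r] by eventually_elim (use B in \<open>auto simp: indicator_def\<close>)
  then have "integrable lborel (\<lambda>y. R y *\<^sub>R L (r - y))"
    by (intro integrable_bilinear_bounded[OF bounded_bilinear.flip[OF bounded_bilinear_scaleR] _ _ R(2), where B=B]) auto
  moreover have "AE y in lborel. R y *\<^sub>R L (r - y) = indicator \<Omega> y *\<^sub>R f y *\<^sub>R K (r - y)"
    using R(3) AE_lborel_diff[OF L(2), of r]
    by eventually_elim (use r in \<open>auto simp: indicator_def diff_setI\<close>)
  ultimately show ?thesis
    by (subst lebesgue_on_eq_lborel(3)[OF \<Omega>l(1), of "\<lambda>y. R y *\<^sub>R L (r - y)"]) auto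
qed

text \<open>Expanding the matrix-vector product by columns reduces the claim to convolutions with scalar densities.\<close>

lemma conv_vec_measurable:
  fixes \<Omega> :: "(real^'n) set"
  assumes \<Omega>: "open \<Omega>" "bounded \<Omega>" and a: "integrable (lebesgue_on \<Omega>) a" and Z: "admissible_kernel \<Omega> Z"
  shows "conv_vec \<Omega> Z a \<in> borel_measurable (lebesgue_on \<Omega>)"
proof -
  let ?L = "lebesgue_on \<Omega>" and ?s = "\<lambda>r. \<Sum>j\<in>UNIV. conv \<Omega> (\<lambda>z. column j (Z z)) (\<lambda>y. a y $ j) r"
  have Sl: "diff_set \<Omega> \<in> sets lebesgue" using open_diff_set[OF \<Omega>(1)] by auto
  have col: "bounded_linear (\<lambda>A::real^'n^'n. column j A)" for j
  proof -
    have "linear (\<lambda>A::real^'n^'n. column j A)" by (intro linearI) (simp_all add: column_def vec_eq_iff)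
    then show ?thesis by (simp add: linear_linear)
  qed
  have cm: "(\<lambda>z. column j (Z z)) \<in> borel_measurable (lebesgue_on (diff_set \<Omega>))" for j
    using Z linear_continuous_on[OF col[of j]]
    by (intro borel_measurable_continuous_on[of "column j"]) (auto simp: admissible_kernel_def)
  have cb: "bounded ((\<lambda>z. column j (Z z)) ` diff_set \<Omega>)" for j
    using bounded_linear_image[OF _ col[of j], of "Z ` diff_set \<Omega>"] Z by (simp add: admissible_kernel_def image_image)
  have ai: "integrable (?L) (\<lambda>y. a y $ j)" for j
    using integrable_bounded_linear[OF bounded_linear_vec_nth a] .
  have "conv_vec \<Omega> Z a r = ?s r" if r: "r \<in> \<Omega>" for r
    unfolding conv_vec_def conv_def matrix_mult_sum scalar_mult_eq_scaleR
    by (rule Bochner_Integration.integral_sum) (rule conv_integrand_integrable[OF \<Omega> ai cm cb r])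
  moreover have "?s \<in> borel_measurable (?L)"
    by (intro borel_measurable_sum borel_measurable_integrable conv_integrable \<Omega> ai
        integrable_bounded_measurable[OF Sl bounded_diff_set[OF \<Omega>(2)] cm cb])
  ultimately show ?thesis by (subst measurable_cong[where g="?s"]) auto
qed

lemma conv_vec_bound:
  fixes \<Omega> :: "(real^'n) set"
  assumes a: "integrable (lebesgue_on \<Omega>) a" and Z: "admissible_kernel \<Omega> Z" and r: "r \<in> \<Omega>"
  shows "norm (conv_vec \<Omega> Z a r) \<le> kernel_norm \<Omega> Z * (LINT y|lebesgue_on \<Omega>. norm (a y))"
proof -
  have Zb: "bounded (Z ` diff_set \<Omega>)" using Z by (simp add: admissible_kernel_def)
  have "norm (conv_vec \<Omega> Z a r) \<le> (LINT y|lebesgue_on \<Omega>. norm (Z (r - y) *v a y))"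
    unfolding conv_vec_def by (rule integral_norm_bound)
  also have "\<dots> \<le> (LINT y|lebesgue_on \<Omega>. kernel_norm \<Omega> Z * norm (a y))"
  proof (rule integral_mono')
    fix y assume "y \<in> space (lebesgue_on \<Omega>)"
    then have "r - y \<in> diff_set \<Omega>" using r by (simp add: diff_setI)
    from kernel_norm_bound[OF Zb this]
    show "norm (Z (r - y) *v a y) \<le> kernel_norm \<Omega> Z * norm (a y)" "0 \<le> kernel_norm \<Omega> Z * norm (a y)"
      by auto
  qed (use a in auto)
  finally show ?thesis by simp
qed

section \<open>Critical points are in force balance\<close>

text \<open>A smooth approximation of \<open>ln\<close> on positive arguments. Its derivative \<open>t / (t\<^sup>2 + \<epsilon>)\<close> is bounded on the whole
  line, and \<open>t\<close> times this derivative lies between 0 and 1; for \<open>t > 0\<close> it increases to 1 as \<open>\<epsilon>\<close> decreases to 0.\<close>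

definition reg_log :: "real \<Rightarrow> real \<Rightarrow> real"
  where "reg_log \<epsilon> t = ln (t\<^sup>2 + \<epsilon>) / 2"

lemma square_add_pos: "0 < \<epsilon> \<Longrightarrow> 0 < t\<^sup>2 + \<epsilon>" for t \<epsilon> :: real
  using zero_le_power2 by (rule add_nonneg_pos)

lemma DERIV_reg_log:
  assumes "0 < \<epsilon>"
  shows "(reg_log \<epsilon> has_real_derivative t / (t\<^sup>2 + \<epsilon>)) (at t)"
proof -
  have "t\<^sup>2 + \<epsilon> > 0" by (rule square_add_pos[OF assms])
  then show ?thesis unfolding reg_log_def[abs_def]
    by (auto intro!: derivative_eq_intros simp: field_simps)
qed

lemma continuous_reg_log_deriv: "\<epsilon> > 0 \<Longrightarrow> continuous_on UNIV (\<lambda>t::real. t / (t\<^sup>2 + \<epsilon>))"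
  by (intro continuous_intros ballI) (rule less_imp_neq[OF square_add_pos, symmetric])

lemma reg_log_deriv_bound:
  fixes t \<epsilon> :: real
  assumes "0 < \<epsilon>" "\<epsilon> \<le> 1"
  shows "\<bar>t / (t\<^sup>2 + \<epsilon>)\<bar> \<le> 1 / \<epsilon>"
proof -
  have pos: "t\<^sup>2 + \<epsilon> > 0" by (rule square_add_pos[OF assms(1)])
  have "2 * \<bar>t\<bar> \<le> 1 + t\<^sup>2" using sum_squares_bound[of 1 "\<bar>t\<bar>"] by simp
  then have "\<epsilon> * (2 * \<bar>t\<bar>) \<le> \<epsilon> * (1 + t\<^sup>2)" using assms by (intro mult_left_mono) auto
  also have "\<dots> \<le> \<epsilon> + t\<^sup>2" using mult_right_mono[OF assms(2), of "t\<^sup>2"] by (simp add: algebra_simps)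
  finally have "\<epsilon> * \<bar>t\<bar> \<le> t\<^sup>2 + \<epsilon>" using assms(1) mult_nonneg_nonneg[of \<epsilon> "\<bar>t\<bar>"] by linarith
  then show ?thesis using pos assms(1) by (simp add: divide_simps mult.commute)
qed

text \<open>Only the linear growth matters: it makes \<open>reg_log \<epsilon> \<circ> \<rho>\<close> square-integrable for integrable \<open>\<rho>\<close>.\<close>

lemma reg_log_growth:
  assumes "0 < \<epsilon>" "\<epsilon> \<le> 1"
  shows "(reg_log \<epsilon> t)\<^sup>2 \<le> (ln \<epsilon>)\<^sup>2 + 4 * (1 + \<bar>t\<bar>)"
proof -
  have pos: "t\<^sup>2 + \<epsilon> > 0" by (rule square_add_pos[OF assms(1)])
  define y where "y = 1 + \<bar>t\<bar>"
  have y: "y \<ge> 1" by (simp add: y_def)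
  have lower: "ln \<epsilon> / 2 \<le> reg_log \<epsilon> t" using assms pos by (simp add: reg_log_def)
  have "t\<^sup>2 + \<epsilon> \<le> y\<^sup>2" using assms by (simp add: y_def power2_eq_square algebra_simps)
  then have "ln (t\<^sup>2 + \<epsilon>) \<le> ln (y\<^sup>2)" using pos y by simp
  then have "reg_log \<epsilon> t \<le> ln y" using y by (simp add: reg_log_def ln_realpow)
  also have "ln y \<le> 2 * sqrt y"
  proof -
    have "ln (sqrt y) \<le> sqrt y - 1" using y by (intro ln_le_minus_one) simp
    then show ?thesis using y by (simp add: ln_sqrt)
  qed
  finally have upper: "reg_log \<epsilon> t \<le> 2 * sqrt y" .
  show ?thesis
  proof (cases "reg_log \<epsilon> t \<ge> 0")
    case True
    then have "(reg_log \<epsilon> t)\<^sup>2 \<le> (2 * sqrt y)\<^sup>2" using upper by (intro power_mono)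
    also have "\<dots> = 4 * y" using y by (simp add: power_mult_distrib)
    also have "\<dots> \<le> (ln \<epsilon>)\<^sup>2 + 4 * (1 + \<bar>t\<bar>)" by (simp add: y_def)
    finally show ?thesis .
  next
    case False
    then have "\<bar>reg_log \<epsilon> t\<bar> \<le> \<bar>ln \<epsilon>\<bar>" using lower by linarith
    then have "(reg_log \<epsilon> t)\<^sup>2 \<le> (ln \<epsilon>)\<^sup>2" by (rule abs_le_square_iff[THEN iffD1])
    also have "\<dots> \<le> (ln \<epsilon>)\<^sup>2 + 4 * (1 + \<bar>t\<bar>)" by simp
    finally show ?thesis .
  qed
qed

text \<open>The representative chosen by \<open>wgrad\<close> agrees almost everywhere with a square-integrable one.\<close>

lemma H1D:
  assumes \<Omega>: "open \<Omega>" and f: "f \<in> H1 \<Omega>"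
  shows "L2_on \<Omega> f" "has_weak_gradient \<Omega> f (wgrad \<Omega> f)" "L2_on \<Omega> (wgrad \<Omega> f)"
proof -
  obtain g where g: "has_weak_gradient \<Omega> f g" "L2_on \<Omega> g" and L: "L2_on \<Omega> f"
    using f by (auto simp: H1_def)
  show "L2_on \<Omega> f" by (rule L)
  show "has_weak_gradient \<Omega> f (wgrad \<Omega> f)" by (rule wgrad[OF g(1)])
  have "AE x in lebesgue_on \<Omega>. g x = wgrad \<Omega> f x" using wgrad_AE_eq[OF \<Omega> g(1)] by eventually_elim simp
  from L2_on_cong_AE[OF _ this g(2)] \<Omega> show "L2_on \<Omega> (wgrad \<Omega> f)" by simp
qed

text \<open>The function \<open>f\<close> in the definition of the normal trace is the weak divergence, which is unique and
  therefore zero almost everywhere.\<close>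

lemma zero_normal_trace_orthogonal:
  assumes \<Omega>: "open \<Omega>" and div: "has_weak_divergence \<Omega> a (\<lambda>_. 0)" and tr: "zero_normal_trace \<Omega> a"
    and \<phi>: "L2_on \<Omega> \<phi>" "has_weak_gradient \<Omega> \<phi> g" "L2_on \<Omega> g"
  shows "(LINT x|lebesgue_on \<Omega>. a x \<bullet> g x) = 0"
proof -
  let ?L = "lebesgue_on \<Omega>"
  have \<Omega>l: "\<Omega> \<in> sets lebesgue" using \<Omega> by simp
  have \<phi>H: "\<phi> \<in> H1 \<Omega>" unfolding H1_def mem_Collect_eq by (intro conjI exI[of _ g] \<phi>)
  have "\<exists>f. L2_on \<Omega> f \<and> has_weak_divergence \<Omega> a f \<and>
      (\<forall>\<phi>\<in>H1 \<Omega>. (LINT x|?L. a x \<bullet> wgrad \<Omega> \<phi> x) + (LINT x|?L. f x * \<phi> x) = 0)"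
    using tr unfolding zero_normal_trace_def by (rule conjunct2)
  then obtain f where f1: "has_weak_divergence \<Omega> a f" and green:
    "\<forall>\<phi>\<in>H1 \<Omega>. (LINT x|?L. a x \<bullet> wgrad \<Omega> \<phi> x) + (LINT x|?L. f x * \<phi> x) = 0"
    by (elim exE conjE)
  note f2 = bspec[OF green \<phi>H]
  have "(LINT x|?L. f x * \<phi> x) = (LINT x|?L. 0)"
    by (rule lebesgue_on_cong_AE(3)[OF \<Omega>l])
      (use has_weak_divergence_unique[OF \<Omega> f1 div] in eventually_elim, simp)
  moreover have "(LINT x|?L. a x \<bullet> wgrad \<Omega> \<phi> x) = (LINT x|?L. a x \<bullet> g x)"
    by (rule lebesgue_on_cong_AE(3)[OF \<Omega>l])
      (use wgrad_AE_eq[OF \<Omega> \<phi>(2)] in eventually_elim, simp)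
  ultimately show ?thesis using f2 by simp
qed

locale potentials =
  fixes \<Omega> :: "'a::euclidean_space set" and V1 V2 :: "'a \<Rightarrow> real" and \<rho> :: "'a \<Rightarrow> real"
  assumes \<Omega>: "open \<Omega>" "bounded \<Omega>"
    and V1: "V1 \<in> H1 \<Omega>" and V2: "V2 \<in> H1 (diff_set \<Omega>)" and \<rho>: "density_on \<Omega> \<rho>"
begin

definition U where "U r = V1 r + conv \<Omega> V2 \<rho> r"
definition dU where "dU r = wgrad \<Omega> V1 r + conv \<Omega> (wgrad (diff_set \<Omega>) V2) \<rho> r"

lemma \<Omega>l: "\<Omega> \<in> sets lebesgue" using \<Omega> by simp

lemma density: "integrable (lebesgue_on \<Omega>) \<rho>" "AE r in lebesgue_on \<Omega>. \<rho> r > 0"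
  "(LINT r|lebesgue_on \<Omega>. \<rho> r) = 1" "has_weak_gradient \<Omega> \<rho> (wgrad \<Omega> \<rho>)"
  using \<rho> wgrad by (auto simp: density_on_def)

lemma potential: "has_weak_gradient \<Omega> U dU" "L2_on \<Omega> U" "L2_on \<Omega> dU"
proof -
  note S = open_diff_set[OF \<Omega>(1)] bounded_diff_set[OF \<Omega>(2)]
  have Sl: "diff_set \<Omega> \<in> sets lebesgue" using S by simp
  note W = H1D[OF S(1) V2]
  show "has_weak_gradient \<Omega> U dU"
    unfolding U_def[abs_def] dU_def[abs_def]
    by (intro has_weak_gradient_add[OF \<Omega>l] H1D[OF \<Omega>(1) V1] has_weak_gradient_conv \<Omega> density(1) W(2)
        L2_on_imp_integrable[OF Sl S(2)] W(1,3))
  show "L2_on \<Omega> U" "L2_on \<Omega> dU"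
    unfolding U_def[abs_def] dU_def[abs_def]
    by (intro L2_on_add H1D[OF \<Omega>(1) V1] L2_on_conv \<Omega> density(1,2,3) W(1,3))+
qed

lemma weak_gradient_reg_log:
  assumes "0 < \<epsilon>" "\<epsilon> \<le> 1"
  shows "has_weak_gradient \<Omega> (\<lambda>r. reg_log \<epsilon> (\<rho> r)) (\<lambda>r. (\<rho> r / ((\<rho> r)\<^sup>2 + \<epsilon>)) *\<^sub>R wgrad \<Omega> \<rho> r)"
  by (rule weak_chain_rule[OF \<Omega>(1) density(4) DERIV_reg_log continuous_reg_log_deriv reg_log_deriv_bound]) (use assms in auto)

text \<open>The function \<open>ln (\<rho>\<^sup>2 + 1) / 2\<close> is obtained from \<open>\<rho>\<close> and from \<open>W = c - U\<close>, which equals \<open>ln \<rho>\<close>, by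
  composition with functions of bounded derivative. Equating the two weak gradients and dividing by the
  positive factor \<open>\<rho> / (\<rho>\<^sup>2 + 1)\<close> gives the claim.\<close>

lemma critical_gradient:
  assumes crit: "AE r in lebesgue_on \<Omega>. free_energy_deriv \<Omega> V1 V2 \<rho> r = c"
  shows "AE r in lebesgue_on \<Omega>. wgrad \<Omega> \<rho> r + \<rho> r *\<^sub>R dU r = 0"
proof -
  let ?L = "lebesgue_on \<Omega>"
  define W where "W r = c + - U r" for r
  have W: "has_weak_gradient \<Omega> W (\<lambda>r. 0 + - dU r)"
    unfolding W_def[abs_def]
    by (intro has_weak_gradient_add[OF \<Omega>l] has_weak_gradient_uminus has_weak_gradient_const[OF \<Omega>l] potential)
  \<comment> \<open>\<open>reg_log 1\<close> as a function of the logarithm; its derivative lies between 0 and 1\<close>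
  define F where "F w = reg_log 1 (exp w)" for w
  define F' where "F' w = (exp w)\<^sup>2 / ((exp w)\<^sup>2 + 1)" for w :: real
  have dF: "(F has_real_derivative F' w) (at w)" for w
    using DERIV_chain2[OF DERIV_reg_log[of 1 "exp w"] DERIV_exp]
    by (simp add: F_def[abs_def] F'_def power2_eq_square)
  have pos: "(exp w)\<^sup>2 + 1 > (0::real)" for w :: real by (rule square_add_pos) simp
  have cF: "continuous_on UNIV F'"
    unfolding F'_def[abs_def] by (intro continuous_intros ballI) (rule less_imp_neq[OF pos, symmetric])
  have bF: "\<bar>F' w\<bar> \<le> 1" for w using pos[of w] by (simp add: F'_def)
  have wF: "has_weak_gradient \<Omega> (\<lambda>r. F (W r)) (\<lambda>r. F' (W r) *\<^sub>R (0 + - dU r))"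
    by (rule weak_chain_rule[OF \<Omega>(1) W dF cF bF])
  have eW: "AE r in ?L. exp (W r) = \<rho> r"
    using crit density(2)
  proof eventually_elim
    case (elim r)
    then have "W r = ln (\<rho> r)" by (simp add: W_def U_def free_energy_deriv_def)
    then show ?case using elim by simp
  qed
  have "AE r in ?L. F (W r) = reg_log 1 (\<rho> r)"
    using eW by eventually_elim (simp add: F_def)
  then have "has_weak_gradient \<Omega> (\<lambda>r. reg_log 1 (\<rho> r)) (\<lambda>r. F' (W r) *\<^sub>R (0 + - dU r))"
    by (rule has_weak_gradient_cong_AE[OF \<Omega>l _ _ wF]) simp
  from has_weak_gradient_unique[OF \<Omega>(1) this weak_gradient_reg_log[of 1]]
  have "AE r in ?L. F' (W r) *\<^sub>R (0 + - dU r) = (\<rho> r / ((\<rho> r)\<^sup>2 + 1)) *\<^sub>R wgrad \<Omega> \<rho> r"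
    by simp
  then show ?thesis
    using eW density(2)
  proof eventually_elim
    case (elim r)
    define s where "s = \<rho> r / ((\<rho> r)\<^sup>2 + 1)"
    have s: "s > 0" using elim(3) by (simp add: s_def add_pos_pos)
    have "F' (W r) = s * \<rho> r" using elim(2) by (simp add: F'_def s_def power2_eq_square)
    then have "s *\<^sub>R (wgrad \<Omega> \<rho> r + \<rho> r *\<^sub>R dU r) = 0"
      using elim(1) by (simp add: s_def[symmetric] scaleR_add_right) (metis add.commute neg_eq_iff_add_eq_0)
    then show ?case using s by simp
  qed
qed

end

section \<open>Stationary states carry no flux\<close>

text \<open>The energy argument. Testing with \<open>reg_log \<epsilon> \<circ> \<rho> + U\<close> instead of \<open>ln \<rho> + U\<close> gives, with
  \<open>\<tau> = \<rho>\<^sup>2 / (\<rho>\<^sup>2 + \<epsilon>)\<close> and \<open>\<nu> = Z2 \<star> a\<close>,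
  \<open>\<integral> \<tau> (a \<bullet> M a / \<rho>) = - \<integral> \<tau> (a \<bullet> \<nu>) - \<integral> (1 - \<tau>) (a \<bullet> \<nabla>U)\<close>. As \<open>\<epsilon>\<close> decreases to zero, \<open>\<tau>\<close> increases to 1; the right-hand
  side converges to \<open>- \<integral> a \<bullet> \<nu>\<close>, and monotone convergence identifies the limit of the left-hand side.\<close>

lemma stationary_flux_zero:
  fixes \<Omega> :: "(real^'n) set"
  assumes \<Omega>: "open \<Omega>" "bounded \<Omega>" and nonempty: "\<Omega> \<noteq> {}"
    and V1: "V1 \<in> H1 \<Omega>" and V2: "V2 \<in> H1 (diff_set \<Omega>)"
    and Z1: "admissible_kernel \<Omega> Z1" and Z2: "admissible_kernel \<Omega> Z2"
    and D: "D_sym_pos_def \<Omega> Z1 \<rho>" and small: "mu_max \<Omega> Z1 \<rho> * ereal (kernel_norm \<Omega> Z2) < 1"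
    and st: "stationary_state \<Omega> V1 V2 Z1 Z2 \<rho> a"
  shows "AE r in lebesgue_on \<Omega>. a r = 0"
proof -
  let ?L = "lebesgue_on \<Omega>"
  have dens: "density_on \<Omega> \<rho>" and aL: "L2_on \<Omega> a" and div: "has_weak_divergence \<Omega> a (\<lambda>_. 0)"
    and tr: "zero_normal_trace \<Omega> a"
    using st by (simp_all add: stationary_state_def solves_system_def)
  interpret potentials \<Omega> V1 V2 \<rho>
    using \<Omega> V1 V2 dens by unfold_locales
  interpret fin: finite_measure "?L" by (rule emeasure_lebesgue_on_finite[OF \<Omega>l \<Omega>(2)])
  have Sl: "diff_set \<Omega> \<in> sets lebesgue" using open_diff_set[OF \<Omega>(1)] by simp
  define M where "M = resistance \<Omega> Z1 \<rho>"
  define \<nu> where "\<nu> = conv_vec \<Omega> Z2 a"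
  define kn where "kn = kernel_norm \<Omega> Z2"
  define I where "I = (LINT r|?L. norm (a r))"
  have ai: "integrable (?L) a" by (rule L2_on_imp_integrable[OF \<Omega>l \<Omega>(2) aL])
  have [measurable]: "a \<in> borel_measurable (?L)" "\<rho> \<in> borel_measurable (?L)"
    using ai density(1) by auto
  have I0: "I \<ge> 0" by (simp add: I_def)
  obtain r0 where r0: "r0 \<in> \<Omega>" using nonempty by blast
  have kn0: "kn \<ge> 0"
    unfolding kn_def using kernel_norm_bound(2)[OF _ diff_setI[OF r0 r0], of Z2] Z2 by (simp add: admissible_kernel_def)
  obtain \<theta> where \<theta>: "0 \<le> \<theta>" "\<theta> < 1" "\<And>r v. r \<in> \<Omega> \<Longrightarrow> kn * (v \<bullet> v) \<le> \<theta> * (v \<bullet> (M r *v v))"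
    unfolding M_def by (rule small_kernel_coercive[OF nonempty D kn0]) (use small kn_def that in auto)
  have Mpos: "v \<bullet> (M r *v v) > 0" if "r \<in> \<Omega>" "v \<noteq> 0" for r v
    using D that inverse_sym_pos_def(2)[of "M r" v] by (simp add: D_sym_pos_def_def D_tensor_def M_def)
  have Mnn: "v \<bullet> (M r *v v) \<ge> 0" if "r \<in> \<Omega>" for r v
    using Mpos[OF that, of v] by (cases "v = 0") auto

  have Z1i: "integrable (lebesgue_on (diff_set \<Omega>)) Z1"
    using Z1 by (intro integrable_bounded_measurable Sl bounded_diff_set \<Omega>) (auto simp: admissible_kernel_def)
  have Mm: "M \<in> borel_measurable (?L)"
    using conv_integrable[OF \<Omega>(1) density(1) Z1i] by (auto simp: M_def resistance_def[abs_def])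
  obtain B where B: "\<And>z. z \<in> diff_set \<Omega> \<Longrightarrow> norm (Z1 z) \<le> B"
    using Z1 by (auto simp: admissible_kernel_def bounded_iff)
  have Mb: "AE r in ?L. norm (M r) \<le> norm (mat 1 :: real^'n^'n) + B * (LINT y|?L. \<bar>\<rho> y\<bar>)"
    using AE_space
  proof eventually_elim
    case (elim r)
    then have "norm (conv \<Omega> Z1 \<rho> r) \<le> B * (LINT y|?L. \<bar>\<rho> y\<bar>)"
      by (intro conv_bound density(1) B) simp_all
    then show ?case
      unfolding M_def resistance_def using norm_triangle_ineq[of "mat 1 :: real^'n^'n" "conv \<Omega> Z1 \<rho> r"] by linarith
  qed
  define Ma where "Ma r = M r *v a r" for r
  have MaL: "L2_on \<Omega> Ma"
    unfolding Ma_def[abs_def] by (rule L2_on_bounded_mult[OF bilinear_matrix_vector_mult Mm Mb aL])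
  have [measurable]: "Ma \<in> borel_measurable (?L)" using MaL by (simp add: L2_on_def)
  have [measurable]: "\<nu> \<in> borel_measurable (?L)"
    unfolding \<nu>_def by (rule conv_vec_measurable[OF \<Omega>(1,2) ai Z2])
  have \<nu>b: "norm (\<nu> r) \<le> kn * I" if "r \<in> \<Omega>" for r
    unfolding \<nu>_def kn_def I_def by (rule conv_vec_bound[OF ai Z2 that])
  have \<nu>L: "L2_on \<Omega> \<nu>"
  proof (rule L2_on_bound)
    show "AE r in ?L. (norm (\<nu> r))\<^sup>2 \<le> (kn * I)\<^sup>2"
      using AE_space by eventually_elim (intro power_mono \<nu>b, simp_all)
  qed simp_all
  \<comment> \<open>this expresses the unknown \<open>\<nabla>\<rho>\<close> through square-integrable fields, up to a factor \<open>\<rho>\<close>\<close>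
  have flux: "AE r in ?L. Ma r + \<rho> r *\<^sub>R \<nu> r = wgrad \<Omega> \<rho> r + \<rho> r *\<^sub>R dU r"
  proof -
    have "AE r in ?L. M r *v a r + \<rho> r *\<^sub>R conv_vec \<Omega> Z2 a r =
        wgrad \<Omega> \<rho> r + \<rho> r *\<^sub>R wgrad \<Omega> V1 r + \<rho> r *\<^sub>R conv \<Omega> (wgrad (diff_set \<Omega>) V2) \<rho> r"
      using st by (simp add: stationary_state_def solves_system_def M_def)
    then show ?thesis
      by eventually_elim (simp add: Ma_def \<nu>_def dU_def scaleR_add_right add.assoc)
  qed

  define \<epsilon> where "\<epsilon> k = 1 / real (Suc k)" for k
  have \<epsilon>: "0 < \<epsilon> k" "\<epsilon> k \<le> 1" for k by (auto simp: \<epsilon>_def)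
  have \<epsilon>0: "\<epsilon> \<longlonglongrightarrow> 0" using LIMSEQ_inverse_real_of_nat by (simp add: \<epsilon>_def[abs_def] inverse_eq_divide)
  have \<epsilon>dec: "\<epsilon> n \<le> \<epsilon> m" if "m \<le> n" for m n using that by (simp add: \<epsilon>_def frac_le)
  define \<eta> where "\<eta> k r = \<rho> r / ((\<rho> r)\<^sup>2 + \<epsilon> k)" for k r
  define \<tau> where "\<tau> k r = (\<rho> r)\<^sup>2 / ((\<rho> r)\<^sup>2 + \<epsilon> k)" for k r
  have pos: "(\<rho> r)\<^sup>2 + \<epsilon> k > 0" for k r by (rule square_add_pos[OF \<epsilon>(1)])
  have \<tau>\<eta>: "\<eta> k r * \<rho> r = \<tau> k r" for k r by (simp add: \<eta>_def \<tau>_def power2_eq_square)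
  have \<tau>01: "0 \<le> \<tau> k r" "\<tau> k r \<le> 1" for k r
    using pos[of r k] \<epsilon>(1)[of k] by (auto simp: \<tau>_def)
  have \<eta>b: "\<bar>\<eta> k r\<bar> \<le> 1 / \<epsilon> k" for k r unfolding \<eta>_def by (rule reg_log_deriv_bound[OF \<epsilon>])
  have [measurable]: "\<eta> k \<in> borel_measurable (?L)" "\<tau> k \<in> borel_measurable (?L)" for k
    unfolding \<eta>_def[abs_def] \<tau>_def[abs_def] by measurable
  have L1: "L2_on \<Omega> (\<lambda>r. \<eta> k r *\<^sub>R Ma r)" for k
    by (rule L2_on_bounded_mult[OF bounded_bilinear_scaleR _ _ MaL, where B="1 / \<epsilon> k"]) (use \<eta>b in auto)
  have L2: "L2_on \<Omega> (\<lambda>r. \<tau> k r *\<^sub>R \<nu> r)" for k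
    by (rule L2_on_bounded_mult[OF bounded_bilinear_scaleR _ _ \<nu>L, where B=1]) (use \<tau>01 in auto)
  have L3: "L2_on \<Omega> (\<lambda>r. (1 - \<tau> k r) *\<^sub>R dU r)" for k
    by (rule L2_on_bounded_mult[OF bounded_bilinear_scaleR _ _ potential(3), where B=1]) (use \<tau>01 in auto)
  have logL: "L2_on \<Omega> (\<lambda>r. reg_log (\<epsilon> k) (\<rho> r))" for k
  proof (rule L2_on_bound)
    have "reg_log (\<epsilon> k) \<in> borel_measurable borel"
      using DERIV_reg_log[OF \<epsilon>(1)] by (intro borel_measurable_continuous_onI continuous_at_imp_continuous_on ballI DERIV_isCont)
    then show "(\<lambda>r. reg_log (\<epsilon> k) (\<rho> r)) \<in> borel_measurable (?L)" by measurable
    show "integrable (?L) (\<lambda>r. (ln (\<epsilon> k))\<^sup>2 + 4 * (1 + \<bar>\<rho> r\<bar>))" using density(1) by auto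
    show "AE r in ?L. (norm (reg_log (\<epsilon> k) (\<rho> r)))\<^sup>2 \<le> (ln (\<epsilon> k))\<^sup>2 + 4 * (1 + \<bar>\<rho> r\<bar>)"
      using reg_log_growth[OF \<epsilon>] by simp
  qed
  let ?G = "\<lambda>k r. \<eta> k r *\<^sub>R Ma r + (\<tau> k r *\<^sub>R \<nu> r + (1 - \<tau> k r) *\<^sub>R dU r)"
  \<comment> \<open>the field is the gradient of \<open>reg_log (\<epsilon> k) \<circ> \<rho> + U\<close> with \<open>\<nabla>\<rho>\<close> eliminated\<close>
  have ortho: "(LINT r|?L. a r \<bullet> ?G k r) = 0" for k
  proof (rule zero_normal_trace_orthogonal[OF \<Omega>(1) div tr])
    show "L2_on \<Omega> (\<lambda>r. reg_log (\<epsilon> k) (\<rho> r) + U r)" by (rule L2_on_add[OF logL potential(2)])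
    show "L2_on \<Omega> (?G k)"
      by (rule L2_on_add[OF L1 L2_on_add[OF L2 L3]])
    have wg: "has_weak_gradient \<Omega> (\<lambda>r. reg_log (\<epsilon> k) (\<rho> r) + U r) (\<lambda>r. \<eta> k r *\<^sub>R wgrad \<Omega> \<rho> r + dU r)"
      unfolding \<eta>_def by (rule has_weak_gradient_add[OF \<Omega>l weak_gradient_reg_log[OF \<epsilon>] potential(1)])
    have "AE r in ?L. \<eta> k r *\<^sub>R wgrad \<Omega> \<rho> r + dU r = ?G k r"
      using flux
    proof eventually_elim
      case (elim r)
      have grad: "wgrad \<Omega> \<rho> r = Ma r + \<rho> r *\<^sub>R \<nu> r - \<rho> r *\<^sub>R dU r" using elim by simp
      show ?case unfolding grad by (simp add: \<tau>\<eta>[symmetric] algebra_simps)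
    qed
    from has_weak_gradient_cong_AE[OF \<Omega>l _ this wg]
    show "has_weak_gradient \<Omega> (\<lambda>r. reg_log (\<epsilon> k) (\<rho> r) + U r) (?G k)"
      by simp
  qed
  note i1 = L2_on_inner_integrable[OF aL L1]
  note i2 = L2_on_inner_integrable[OF aL L2]
  note i3 = L2_on_inner_integrable[OF aL L3]
  have split: "(LINT r|?L. a r \<bullet> (\<eta> k r *\<^sub>R Ma r)) =
      - ((LINT r|?L. a r \<bullet> (\<tau> k r *\<^sub>R \<nu> r)) + (LINT r|?L. a r \<bullet> ((1 - \<tau> k r) *\<^sub>R dU r)))" for k
  proof -
    have "(LINT r|?L. a r \<bullet> (\<eta> k r *\<^sub>R Ma r) + (a r \<bullet> (\<tau> k r *\<^sub>R \<nu> r) + a r \<bullet> ((1 - \<tau> k r) *\<^sub>R dU r))) = 0"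
      using ortho[of k] by (simp only: inner_add_right)
    also have "(LINT r|?L. a r \<bullet> (\<eta> k r *\<^sub>R Ma r) + (a r \<bullet> (\<tau> k r *\<^sub>R \<nu> r) + a r \<bullet> ((1 - \<tau> k r) *\<^sub>R dU r))) =
      (LINT r|?L. a r \<bullet> (\<eta> k r *\<^sub>R Ma r)) +
      ((LINT r|?L. a r \<bullet> (\<tau> k r *\<^sub>R \<nu> r)) + (LINT r|?L. a r \<bullet> ((1 - \<tau> k r) *\<^sub>R dU r)))"
      by (subst Bochner_Integration.integral_add[OF i1 Bochner_Integration.integrable_add[OF i2 i3]])
        (subst Bochner_Integration.integral_add[OF i2 i3], rule refl)
    finally show ?thesis by linarith
  qed
  have \<tau>lim: "AE r in ?L. (\<lambda>k. \<tau> k r) \<longlonglongrightarrow> 1"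
    using density(2)
  proof eventually_elim
    case (elim r)
    have "(\<lambda>k. (\<rho> r)\<^sup>2 / ((\<rho> r)\<^sup>2 + \<epsilon> k)) \<longlonglongrightarrow> (\<rho> r)\<^sup>2 / ((\<rho> r)\<^sup>2 + 0)"
      using elim by (intro tendsto_intros \<epsilon>0) auto
    then show ?case using elim by (simp add: \<tau>_def)
  qed
  have lim2: "(\<lambda>k. LINT r|?L. a r \<bullet> (\<tau> k r *\<^sub>R \<nu> r)) \<longlonglongrightarrow> (LINT r|?L. a r \<bullet> \<nu> r)"
  proof (rule integral_dominated_convergence[where w="\<lambda>r. \<bar>a r \<bullet> \<nu> r\<bar>"])
    show "integrable (?L) (\<lambda>r. \<bar>a r \<bullet> \<nu> r\<bar>)" using L2_on_inner_integrable[OF aL \<nu>L] by simp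
    show "AE r in ?L. (\<lambda>k. a r \<bullet> (\<tau> k r *\<^sub>R \<nu> r)) \<longlonglongrightarrow> a r \<bullet> \<nu> r"
      using \<tau>lim
    proof eventually_elim
      case (elim r)
      from tendsto_mult_right[OF elim, of "a r \<bullet> \<nu> r"] show ?case by simp
    qed
    show "AE r in ?L. norm (a r \<bullet> (\<tau> k r *\<^sub>R \<nu> r)) \<le> \<bar>a r \<bullet> \<nu> r\<bar>" for k
      using \<tau>01 by (intro AE_I2) (simp add: abs_mult mult_left_le_one_le)
  qed measurable
  have [measurable]: "dU \<in> borel_measurable (?L)" using potential(3) by (simp add: L2_on_def)
  have lim3: "(\<lambda>k. LINT r|?L. a r \<bullet> ((1 - \<tau> k r) *\<^sub>R dU r)) \<longlonglongrightarrow> (LINT r|?L. 0)"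
  proof (rule integral_dominated_convergence[where w="\<lambda>r. \<bar>a r \<bullet> dU r\<bar>"])
    show "integrable (?L) (\<lambda>r. \<bar>a r \<bullet> dU r\<bar>)" using L2_on_inner_integrable[OF aL potential(3)] by simp
    show "AE r in ?L. (\<lambda>k. a r \<bullet> ((1 - \<tau> k r) *\<^sub>R dU r)) \<longlonglongrightarrow> 0"
      using \<tau>lim
    proof eventually_elim
      case (elim r)
      have "(\<lambda>k. (1 - \<tau> k r) * (a r \<bullet> dU r)) \<longlonglongrightarrow> (1 - 1) * (a r \<bullet> dU r)"
        by (intro tendsto_intros elim)
      then show ?case by simp
    qed
    show "AE r in ?L. norm (a r \<bullet> ((1 - \<tau> k r) *\<^sub>R dU r)) \<le> \<bar>a r \<bullet> dU r\<bar>" for k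
      using \<tau>01 by (intro AE_I2) (simp add: abs_mult mult_left_le_one_le)
  qed measurable
  define q where "q r = (a r \<bullet> Ma r) / \<rho> r" for r
  have qlim: "(\<lambda>k. LINT r|?L. a r \<bullet> (\<eta> k r *\<^sub>R Ma r)) \<longlonglongrightarrow> - (LINT r|?L. a r \<bullet> \<nu> r)"
    unfolding split using tendsto_minus[OF tendsto_add[OF lim2 lim3]] by simp
  have qmono: "AE r in ?L. mono (\<lambda>k. a r \<bullet> (\<eta> k r *\<^sub>R Ma r))"
    using density(2) AE_space
  proof eventually_elim
    case (elim r)
    show ?case
    proof (rule monoI)
      fix m n :: nat assume mn: "m \<le> n"
      have "\<eta> m r \<le> \<eta> n r"
        unfolding \<eta>_def using elim(1) \<epsilon>dec[OF mn] pos by (intro frac_le) auto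
      then show "a r \<bullet> (\<eta> m r *\<^sub>R Ma r) \<le> a r \<bullet> (\<eta> n r *\<^sub>R Ma r)"
        using Mnn[of r "a r"] elim(2) by (simp add: Ma_def mult_right_mono)
    qed
  qed
  have qpt: "AE r in ?L. (\<lambda>k. a r \<bullet> (\<eta> k r *\<^sub>R Ma r)) \<longlonglongrightarrow> q r"
    using density(2)
  proof eventually_elim
    case (elim r)
    have "(\<lambda>k. \<rho> r / ((\<rho> r)\<^sup>2 + \<epsilon> k) * (a r \<bullet> Ma r)) \<longlonglongrightarrow> \<rho> r / ((\<rho> r)\<^sup>2 + 0) * (a r \<bullet> Ma r)"
      using elim by (intro tendsto_intros \<epsilon>0) auto
    then show ?case using elim by (simp add: \<eta>_def q_def power2_eq_square)
  qed
  have qm: "q \<in> borel_measurable (?L)" unfolding q_def[abs_def] by measurable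
  have qi: "integrable (?L) q" and qI: "(LINT r|?L. q r) = - (LINT r|?L. a r \<bullet> \<nu> r)"
    using integrable_monotone_convergence[OF i1 qmono qpt qlim qm] integral_monotone_convergence[OF i1 qmono qpt qlim qm]
    by auto
  define Q where "Q = (LINT r|?L. q r)"
  have qnn: "AE r in ?L. q r \<ge> 0"
    using density(2) AE_space by eventually_elim (use Mnn in \<open>auto simp: q_def Ma_def\<close>)
  have upper: "Q \<le> kn * I * I"
  proof -
    have "Q \<le> norm (LINT r|?L. a r \<bullet> \<nu> r)" by (simp add: Q_def qI)
    also have "\<dots> \<le> (LINT r|?L. kn * I * norm (a r))"
    proof (rule order_trans[OF integral_norm_bound], rule integral_mono')
      fix r assume "r \<in> space (?L)"
      then have r: "r \<in> \<Omega>" by simp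
      have "norm (a r \<bullet> \<nu> r) \<le> norm (a r) * norm (\<nu> r)" by (simp add: Cauchy_Schwarz_ineq2)
      also have "\<dots> \<le> norm (a r) * (kn * I)" using \<nu>b[OF r] by (rule mult_left_mono) simp
      finally show "norm (a r \<bullet> \<nu> r) \<le> kn * I * norm (a r)" by (simp add: mult.commute)
      show "0 \<le> kn * I * norm (a r)" using kn0 I0 by simp
    qed (use ai in auto)
    also have "\<dots> = kn * I * I" by (simp add: I_def)
    finally show ?thesis .
  qed
  show ?thesis
  proof (cases "I = 0")
    case True
    then have "AE r in ?L. norm (a r) = 0"
      unfolding I_def using ai by (subst (asm) integral_nonneg_eq_0_iff_AE) auto
    then show ?thesis by simp
  next
    case False
    then have Ipos: "I > 0" using I0 by simp
    \<comment> \<open>Cauchy-Schwarz as a weighted AM-GM inequality with the optimal weight \<open>I\<close>; unlike the quotient form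
      it makes sense when \<open>kn = 0\<close> and \<open>|a|\<^sup>2 / \<rho>\<close> is not known to be integrable\<close>
    have pt: "AE r in ?L. 2 * kn * norm (a r) \<le> I * kn * \<rho> r + \<theta> / I * q r"
      using density(2) AE_space
    proof eventually_elim
      case (elim r)
      then have r: "r \<in> \<Omega>" by simp
      have "2 * norm (a r) * (I * \<rho> r) \<le> (I * \<rho> r)\<^sup>2 + (norm (a r))\<^sup>2"
        using sum_squares_bound[of "norm (a r)" "I * \<rho> r"] by simp
      then have "2 * norm (a r) \<le> ((I * \<rho> r)\<^sup>2 + (norm (a r))\<^sup>2) / (I * \<rho> r)"
        using Ipos elim(1) by (simp add: pos_le_divide_eq)
      also have "\<dots> = I * \<rho> r + (norm (a r))\<^sup>2 / (I * \<rho> r)"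
        using Ipos elim(1) by (simp add: add_divide_distrib power2_eq_square)
      finally have "kn * (2 * norm (a r)) \<le> kn * (I * \<rho> r + (norm (a r))\<^sup>2 / (I * \<rho> r))"
        using kn0 by (rule mult_left_mono)
      also have "\<dots> = I * kn * \<rho> r + (kn * (a r \<bullet> a r)) / (I * \<rho> r)"
        by (simp add: algebra_simps dot_square_norm)
      also have "(kn * (a r \<bullet> a r)) / (I * \<rho> r) \<le> (\<theta> * (a r \<bullet> Ma r)) / (I * \<rho> r)"
        using \<theta>(3)[OF r, of "a r"] Ipos elim(1) by (intro divide_right_mono) (auto simp: Ma_def)
      finally show ?case by (simp add: q_def mult_ac)
    qed
    have "(LINT r|?L. 2 * kn * norm (a r)) \<le> (LINT r|?L. I * kn * \<rho> r + \<theta> / I * q r)"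
      by (rule integral_mono_AE) (use ai density(1) qi pt in auto)
    also have "\<dots> = I * kn + \<theta> / I * Q" using density(1,3) qi by (simp add: Q_def)
    also have "(LINT r|?L. 2 * kn * norm (a r)) = 2 * kn * I" by (simp add: I_def)
    finally have "kn * I \<le> \<theta> / I * Q" by (simp add: mult.commute[of kn I])
    then have "kn * I * I \<le> \<theta> * Q" using Ipos by (simp add: field_simps)
    then have "(1 - \<theta>) * Q \<le> 0" using upper by (simp add: algebra_simps)
    then have "Q \<le> 0" using \<theta>(2) by (simp add: mult_le_0_iff)
    moreover have "Q \<ge> 0" unfolding Q_def by (rule integral_nonneg_AE[OF qnn])
    ultimately have "AE r in ?L. q r = 0"
      unfolding Q_def using integral_nonneg_eq_0_iff_AE[OF qi qnn] by simp
    then show ?thesis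
      using density(2) AE_space
    proof eventually_elim
      case (elim r)
      then show ?case using Mpos[of r "a r"] by (auto simp: q_def Ma_def)
    qed
  qed
qed

lemma rest_state:
  assumes \<Omega>: "\<Omega> \<in> sets lebesgue"
    and force: "AE r in lebesgue_on \<Omega>. wgrad \<Omega> \<rho> r + \<rho> r *\<^sub>R wgrad \<Omega> V1 r + \<rho> r *\<^sub>R conv \<Omega> (wgrad (diff_set \<Omega>) V2) \<rho> r = 0"
  shows "solves_system \<Omega> V1 V2 M Z2 \<rho> (\<lambda>_. 0)"
proof -
  have L: "L2_on \<Omega> (\<lambda>_. 0 :: real^'n)" "L2_on \<Omega> (\<lambda>_. 0 :: real)" by (simp_all add: L2_on_def)
  have div: "has_weak_divergence \<Omega> (\<lambda>_. 0) (\<lambda>_. 0)"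
    by (simp add: has_weak_divergence_def locally_integrable_on_def)
  have "zero_normal_trace \<Omega> (\<lambda>_. 0)"
    unfolding zero_normal_trace_def using L div by (intro conjI exI[of _ "\<lambda>_. 0"]) auto
  moreover have "conv_vec \<Omega> Z2 (\<lambda>_. 0) r = 0" for r by (simp add: conv_vec_def)
  ultimately show ?thesis using L div force by (simp add: solves_system_def)
qed

text \<open>At rest the flux terms vanish, so neither the mobility tensor nor the kernels survive in the
  balance of forces; this is the sense in which equilibria do not depend on the kernels.\<close>

lemma equilibrium_density_iff:
  assumes \<Omega>: "\<Omega> \<in> sets lebesgue"
  shows "equilibrium_density \<Omega> V1 V2 Z1 Z2 \<rho> \<longleftrightarrow> density_on \<Omega> \<rho> \<and>
    (AE r in lebesgue_on \<Omega>. wgrad \<Omega> \<rho> r + \<rho> r *\<^sub>R wgrad \<Omega> V1 r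
       + \<rho> r *\<^sub>R conv \<Omega> (wgrad (diff_set \<Omega>) V2) \<rho> r = 0)"
proof -
  have "conv_vec \<Omega> Z2 (\<lambda>_. 0) r = 0" for r by (simp add: conv_vec_def)
  then have "AE r in lebesgue_on \<Omega>. wgrad \<Omega> \<rho> r + \<rho> r *\<^sub>R wgrad \<Omega> V1 r
      + \<rho> r *\<^sub>R conv \<Omega> (wgrad (diff_set \<Omega>) V2) \<rho> r = 0"
    if "solves_system \<Omega> V1 V2 (resistance \<Omega> Z1 \<rho>) Z2 \<rho> (\<lambda>_. 0)"
    using that by (auto simp: solves_system_def elim!: eventually_mono)
  then show ?thesis
    using rest_state[OF \<Omega>] by (auto simp: equilibrium_density_def stationary_state_def)
qed

theorem corollary6p7:
  fixes \<Omega> :: "(real^'n) set"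
    and V1 V2 :: "real^'n \<Rightarrow> real"
    and Z1 Z2 :: "real^'n \<Rightarrow> real^'n^'n"
    and \<rho> :: "real^'n \<Rightarrow> real"
  assumes domain: "bounded_C1_domain \<Omega>"
    and V1: "V1 \<in> H1 \<Omega>"
    and V2: "V2 \<in> H1 (diff_set \<Omega>)"
    and V2_even: "\<forall>z\<in>diff_set \<Omega>. V2 (- z) = V2 z"
    and Z1: "admissible_kernel \<Omega> Z1"
    and Z2: "admissible_kernel \<Omega> Z2"
    and critical: "critical_point \<Omega> V1 V2 \<rho>"
    and D_spd: "D_sym_pos_def \<Omega> Z1 \<rho>"
    and small: "mu_max \<Omega> Z1 \<rho> * ereal (kernel_norm \<Omega> Z2) < 1"
  shows
    \<comment> \<open>(1)\<close>
    "equilibrium_density \<Omega> V1 V2 Z1 Z2 \<rho>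
     \<comment> \<open>(2) independence of \<open>Z1\<close>, \<open>Z2\<close>, and of the tensor \<open>D\<close>\<close>
     \<and> (\<forall>Z1' Z2'. admissible_kernel \<Omega> Z1' \<and> admissible_kernel \<Omega> Z2' \<longrightarrow>
          equilibrium_density \<Omega> V1 V2 Z1' Z2' \<rho>
          \<and> {\<rho>'. equilibrium_density \<Omega> V1 V2 Z1' Z2' \<rho>'}
              = {\<rho>'. equilibrium_density \<Omega> V1 V2 Z1 Z2 \<rho>'})
     \<and> (\<forall>D' Z2'. (\<forall>r\<in>\<Omega>. sym_pos_def (D' r)) \<and> admissible_kernel \<Omega> Z2' \<longrightarrow>
          solves_system \<Omega> V1 V2 (\<lambda>r. matrix_inv (D' r)) Z2' \<rho> (\<lambda>_. 0))
     \<comment> \<open>(3)\<close>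
     \<and> (\<forall>a. stationary_state \<Omega> V1 V2 Z1 Z2 \<rho> a \<longrightarrow> (AE r in lebesgue_on \<Omega>. a r = 0))
     \<comment> \<open>no stationary density is advected by a nonzero flux; stationary states are equilibria\<close>
     \<and> (\<forall>\<rho>' a'. stationary_state \<Omega> V1 V2 Z1 Z2 \<rho>' a' \<and> D_sym_pos_def \<Omega> Z1 \<rho>' \<and>
          mu_max \<Omega> Z1 \<rho>' * ereal (kernel_norm \<Omega> Z2) < 1 \<longrightarrow>
          (AE r in lebesgue_on \<Omega>. a' r = 0) \<and> equilibrium_density \<Omega> V1 V2 Z1 Z2 \<rho>')"
proof -
  let ?L = "lebesgue_on \<Omega>"
  have dom: "open \<Omega>" "bounded \<Omega>" "\<Omega> \<noteq> {}"
    using domain by (simp_all add: bounded_C1_domain_def)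
  have \<Omega>l: "\<Omega> \<in> sets lebesgue" using dom(1) by simp
  have dens: "density_on \<Omega> \<rho>" using critical by (simp add: critical_point_def)
  interpret P: potentials \<Omega> V1 V2 \<rho>
    using dom V1 V2 dens by unfold_locales
  obtain c where "AE r in ?L. free_energy_deriv \<Omega> V1 V2 \<rho> r = c"
    using critical unfolding critical_point_def by (elim conjE exE)
  then have "AE r in ?L. wgrad \<Omega> \<rho> r + \<rho> r *\<^sub>R P.dU r = 0"
    by (rule P.critical_gradient)
  then have balance: "AE r in ?L. wgrad \<Omega> \<rho> r + \<rho> r *\<^sub>R wgrad \<Omega> V1 r
      + \<rho> r *\<^sub>R conv \<Omega> (wgrad (diff_set \<Omega>) V2) \<rho> r = 0"
    by eventually_elim (simp add: P.dU_def scaleR_add_right add.assoc)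
  have equilibrium: "equilibrium_density \<Omega> V1 V2 Z1' Z2' \<rho>" for Z1' Z2'
    using dens balance by (simp add: equilibrium_density_iff[OF \<Omega>l])
  have same_equilibria: "{\<rho>'. equilibrium_density \<Omega> V1 V2 Z1' Z2' \<rho>'} = {\<rho>'. equilibrium_density \<Omega> V1 V2 Z1 Z2 \<rho>'}"
    for Z1' Z2' by (simp add: equilibrium_density_iff[OF \<Omega>l])
  have any_tensor: "solves_system \<Omega> V1 V2 M Z2' \<rho> (\<lambda>_. 0)" for M Z2'
    by (rule rest_state[OF \<Omega>l balance])
  have no_flux: "AE r in ?L. a r = 0"
    if "stationary_state \<Omega> V1 V2 Z1 Z2 \<rho>' a" "D_sym_pos_def \<Omega> Z1 \<rho>'"
      "mu_max \<Omega> Z1 \<rho>' * ereal (kernel_norm \<Omega> Z2) < 1" for \<rho>' a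
    by (rule stationary_flux_zero[OF dom V1 V2 Z1 Z2 that(2,3,1)])
  have stationary_equilibrium: "equilibrium_density \<Omega> V1 V2 Z1 Z2 \<rho>'"
    if st: "stationary_state \<Omega> V1 V2 Z1 Z2 \<rho>' a" and zero: "AE r in ?L. a r = 0" for \<rho>' a
  proof -
    have conv0: "conv_vec \<Omega> Z2 a r = 0" for r
    proof -
      have "conv_vec \<Omega> Z2 a r = (LINT r'|?L. 0)"
        unfolding conv_vec_def
        by (rule lebesgue_on_cong_AE(3)[OF \<Omega>l]) (use zero in eventually_elim, simp)
      then show ?thesis by simp
    qed
    have "AE r in ?L. resistance \<Omega> Z1 \<rho>' r *v a r + \<rho>' r *\<^sub>R conv_vec \<Omega> Z2 a r =
        wgrad \<Omega> \<rho>' r + \<rho>' r *\<^sub>R wgrad \<Omega> V1 r + \<rho>' r *\<^sub>R conv \<Omega> (wgrad (diff_set \<Omega>) V2) \<rho>' r"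
      using st by (simp add: stationary_state_def solves_system_def)
    then have "AE r in ?L. wgrad \<Omega> \<rho>' r + \<rho>' r *\<^sub>R wgrad \<Omega> V1 r
        + \<rho>' r *\<^sub>R conv \<Omega> (wgrad (diff_set \<Omega>) V2) \<rho>' r = 0"
      using zero by eventually_elim (simp add: conv0)
    then show ?thesis
      using st by (simp add: equilibrium_density_iff[OF \<Omega>l] stationary_state_def)
  qed
  show ?thesis
    using equilibrium same_equilibria any_tensor no_flux[OF _ D_spd small] no_flux stationary_equilibrium
    by (intro conjI allI impI) (elim conjE, assumption | blast)+
qed

end
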